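(* Fix constants $\sigma,\delta>0$. There are constants $c_0,c_1,c_2>0$ (depending only on $\sigma,\delta$) such that for all $n,d$ and every integer $R$ with $1\le R\le c_0\sqrt{\log n}$ there exist a number $L\ge c_1R^2/\log n$ and an efficiently sampleable probability distribution $\mathcal D$ over lists of at most $R$ vectors in $\mathbb R^d$ with the following property. Let $\mathbf v_1,\dots,\mathbf v_n\in\mathbb R^d$ be distinct points with $\|\mathbf v_x\|\le 1$ for all $x$ and $\sum_{x<y}\|\mathbf v_x-\mathbf v_y\|^2=n^2$. If $M$ is a $(\sigma,\delta)$-matching-cover for $\{\mathbf v_x\}$, then the expected number of pairs $(x,y)$ with $(x,y)\in M(\mathbf u_1,\dots,\mathbf u_r)$ and $\|\mathbf v_x-\mathbf v_y\|^2\ge L$, where $(\mathbf u_1,\dots,\mathbf u_r)\sim\mathcal D$, is at least $e^{-c_2R^2}n$.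
   Context: Vertices are $[n]$, with embedding $x\mapsto\mathbf v_x\in\mathbb R^d$. A directed matching on $[n]$ is a set of ordered pairs $(x,y)$ of distinct vertices in which every vertex occurs in at most one pair. A $(\sigma,\delta)$-matching-cover for $\{\mathbf v_x\}$ is a family $\{M(\mathbf u)\}_{\mathbf u\in\mathbb R^d}$ of directed matchings such that: (stretch) $(\mathbf v_y-\mathbf v_x)\cdot\mathbf u\ge\sigma$ for all $(x,y)\in M(\mathbf u)$; (skew-symmetry) $(x,y)\in M(\mathbf u)$ iff $(y,x)\in M(-\mathbf u)$; (largeness) $\mathbb E_{\mathbf u}[|M(\mathbf u)|]\ge\delta n$, where $\mathbf u$ is a standard Gaussian vector in $\mathbb R^d$. For vectors $\mathbf u_1,\dots,\mathbf u_R$, $M(\mathbf u_1,\dots,\mathbf u_R)$ is the directed graph containing edge $(x,y)$ iff there exist $x_0=x,x_1,\dots,x_R=y$ with $(x_{r-1},x_r)\in M(\mathbf u_r)$ for all $r\le R$; $M()$ (empty list) consists of a self-loop at every vertex. *)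

theory Defs
  imports "HOL-Probability.Probability"
begin

text \<open>
  The constants of the theorem are chosen before the dimension \<open>d\<close>, so \<open>d\<close> cannot be a type.
  A point of \<open>\<real>\<^sup>d\<close> is a function on \<open>{..<d}\<close>, extended by \<^term>\<open>undefined\<close>.
\<close>

type_synonym rvec = "nat \<Rightarrow> real"

definition vec_space :: "nat \<Rightarrow> rvec measure" where
  "vec_space d = (\<Pi>\<^sub>M i\<in>{..<d}. borel)"

definition vdot :: "nat \<Rightarrow> rvec \<Rightarrow> rvec \<Rightarrow> real" where
  "vdot d a b = (\<Sum>i<d. a i * b i)"

definition vnorm :: "nat \<Rightarrow> rvec \<Rightarrow> real" where
  "vnorm d a = L2_set a {..<d}"

definition vminus :: "nat \<Rightarrow> rvec \<Rightarrow> rvec \<Rightarrow> rvec" where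
  "vminus d a b = (\<lambda>i\<in>{..<d}. a i - b i)"

definition vuminus :: "nat \<Rightarrow> rvec \<Rightarrow> rvec" where
  "vuminus d a = (\<lambda>i\<in>{..<d}. - a i)"

definition std_gaussian :: "real measure" where
  "std_gaussian = density lborel (\<lambda>x. ennreal (std_normal_density x))"

definition gaussian_vec :: "nat \<Rightarrow> rvec measure" where
  "gaussian_vec d = (\<Pi>\<^sub>M i\<in>{..<d}. std_gaussian)"

definition directed_matching :: "nat \<Rightarrow> (nat \<times> nat) set \<Rightarrow> bool" where
  "directed_matching n E \<longleftrightarrow>
     E \<subseteq> {1..n} \<times> {1..n} \<and>
     (\<forall>(x, y)\<in>E. x \<noteq> y) \<and>
     (\<forall>z. \<forall>e\<in>E. \<forall>e'\<in>E. z \<in> {fst e, snd e} \<longrightarrow> z \<in> {fst e', snd e'} \<longrightarrow> e = e')"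

text \<open>
  The last conjunct before largeness says that \<open>u \<mapsto> M u\<close> is a random graph; without it the
  expectation in the largeness condition has no meaning.
\<close>

definition matching_cover ::
  "nat \<Rightarrow> nat \<Rightarrow> (nat \<Rightarrow> rvec) \<Rightarrow> real \<Rightarrow> real \<Rightarrow> (rvec \<Rightarrow> (nat \<times> nat) set) \<Rightarrow> bool" where
  "matching_cover n d v \<sigma> \<delta> M \<longleftrightarrow>
     (\<forall>u\<in>space (vec_space d). directed_matching n (M u)) \<and>
     (\<forall>u\<in>space (vec_space d). \<forall>(x, y)\<in>M u. vdot d (vminus d (v y) (v x)) u \<ge> \<sigma>) \<and>
     (\<forall>u\<in>space (vec_space d). \<forall>x y. (x, y) \<in> M u \<longleftrightarrow> (y, x) \<in> M (vuminus d u)) \<and>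
     (\<forall>x y. {u \<in> space (vec_space d). (x, y) \<in> M u} \<in> sets (vec_space d)) \<and>
     (\<integral>u. real (card (M u)) \<partial>gaussian_vec d) \<ge> \<delta> * real n"

definition chain_graph ::
  "nat \<Rightarrow> (rvec \<Rightarrow> (nat \<times> nat) set) \<Rightarrow> rvec list \<Rightarrow> (nat \<times> nat) set" where
  "chain_graph n M us =
     {(x, y). x \<in> {1..n} \<and> y \<in> {1..n} \<and>
        (\<exists>p. p 0 = x \<and> p (length us) = y \<and>
             (\<forall>r<length us. (p r, p (Suc r)) \<in> M (us ! r)))}"

text \<open>The disjoint union of the powers \<open>S\<^sup>r\<close>: a set of lists is measurable iff each of its
  fixed-length parts is.\<close>

definition list_space :: "'a measure \<Rightarrow> 'a list measure" where
  "list_space S = sigma (lists (space S))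
     {A. A \<subseteq> lists (space S) \<and>
         (\<forall>r. {f \<in> space (\<Pi>\<^sub>M i\<in>{..<r}. S). map f [0..<r] \<in> A} \<in> sets (\<Pi>\<^sub>M i\<in>{..<r}. S))}"

lemma space_list_space: "space (list_space S) = lists (space S)"
  unfolding list_space_def by (rule space_measure_of) auto

lemma sets_list_space:
  "sets (list_space S) =
     {A. A \<subseteq> lists (space S) \<and>
         (\<forall>r. {f \<in> space (\<Pi>\<^sub>M i\<in>{..<r}. S). map f [0..<r] \<in> A} \<in> sets (\<Pi>\<^sub>M i\<in>{..<r}. S))}"
  (is "_ = ?\<A>")
proof -
  have "sigma_algebra (lists (space S)) ?\<A>"
  proof (rule sigma_algebra_iff2[THEN iffD2], intro conjI ballI allI impI)
    show "?\<A> \<subseteq> Pow (lists (space S))" by auto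
    show "{} \<in> ?\<A>" by auto
  next
    fix A assume A: "A \<in> ?\<A>"
    have "{f \<in> space (\<Pi>\<^sub>M i\<in>{..<r}. S). map f [0..<r] \<in> lists (space S) - A} =
        space (\<Pi>\<^sub>M i\<in>{..<r}. S) - {f \<in> space (\<Pi>\<^sub>M i\<in>{..<r}. S). map f [0..<r] \<in> A}" for r
      by (auto simp: space_PiM PiE_def Pi_def)
    with A show "lists (space S) - A \<in> ?\<A>" by auto
  next
    fix A :: "nat \<Rightarrow> 'a list set" assume A: "range A \<subseteq> ?\<A>"
    have "{f \<in> space (\<Pi>\<^sub>M i\<in>{..<r}. S). map f [0..<r] \<in> (\<Union>k. A k)} =
        (\<Union>k. {f \<in> space (\<Pi>\<^sub>M i\<in>{..<r}. S). map f [0..<r] \<in> A k})" for r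
      by auto
    moreover have "(\<Union>k. {f \<in> space (\<Pi>\<^sub>M i\<in>{..<r}. S). map f [0..<r] \<in> A k})
        \<in> sets (\<Pi>\<^sub>M i\<in>{..<r}. S)" for r
      using A by (intro sets.countable_UN) auto
    moreover have "(\<Union>k. A k) \<subseteq> lists (space S)" using A by blast
    ultimately show "(\<Union>k. A k) \<in> ?\<A>" by simp
  qed
  then show ?thesis
    unfolding list_space_def by (rule sigma_algebra.sets_measure_of_eq)
qed

text \<open>
  Model of efficient sampling: a randomized real RAM. An algorithm is a while program over natural-number variables (for indices and counters) and an
  indirectly addressed memory of real cells. Real operations, comparisons and draws from
  \<open>N(0,1)\<close> and from the uniform distribution on \<open>[0,1]\<close> have unit cost. To exclude the
  known abuses of unit-cost models there is no multiplication of natural numbers (so that after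
  \<open>t\<close> steps they have \<open>O(t)\<close> bits more than the input), no rounding of reals to naturals, and
  all constants in a program are rational.
\<close>

record ram_state =
  nvar :: "nat \<Rightarrow> nat"
  cell :: "nat \<Rightarrow> real"
  tpos :: nat

datatype nexp = NConst nat | NVar nat | NAdd nexp nexp | NSub nexp nexp

datatype rexp =
    RConst rat | RNat nexp | Cell nexp
  | RAdd rexp rexp | RSub rexp rexp | RMul rexp rexp | RDiv rexp rexp | RSqrt rexp

datatype test = NLess nexp nexp | RLess rexp rexp | TNot test | TAnd test test

datatype prog =
    Skip
  | NAssign nat nexp
  | RAssign nexp rexp
  | DrawGauss nexp
  | DrawUnif nexp
  | Seq prog prog
  | Cond test prog prog
  | While test prog

fun nval :: "nexp \<Rightarrow> ram_state \<Rightarrow> nat" where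
  "nval (NConst k) s = k"
| "nval (NVar i) s = nvar s i"
| "nval (NAdd a b) s = nval a s + nval b s"
| "nval (NSub a b) s = nval a s - nval b s"

fun rval :: "rexp \<Rightarrow> ram_state \<Rightarrow> real" where
  "rval (RConst q) s = of_rat q"
| "rval (RNat a) s = real (nval a s)"
| "rval (Cell a) s = cell s (nval a s)"
| "rval (RAdd e f) s = rval e s + rval f s"
| "rval (RSub e f) s = rval e s - rval f s"
| "rval (RMul e f) s = rval e s * rval f s"
| "rval (RDiv e f) s = rval e s / rval f s"
| "rval (RSqrt e) s = sqrt (rval e s)"

fun tval :: "test \<Rightarrow> ram_state \<Rightarrow> bool" where
  "tval (NLess a b) s = (nval a s < nval b s)"
| "tval (RLess e f) s = (rval e s < rval f s)"
| "tval (TNot b) s = (\<not> tval b s)"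
| "tval (TAnd b c) s = (tval b s \<and> tval c s)"

text \<open>Entry \<open>k\<close> of the random tape provides the \<open>k\<close>-th draw, in both flavours.\<close>

type_synonym tape = "nat \<Rightarrow> real \<times> real"

definition random_tape :: "tape measure" where
  "random_tape = (\<Pi>\<^sub>M k\<in>UNIV. std_gaussian \<Otimes>\<^sub>M uniform_measure lborel {0..1})"

text \<open>\<open>run \<omega> c s t s'\<close>: on tape \<open>\<omega>\<close>, program \<open>c\<close> started in \<open>s\<close> halts in \<open>s'\<close> after \<open>t\<close> steps.\<close>

inductive run :: "tape \<Rightarrow> prog \<Rightarrow> ram_state \<Rightarrow> nat \<Rightarrow> ram_state \<Rightarrow> bool" for \<omega> :: tape where
  run_Skip: "run \<omega> Skip s 1 s"
| run_NAssign: "run \<omega> (NAssign i a) s 1 (s\<lparr>nvar := (nvar s)(i := nval a s)\<rparr>)"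
| run_RAssign: "run \<omega> (RAssign a e) s 1 (s\<lparr>cell := (cell s)(nval a s := rval e s)\<rparr>)"
| run_DrawGauss: "run \<omega> (DrawGauss a) s 1
    (s\<lparr>cell := (cell s)(nval a s := fst (\<omega> (tpos s))), tpos := Suc (tpos s)\<rparr>)"
| run_DrawUnif: "run \<omega> (DrawUnif a) s 1
    (s\<lparr>cell := (cell s)(nval a s := snd (\<omega> (tpos s))), tpos := Suc (tpos s)\<rparr>)"
| run_Seq: "run \<omega> c1 s t1 s' \<Longrightarrow> run \<omega> c2 s' t2 s'' \<Longrightarrow> run \<omega> (Seq c1 c2) s (t1 + t2) s''"
| run_CondT: "tval b s \<Longrightarrow> run \<omega> c1 s t s' \<Longrightarrow> run \<omega> (Cond b c1 c2) s (Suc t) s'"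
| run_CondF: "\<not> tval b s \<Longrightarrow> run \<omega> c2 s t s' \<Longrightarrow> run \<omega> (Cond b c1 c2) s (Suc t) s'"
| run_WhileF: "\<not> tval b s \<Longrightarrow> run \<omega> (While b c) s 1 s"
| run_WhileT: "tval b s \<Longrightarrow> run \<omega> c s t1 s' \<Longrightarrow> run \<omega> (While b c) s' t2 s'' \<Longrightarrow>
    run \<omega> (While b c) s (Suc (t1 + t2)) s''"

inductive_cases run_elims:
  "run \<omega> Skip s t s'" "run \<omega> (NAssign i a) s t s'" "run \<omega> (RAssign a e) s t s'"
  "run \<omega> (DrawGauss a) s t s'" "run \<omega> (DrawUnif a) s t s'" "run \<omega> (Seq c1 c2) s t s'"
  "run \<omega> (Cond b c1 c2) s t s'" "run \<omega> (While b c) s t s'"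

lemma run_deterministic:
  "run \<omega> c s t s' \<Longrightarrow> run \<omega> c s r s'' \<Longrightarrow> r = t \<and> s'' = s'"
proof (induction arbitrary: r s'' rule: run.induct)
  case (run_Seq c1 s t1 s' c2 t2 s'')
  from run_Seq.prems show ?case
    by (rule run_elims(6)) (use run_Seq.IH in blast)
next
  case (run_CondT b s c1 t s' c2)
  from run_CondT.prems show ?case
    by (rule run_elims(7)) (use run_CondT in blast)+
next
  case (run_CondF b s c2 t s' c1)
  from run_CondF.prems show ?case
    by (rule run_elims(7)) (use run_CondF in blast)+
next
  case (run_WhileF b s c)
  from run_WhileF.prems show ?case
    by (rule run_elims(8)) (use run_WhileF in auto)
next
  case (run_WhileT b s c t1 s' t2 s'')
  from run_WhileT.prems show ?case
    by (rule run_elims(8)) (use run_WhileT in blast)+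
qed (auto elim: run_elims)

text \<open>
  The input \<open>(n, d, R)\<close> is passed in variables 0, 1, 2. On halting, variable 0 holds the number
  of output vectors, which are stored one after the other from cell 0 on.
\<close>

definition ram_init :: "nat \<Rightarrow> nat \<Rightarrow> nat \<Rightarrow> ram_state" where
  "ram_init n d R =
     \<lparr>nvar = (\<lambda>_. 0)(0 := n, 1 := d, 2 := R), cell = (\<lambda>_. 0), tpos = 0\<rparr>"

definition ram_output :: "nat \<Rightarrow> ram_state \<Rightarrow> rvec list" where
  "ram_output d s = map (\<lambda>k. \<lambda>i\<in>{..<d}. cell s (k * d + i)) [0..<nvar s 0]"

text \<open>\<open>D\<close> is the law of the output of \<open>P\<close> on input \<open>(n, d, R)\<close>, and \<open>P\<close> halts within \<open>T\<close> steps
  whatever the random draws are.\<close>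

definition samples_within ::
  "prog \<Rightarrow> nat \<Rightarrow> nat \<Rightarrow> nat \<Rightarrow> nat \<Rightarrow> rvec list measure \<Rightarrow> bool" where
  "samples_within P n d R T D \<longleftrightarrow>
     (\<exists>f. f \<in> random_tape \<rightarrow>\<^sub>M list_space (vec_space d) \<and>
          (\<forall>\<omega>\<in>space random_tape.
             \<exists>t s. t \<le> T \<and> run \<omega> P (ram_init n d R) t s \<and> f \<omega> = ram_output d s) \<and>
          D = distr random_tape (list_space (vec_space d)) f)"

end

theory Submission
  imports Defs "HOL-Real_Asymp.Real_Asymp"
begin

text \<open>
  The list consists of the first \<open>r\<close> vectors of an Ornstein--Uhlenbeck chain
  \<open>u\<^sub>0 = g\<^sub>0\<close>, \<open>u\<^sub>k\<^sub>+\<^sub>1 = \<rho> u\<^sub>k + \<surd>(1 - \<rho>\<^sup>2) g\<^sub>k\<^sub>+\<^sub>1\<close> of Gaussian vectors with \<open>\<rho> = 1 - 1/R\<close>,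
  where \<open>r\<close> is uniform in \<open>{1..R}\<close>.

  Many walks survive: dimension-free reverse hypercontractivity,
  \<open>(E F(X))\<^sup>a (E G(Y))\<^sup>a \<le> E F(X)\<^sup>a G(Y)\<^sup>a\<close> for Gaussian vectors with correlation \<open>\<rho> = 1 - 1/a\<close>,
  gives \<open>\<integral>\<^sub>A (T f)\<^bsup>1/a\<^esup> \<ge> \<gamma>(A)\<^sup>2 \<integral> f\<^bsup>1/a\<^esup>\<close> for the noise operator \<open>T\<close>. On a subset of the
  vertices with in-degrees at least \<open>\<delta>/4\<close>, the sum over the vertices of the \<open>1/a\<close>-moments of the
  conditional survival probabilities therefore drops by at most a constant factor per step, and with
  \<open>a = R\<close> the expected number of walks of length \<open>R\<close> is at least \<open>e\<^bsup>-O(R\<^sup>2)\<^esup> n\<close>. The inequality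
  tensorizes; in dimension one it is the central limit of a two-point inequality, which for integral
  \<open>a\<close> follows from the binomial theorem and Bernoulli's inequality.

  Few walks stay near their starting point: if a walk of length \<open>R\<close> stays within distance \<open>\<surd>L\<close> of
  it, summation by parts writes its total stretch, which is at least \<open>R\<sigma>\<close>, as a sum of inner products
  \<open>z \<cdot> u\<^sub>k\<close> with \<open>\<parallel>z\<parallel>\<^sup>2 < L\<close>, controlled by a union bound over the vertices, and of a martingale of
  variance \<open>O(L)\<close>. For \<open>L = c R\<^sup>2 / log n\<close> both are large with probability at most \<open>2 n\<^bsup>-2\<^esup>\<close>.
  All other surviving walks contain a prefix that ends at distance at least \<open>\<surd>L\<close>.
\<close>

section \<open>A power inequality for the simple random walk\<close>

text \<open>Two demands fix the correlation. Equal directions admit no walk of length two, since in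
  a matching no vertex has both an incoming and an outgoing edge. Independent directions would make
  the martingale variance of order \<open>R L\<close>, and the same estimate would only reach
  \<open>L\<close> of order \<open>R / log n\<close>; with \<open>1 - \<rho> = 1/R\<close> the
  \<open>R\<close> increments have total variance at most \<open>2 L\<close>. The power inequality,
  in turn, holds at \<open>1 - \<rho> = 1/a\<close> for the exponent \<open>a\<close>. A step then
  costs a factor \<open>\<beta>^2\<close> in the \<open>1/a\<close>-moment, with
  \<open>\<beta>\<close> the lower bound on in-degrees, and the return to the first moment by Jensen
  raises \<open>\<beta>^(2 R)\<close> to the power \<open>a\<close>. The choice \<open>a = R\<close>
  meets both demands and produces the exponent of order \<open>R^2\<close>. The time at which a walk
  leaves its ball is not known in advance. Drawing the length at random loses only a factor
  \<open>R\<close>, which the exponential bound absorbs.\<close>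

text \<open>Odd orders cancel and even orders are nonnegative, so the terms of order 0 and 2 form a
  lower bound. The \<open>t^2\<close> coefficient is the one that must balance Bernoulli's
  inequality in the next lemma.\<close>

lemma sum_even_binomials_ge:
  fixes t :: real assumes "0 \<le> t" "a \<ge> 1"
  shows "(1 + t) ^ (2*a) + (1 - t) ^ (2*a) \<ge> 2 + 2 * real a * (2 * real a - 1) * t\<^sup>2"
proof -
  define c where "c k = real ((2*a) choose k) * (t ^ k + (- t) ^ k)" for k
  have nn: "c k \<ge> 0" for k
    using assms by (cases "even k") (auto simp: c_def)
  have "(1 + t) ^ (2*a) + (1 - t) ^ (2*a) = (\<Sum>k\<le>2*a. c k)"
    using binomial_ring[of t 1 "2*a"] binomial_ring[of "-t" 1 "2*a"]
    by (simp add: c_def algebra_simps sum.distrib)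
  also have "\<dots> \<ge> sum c {0,2}"
    using nn assms by (intro sum_mono2) auto
  finally have "sum c {0,2} \<le> (1 + t) ^ (2*a) + (1 - t) ^ (2*a)" .
  moreover have "real ((2*a) choose 2) = real a * (2 * real a - 1)"
  proof -
    have "(2*a) choose 2 = a * (2*a - 1)" by (simp add: choose_two)
    then show ?thesis using assms by (simp add: of_nat_diff)
  qed
  moreover have "sum c {0,2} = 2 + 2 * real ((2*a) choose 2) * t\<^sup>2" by (simp add: c_def)
  ultimately show ?thesis by (simp add: mult.assoc)
qed

text \<open>With \<open>p = 1 + t\<close>, \<open>q = 1 - t\<close> the difference of the quadratic
  terms is a nonnegative combination of \<open>p^(2a) + q^(2a)\<close> and \<open>p^a * q^a\<close>.
  Bounding the first by the binomial theorem and the second by Bernoulli, the \<open>t^2\<close>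
  terms cancel exactly at \<open>\<rho> = 1 - 1/a\<close>; this is the origin of that value.\<close>

lemma two_point_diag:
  fixes p q :: real and a :: nat
  defines "\<rho> \<equiv> 1 - 1 / real a"
  assumes "0 \<le> p" "0 \<le> q" "p + q = 2" "a \<ge> 1"
  shows "1 + \<rho> * ((p^a - q^a)/2)\<^sup>2 \<le> ((p^a + q^a)/2)\<^sup>2"
proof -
  have main: "1 + \<rho> * ((p^a - q^a)/2)\<^sup>2 \<le> ((p^a + q^a)/2)\<^sup>2"
    if pq: "0 \<le> q" "q \<le> p" "p + q = 2" for p q :: real
  proof -
    define t where "t = p - 1"
    have t: "0 \<le> t" "t \<le> 1" "p = 1 + t" "q = 1 - t" using pq by (auto simp: t_def)
    have 1: "p ^ (2*a) + q ^ (2*a) \<ge> 2 + 2 * real a * (2 * real a - 1) * t\<^sup>2"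
      using sum_even_binomials_ge[OF t(1) \<open>a \<ge> 1\<close>] t by simp
    have "1 + real a * (- t\<^sup>2) \<le> (1 + (- t\<^sup>2)) ^ a"
      using t by (intro Bernoulli_inequality) (auto simp: power_le_one)
    also have "1 + (- t\<^sup>2) = p * q" unfolding t(3,4) by (simp add: algebra_simps power2_eq_square)
    finally have 2: "1 - real a * t\<^sup>2 \<le> p ^ a * q ^ a" by (simp add: power_mult_distrib)
    have r: "1 - \<rho> = 1 / real a" "1 + \<rho> = (2 * real a - 1) / real a"
      using \<open>a \<ge> 1\<close> by (auto simp: \<rho>_def field_simps)
    have "((p^a + q^a)/2)\<^sup>2 - \<rho> * ((p^a - q^a)/2)\<^sup>2
       = (1 - \<rho>) / 4 * (p ^ (2*a) + q ^ (2*a)) + (1 + \<rho>) / 2 * (p ^ a * q ^ a)"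
      unfolding power_mult[of _ a 2, unfolded mult.commute[of a]] by (simp add: power2_eq_square field_simps)
    also have "\<dots> \<ge> (1 - \<rho>) / 4 * (2 + 2 * real a * (2 * real a - 1) * t\<^sup>2) + (1 + \<rho>) / 2 * (1 - real a * t\<^sup>2)"
      using r \<open>a \<ge> 1\<close> by (intro add_mono mult_left_mono[OF 1] mult_left_mono[OF 2]) auto
    also have "(1 - \<rho>) / 4 * (2 + 2 * real a * (2 * real a - 1) * t\<^sup>2) + (1 + \<rho>) / 2 * (1 - real a * t\<^sup>2) = 1"
      unfolding r using \<open>a \<ge> 1\<close> by (simp add: field_simps)
    finally show ?thesis by simp
  qed
  show ?thesis
  proof (cases "q \<le> p")
    case True then show ?thesis using main assms by blast
  next
    case False
    have "((p^a - q^a)/2)\<^sup>2 = ((q^a - p^a)/2)\<^sup>2" by (simp add: power2_eq_square field_simps)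
    then show ?thesis using main[of p q] False assms by (simp add: add.commute)
  qed
qed

text \<open>By homogeneity both means may be normalised to 1. In terms of the half sums
  \<open>A\<close>, \<open>B\<close> and half differences \<open>A'\<close>, \<open>B'\<close> of
  the powers, the right side becomes \<open>A * B + \<rho> * A' * B'\<close>, and Cauchy--Schwarz
  reduces the claim to the diagonal case for each pair.\<close>

lemma two_point_inequality:
  fixes p q r s :: real and a :: nat
  defines "\<rho> \<equiv> 1 - 1 / real a"
  assumes nn: "0 \<le> p" "0 \<le> q" "0 \<le> r" "0 \<le> s" and "a \<ge> 1"
  shows "((p + q)/2)^a * ((r + s)/2)^a
     \<le> (1 + \<rho>)/4 * (p^a * r^a + q^a * s^a) + (1 - \<rho>)/4 * (p^a * s^a + q^a * r^a)"
proof (cases "p + q = 0 \<or> r + s = 0")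
  case True
  have "0 \<le> \<rho>" "\<rho> \<le> 1" using \<open>a \<ge> 1\<close> by (auto simp: \<rho>_def)
  moreover have "((p + q)/2)^a * ((r + s)/2)^a = 0" using True \<open>a \<ge> 1\<close> by auto
  ultimately show ?thesis using nn by (simp only:) (intro add_nonneg_nonneg mult_nonneg_nonneg; simp)
next
  case False
  have rho: "0 \<le> \<rho>" "\<rho> \<le> 1" using \<open>a \<ge> 1\<close> by (auto simp: \<rho>_def)
  define m n where "m = (p + q)/2" and "n = (r + s)/2"
  have mn: "m > 0" "n > 0" using False nn by (auto simp: m_def n_def)
  define p' q' r' s' where "p' = p/m" and "q' = q/m" and "r' = r/n" and "s' = s/n"
  have 1: "0 \<le> p'" "0 \<le> q'" "0 \<le> r'" "0 \<le> s'" using nn mn by (auto simp: p'_def q'_def r'_def s'_def)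
  have "p + q = 2 * m" "r + s = 2 * n" by (simp_all add: m_def n_def)
  then have 2: "p' + q' = 2" "r' + s' = 2"
    using mn unfolding p'_def q'_def r'_def s'_def add_divide_distrib[symmetric]
    by simp_all
  define A A' B B' where "A = (p'^a + q'^a)/2" and "A' = (p'^a - q'^a)/2"
    and "B = (r'^a + s'^a)/2" and "B' = (r'^a - s'^a)/2"
  have A: "1 + \<rho> * A'\<^sup>2 \<le> A\<^sup>2" "A \<ge> 0"
    using two_point_diag[of p' q' a] 1 2 \<open>a \<ge> 1\<close> by (auto simp: A_def A'_def \<rho>_def)
  have B: "1 + \<rho> * B'\<^sup>2 \<le> B\<^sup>2" "B \<ge> 0"
    using two_point_diag[of r' s' a] 1 2 \<open>a \<ge> 1\<close> by (auto simp: B_def B'_def \<rho>_def)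
  \<comment> \<open>Cauchy--Schwarz for \<open>(1, sqrt \<rho> * A')\<close> and
    \<open>(1, - sqrt \<rho> * B')\<close>, with explicit defect.\<close>
  have "(1 - \<rho> * (A' * B'))\<^sup>2 \<le> (1 + \<rho> * A'\<^sup>2) * (1 + \<rho> * B'\<^sup>2)"
  proof -
    have "(1 + \<rho> * A'\<^sup>2) * (1 + \<rho> * B'\<^sup>2) - (1 - \<rho> * (A' * B'))\<^sup>2 = \<rho> * (A' + B')\<^sup>2"
      by (simp add: power2_eq_square algebra_simps)
    then show ?thesis using rho by (smt (verit) zero_le_mult_iff zero_le_power2)
  qed
  also have "\<dots> \<le> A\<^sup>2 * B\<^sup>2" using A B rho by (intro mult_mono) auto
  finally have "(1 - \<rho> * (A' * B'))\<^sup>2 \<le> (A * B)\<^sup>2" by (simp add: power_mult_distrib)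
  then have "1 - \<rho> * (A' * B') \<le> A * B"
    using A B by (meson mult_nonneg_nonneg power2_le_imp_le)
  then have *: "1 \<le> (1 + \<rho>)/4 * (p'^a * r'^a + q'^a * s'^a) + (1 - \<rho>)/4 * (p'^a * s'^a + q'^a * r'^a)"
    by (simp add: A_def A'_def B_def B'_def field_simps)
  have "m^a * n^a * 1 \<le> m^a * n^a * ((1 + \<rho>)/4 * (p'^a * r'^a + q'^a * s'^a) + (1 - \<rho>)/4 * (p'^a * s'^a + q'^a * r'^a))"
    using * mn by (intro mult_left_mono) auto
  also have "\<dots> = (1 + \<rho>)/4 * ((m * p')^a * (n * r')^a + (m * q')^a * (n * s')^a) + (1 - \<rho>)/4 * ((m * p')^a * (n * s')^a + (m * q')^a * (n * r')^a)"
    by (simp add: power_mult_distrib algebra_simps)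
  finally show ?thesis
    using mn by (simp add: p'_def q'_def r'_def s'_def m_def n_def)
qed

text \<open>The four increments have the correlation \<open>\<rho>\<close> of the limiting Gaussian pair.\<close>

definition step_pmf :: "real \<Rightarrow> (real \<times> real) pmf" where
  "step_pmf \<rho> = bernoulli_pmf (1/2) \<bind> (\<lambda>b. map_pmf (\<lambda>c. ((if b then 1 else -1), (if b = c then 1 else -1)))
     (bernoulli_pmf ((1 + \<rho>)/2)))"

text \<open>The recursion peels off the first step and carries the starting point, so that induction
  hypotheses are available at all four neighbours.\<close>

fun walk_pmf :: "real \<Rightarrow> real \<Rightarrow> nat \<Rightarrow> real \<times> real \<Rightarrow> (real \<times> real) pmf" where
  "walk_pmf \<rho> h 0 z = return_pmf z"
| "walk_pmf \<rho> h (Suc n) z = step_pmf \<rho> \<bind> (\<lambda>e. walk_pmf \<rho> h n (z + h *\<^sub>R e))"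

lemma finite_set_step_pmf: "finite (set_pmf (step_pmf \<rho>))"
  unfolding step_pmf_def by auto

lemma finite_set_walk_pmf: "finite (set_pmf (walk_pmf \<rho> h n z))"
  by (induction n arbitrary: z) (auto simp: finite_set_step_pmf)

lemma expectation_step_pmf_bind:
  fixes H :: "real \<times> real \<Rightarrow> real" and W :: "real \<times> real \<Rightarrow> (real \<times> real) pmf"
  assumes "\<bar>\<rho>\<bar> \<le> 1" "\<And>e. finite (set_pmf (W e))"
  shows "measure_pmf.expectation (step_pmf \<rho> \<bind> W) H =
    (1 + \<rho>)/4 * (measure_pmf.expectation (W (1,1)) H + measure_pmf.expectation (W (-1,-1)) H)
    + (1 - \<rho>)/4 * (measure_pmf.expectation (W (1,-1)) H + measure_pmf.expectation (W (-1,1)) H)"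
proof -
  have *: "measure_pmf.expectation (bernoulli_pmf p \<bind> Z) H
     = p * measure_pmf.expectation (Z True) H + (1 - p) * measure_pmf.expectation (Z False) H"
    if "0 \<le> p" "p \<le> 1" "\<And>b. finite (set_pmf (Z b))" for p and Z :: "bool \<Rightarrow> (real \<times> real) pmf"
    using that by (subst pmf_expectation_bind[where A = UNIV]) (auto simp: UNIV_bool)
  have "0 \<le> (1+\<rho>)/2" "(1+\<rho>)/2 \<le> 1" using assms by auto
  then show ?thesis
    unfolding step_pmf_def map_pmf_def bind_assoc_pmf bind_return_pmf
    using assms(2) by (simp add: * ) (simp add: field_simps)
qed

text \<open>Induction on the number of steps. At the four neighbours \<open>EF\<close> takes only
  two values, one for each first increment, and \<open>EG\<close> only two, one for each second
  increment; the induction step is then the two-point inequality for these values.\<close>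

lemma walk_pmf_power_inequality:
  fixes F G :: "real \<Rightarrow> real"
  assumes "a \<ge> 1" "\<And>x. F x \<ge> 0" "\<And>x. G x \<ge> 0"
  defines "\<rho> \<equiv> 1 - 1 / real a"
  shows "(measure_pmf.expectation (walk_pmf \<rho> h n z) (\<lambda>(x,y). F x)) ^ a *
         (measure_pmf.expectation (walk_pmf \<rho> h n z) (\<lambda>(x,y). G y)) ^ a
    \<le> measure_pmf.expectation (walk_pmf \<rho> h n z) (\<lambda>(x,y). F x ^ a * G y ^ a)"
proof (cases z)
  case (Pair x y)
  have rho: "0 \<le> \<rho>" "\<rho> \<le> 1" using \<open>a \<ge> 1\<close> by (auto simp: \<rho>_def)
  define EF where "EF n x y = measure_pmf.expectation (walk_pmf \<rho> h n (x,y)) (\<lambda>(x,y). F x)" for n x y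
  define EG where "EG n x y = measure_pmf.expectation (walk_pmf \<rho> h n (x,y)) (\<lambda>(x,y). G y)" for n x y
  define E where "E n x y = measure_pmf.expectation (walk_pmf \<rho> h n (x,y)) (\<lambda>(x,y). F x ^ a * G y ^ a)" for n x y
  note defs = EF_def EG_def E_def
  have rec: "Z (Suc n) x y = (1 + \<rho>)/4 * (Z n (x + h) (y + h) + Z n (x - h) (y - h))
       + (1 - \<rho>)/4 * (Z n (x + h) (y - h) + Z n (x - h) (y + h))"
    if "Z = EF \<or> Z = EG \<or> Z = E" for Z n x y
    using that rho unfolding defs
    by (elim disjE; simp add: expectation_step_pmf_bind finite_set_walk_pmf)
  have z0: "EF 0 x y = F x" "EG 0 x y = G y" "E 0 x y = F x ^ a * G y ^ a" for x y
    by (simp_all add: defs)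
  have nn: "EF n x y \<ge> 0" "EG n x y \<ge> 0" for n x y
    using assms unfolding defs by (auto intro!: integral_nonneg_AE)
  \<comment> \<open>The first coordinate evolves on its own as a fair walk, whatever the second one
    does.\<close>
  have indepF: "EF n x y = EF n x y'" for n x y y'
  proof (induction n arbitrary: x y y')
    case (Suc n)
    have "EF n (x+h) (y-h) = EF n (x+h) (y+h)" "EF n (x-h) (y-h) = EF n (x-h) (y+h)"
      "EF n (x+h) (y'-h) = EF n (x+h) (y+h)" "EF n (x-h) (y'-h) = EF n (x-h) (y+h)"
      "EF n (x+h) (y'+h) = EF n (x+h) (y+h)" "EF n (x-h) (y'+h) = EF n (x-h) (y+h)"
      by (rule Suc.IH)+
    then show ?case by (simp add: rec)
  qed (simp add: z0)
  have indepG: "EG n x y = EG n x' y" for n x x' y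
  proof (induction n arbitrary: x x' y)
    case (Suc n)
    have "EG n (x-h) (y+h) = EG n (x+h) (y+h)" "EG n (x-h) (y-h) = EG n (x+h) (y-h)"
      "EG n (x'-h) (y+h) = EG n (x+h) (y+h)" "EG n (x'-h) (y-h) = EG n (x+h) (y-h)"
      "EG n (x'+h) (y+h) = EG n (x+h) (y+h)" "EG n (x'+h) (y-h) = EG n (x+h) (y-h)"
      by (rule Suc.IH)+
    then show ?case by (simp add: rec algebra_simps)
  qed (simp add: z0)
  have "EF n x y ^ a * EG n x y ^ a \<le> E n x y" for n x y
  proof (induction n arbitrary: x y)
    case (Suc n)
    define p q r s where "p = EF n (x+h) y" and "q = EF n (x-h) y"
      and "r = EG n x (y+h)" and "s = EG n x (y-h)"
    have p: "EF n (x+h) y' = p" "EF n (x-h) y' = q" "EG n x' (y+h) = r" "EG n x' (y-h) = s" for y' x'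
      unfolding p_def q_def r_def s_def by (rule indepF indepG)+
    have E2: "EF (Suc n) x y = (p+q)/2" "EG (Suc n) x y = (r+s)/2"
      by (simp_all add: rec p) (simp_all add: field_simps)
    have "0 \<le> p" "0 \<le> q" "0 \<le> r" "0 \<le> s" by (simp_all add: p_def q_def r_def s_def nn)
    then have "EF (Suc n) x y ^ a * EG (Suc n) x y ^ a
       \<le> (1 + \<rho>)/4 * (p^a * r^a + q^a * s^a) + (1 - \<rho>)/4 * (p^a * s^a + q^a * r^a)"
      unfolding E2 \<rho>_def using two_point_inequality[of p q r s a] assms(1) by blast
    also have "\<dots> \<le> (1 + \<rho>)/4 * (E n (x + h) (y + h) + E n (x - h) (y - h))
       + (1 - \<rho>)/4 * (E n (x + h) (y - h) + E n (x - h) (y + h))"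
      using rho Suc.IH[of "x+h" "y+h"] Suc.IH[of "x-h" "y-h"] Suc.IH[of "x+h" "y-h"] Suc.IH[of "x-h" "y+h"]
      by (intro add_mono mult_left_mono) (simp_all add: p)
    also have "\<dots> = E (Suc n) x y" by (simp add: rec)
    finally show ?case .
  qed (simp add: z0)
  then show ?thesis unfolding Pair defs .
qed

text \<open>Increments are symmetric, so the sine terms cancel and each step contributes a real
  factor. The phase \<open>c\<close> lets real cosine integrals carry both the real and the
  imaginary part of a characteristic function.\<close>

lemma expectation_walk_pmf_cos:
  fixes s t c h \<rho> :: real
  assumes "\<bar>\<rho>\<bar> \<le> 1"
  shows "measure_pmf.expectation (walk_pmf \<rho> h n (x0, y0)) (\<lambda>(x,y). cos (c + s * x + t * y)) =
    cos (c + s * x0 + t * y0) * ((1 + \<rho>)/2 * cos (h * (s + t)) + (1 - \<rho>)/2 * cos (h * (s - t))) ^ n"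
proof (induction n arbitrary: x0 y0)
  case 0 then show ?case by simp
next
  case (Suc n)
  define w where "w = c + s * x0 + t * y0"
  define K where "K = ((1 + \<rho>)/2 * cos (h * (s + t)) + (1 - \<rho>)/2 * cos (h * (s - t))) ^ n"
  have e: "c + s * (x0 + h) + t * (y0 + h) = w + h * (s + t)"
    "c + s * (x0 - h) + t * (y0 - h) = w - h * (s + t)"
    "c + s * (x0 + h) + t * (y0 - h) = w + h * (s - t)"
    "c + s * (x0 - h) + t * (y0 + h) = w - h * (s - t)"
    by (simp_all add: w_def algebra_simps)
  have "measure_pmf.expectation (walk_pmf \<rho> h (Suc n) (x0, y0)) (\<lambda>(x,y). cos (c + s * x + t * y))
    = (1 + \<rho>)/4 * (cos (w + h * (s + t)) * K + cos (w - h * (s + t)) * K)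
      + (1 - \<rho>)/4 * (cos (w + h * (s - t)) * K + cos (w - h * (s - t)) * K)"
    using assms by (simp add: expectation_step_pmf_bind finite_set_walk_pmf Suc.IH e K_def)
  also have "\<dots> = cos w * (((1 + \<rho>)/2 * cos (h * (s + t)) + (1 - \<rho>)/2 * cos (h * (s - t))) * K)"
    unfolding cos_add[of w] cos_diff[of w] by (simp add: field_simps)
  finally show ?case by (simp add: K_def w_def)
qed

text \<open>Each factor is \<open>1 - v/(2n) + o(1/n)\<close> with
  \<open>v = s^2 + 2 \<rho> s t + t^2\<close>. Its power is compared with that of
  \<open>exp (- v/(2n))\<close> through \<open>|x^n - y^n| <= n |x - y|\<close> on
  \<open>[-1, 1]\<close>.\<close>

lemma walk_cos_limit:
  fixes s t \<rho> :: real
  assumes "\<bar>\<rho>\<bar> \<le> 1"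
  shows "(\<lambda>n. ((1 + \<rho>)/2 * cos ((1 / sqrt (real n)) * (s + t)) + (1 - \<rho>)/2 * cos ((1 / sqrt (real n)) * (s - t))) ^ n)
     \<longlonglongrightarrow> exp (- (s\<^sup>2 + 2 * \<rho> * s * t + t\<^sup>2) / 2)"
proof -
  define v where "v = s\<^sup>2 + 2 * \<rho> * s * t + t\<^sup>2"
  define f where "f n = (1 + \<rho>)/2 * cos ((1 / sqrt (real n)) * (s + t)) + (1 - \<rho>)/2 * cos ((1 / sqrt (real n)) * (s - t))" for n
  have c: "(\<lambda>n. real n * (cos ((1 / sqrt (real n)) * p) - 1)) \<longlonglongrightarrow> - p\<^sup>2 / 2" for p :: real
    unfolding power2_eq_square by real_asymp
  have "(\<lambda>n. (1 + \<rho>)/2 * (real n * (cos ((1 / sqrt (real n)) * (s + t)) - 1)) + (1 - \<rho>)/2 * (real n * (cos ((1 / sqrt (real n)) * (s - t)) - 1)))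
    \<longlonglongrightarrow> (1 + \<rho>)/2 * (- (s + t)\<^sup>2 / 2) + (1 - \<rho>)/2 * (- (s - t)\<^sup>2 / 2)"
    by (intro tendsto_intros c)
  also have "(1 + \<rho>)/2 * (- (s + t)\<^sup>2 / 2) + (1 - \<rho>)/2 * (- (s - t)\<^sup>2 / 2) = - v / 2"
    by (simp add: v_def power2_eq_square field_simps)
  also have "(\<lambda>n. (1 + \<rho>)/2 * (real n * (cos ((1 / sqrt (real n)) * (s + t)) - 1)) + (1 - \<rho>)/2 * (real n * (cos ((1 / sqrt (real n)) * (s - t)) - 1)))
     = (\<lambda>n. real n * (f n - 1))"
    by (simp add: f_def field_simps)
  finally have 1: "(\<lambda>n. real n * (f n - 1)) \<longlonglongrightarrow> - v / 2" .
  have 2: "(\<lambda>n. real n * (exp (- v / 2 / real n) - 1)) \<longlonglongrightarrow> - v / 2"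
    by real_asymp
  have "(\<lambda>n. real n * (f n - 1) - real n * (exp (- v / 2 / real n) - 1)) \<longlonglongrightarrow> - v / 2 - (- v / 2)"
    by (intro tendsto_diff 1 2)
  then have 3: "(\<lambda>n. \<bar>real n * (f n - exp (- v / 2 / real n))\<bar>) \<longlonglongrightarrow> 0"
    by (intro tendsto_rabs_zero) (simp add: algebra_simps)
  have le: "\<bar>f n\<bar> \<le> 1" for n
  proof -
    have "\<bar>f n\<bar> \<le> (1 + \<rho>)/2 * 1 + (1 - \<rho>)/2 * 1"
      unfolding f_def using assms
      by (intro order.trans[OF abs_triangle_ineq] add_mono) (auto simp: abs_mult intro!: mult_left_le)
    then show ?thesis by (simp add: field_simps)
  qed
  \<comment> \<open>Nonnegativity of \<open>v\<close> keeps the exponential at most 1, as the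
    comparison of powers requires.\<close>
  have "v = (1 + \<rho>)/2 * (s + t)\<^sup>2 + (1 - \<rho>)/2 * (s - t)\<^sup>2" 
    by (simp add: v_def power2_eq_square field_simps)
  then have "v \<ge> 0" using assms by simp
  have "(\<lambda>n. f n ^ n - exp (- v / 2 / real n) ^ n) \<longlonglongrightarrow> 0"
  proof (rule Lim_null_comparison[OF _ 3], rule always_eventually, rule allI)
    fix n show "norm (f n ^ n - exp (- v / 2 / real n) ^ n) \<le> \<bar>real n * (f n - exp (- v / 2 / real n))\<bar>"
      using norm_power_diff[of "f n" "exp (- v / 2 / real n)" n] le[of n] \<open>v \<ge> 0\<close>
      by (simp add: abs_mult)
  qed
  then have "(\<lambda>n. f n ^ n - exp (- v / 2 / real n) ^ n + exp (- v / 2)) \<longlonglongrightarrow> 0 + exp (- v / 2)"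
    by (intro tendsto_intros)
  moreover have "eventually (\<lambda>n. f n ^ n - exp (- v / 2 / real n) ^ n + exp (- v / 2) = f n ^ n) sequentially"
    using eventually_gt_at_top[of 0] by eventually_elim (simp flip: exp_of_nat_mult)
  ultimately have "(\<lambda>n. f n ^ n) \<longlonglongrightarrow> exp (- v / 2)"
    by (auto intro: Lim_transform_eventually)
  then show ?thesis unfolding f_def v_def .
qed

section \<open>Bivariate weak convergence\<close>

text \<open>Tilting by a bounded weight turns an integral of \<open>w * f(X)\<close> into one
  against a law on the real line. The lower bound 1 on the weight keeps the normalisation away from
  0.\<close>

lemma weighted_law:
  fixes X w :: "'a \<Rightarrow> real"
  assumes "prob_space N" and [measurable]: "X \<in> borel_measurable N" "w \<in> borel_measurable N"
    and w: "\<And>x. 1 \<le> w x" "\<And>x. w x \<le> B"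
  defines "E \<equiv> (\<integral>x. w x \<partial>N)"
  defines "\<mu> \<equiv> distr (density N (\<lambda>x. ennreal (w x / E))) borel X"
  shows "1 \<le> E" "real_distribution \<mu>"
    "\<And>f. f \<in> borel_measurable borel \<Longrightarrow> (\<integral>x. f x \<partial>\<mu>) = (\<integral>x. w x * (f (X x) :: real) \<partial>N) / E"
proof -
  interpret prob_space N by fact
  have int: "integrable N w" using w by (intro integrable_const_bound[where B = B]) (auto simp: abs_of_nonneg order.trans[OF zero_le_one])
  have "(\<integral>x. 1 \<partial>N) \<le> E" unfolding E_def using w int by (intro integral_mono) auto
  then show E: "1 \<le> E" by (simp add: prob_space)
  have w0: "0 \<le> w x" for x using w(1)[of x] by simp
  have "(\<integral>\<^sup>+ x. ennreal (w x / E) \<partial>N) = ennreal (\<integral>x. w x / E \<partial>N)"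
    using E int by (intro nn_integral_eq_integral) (auto intro!: divide_nonneg_nonneg order.trans[OF zero_le_one w(1)])
  also have "\<dots> = 1" using E int by (simp flip: E_def)
  finally have "prob_space (density N (\<lambda>x. ennreal (w x / E)))"
    by (intro prob_spaceI) (simp add: emeasure_density cong: nn_integral_cong)
  then show "real_distribution \<mu>"
    unfolding \<mu>_def by (intro real_distribution.intro real_distribution_axioms.intro prob_space.prob_space_distr) auto
  fix f :: "real \<Rightarrow> real" assume [measurable]: "f \<in> borel_measurable borel"
  have "(\<integral>x. f x \<partial>\<mu>) = (\<integral>x. (w x / E) *\<^sub>R f (X x) \<partial>N)"
    unfolding \<mu>_def using w0 E by (subst integral_distr) (auto simp: integral_density)
  then show "(\<integral>x. f x \<partial>\<mu>) = (\<integral>x. w x * f (X x) \<partial>N) / E"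
    by simp
qed

lemma char_eq_cos_integrals:
  assumes "real_distribution \<nu>"
  shows "char \<nu> t = Complex (\<integral>x. cos (0 + t * x) \<partial>\<nu>) (\<integral>x. cos (- pi/2 + t * x) \<partial>\<nu>)"
proof -
  interpret real_distribution \<nu> by fact
  have i: "integrable \<nu> (\<lambda>x. iexp (t * x))" by (rule integrable_iexp) auto
  have "sin y = cos (- pi/2 + y)" for y by (simp add: cos_diff)
  then show ?thesis
    unfolding char_def complex_eq_iff using integral_Re[OF i] integral_Im[OF i]
    by (simp add: Re_exp Im_exp)
qed

text \<open>Levy continuity for the tilted laws. The phases \<open>0\<close> and
  \<open>- pi/2\<close> in \<open>lim\<close> supply the characteristic functions, and
  \<open>c = s = 0\<close> the convergence of the normalisations, by which the limit is multiplied
  back at the end.\<close>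

lemma weighted_weak_convergence:
  fixes M :: "nat \<Rightarrow> 'a measure" and M' :: "'b measure" and f :: "real \<Rightarrow> real"
  assumes M: "\<And>n. prob_space (M n)" "prob_space M'"
    and X: "\<And>n. X n \<in> borel_measurable (M n)" "X' \<in> borel_measurable M'"
    and w: "\<And>n. w n \<in> borel_measurable (M n)" "\<And>n x. 1 \<le> w n x" "\<And>n x. w n x \<le> B"
    and w': "w' \<in> borel_measurable M'" "\<And>x. 1 \<le> w' x" "\<And>x. w' x \<le> B"
    and lim: "\<And>c s. (\<lambda>n. \<integral>x. w n x * cos (c + s * X n x) \<partial>M n) \<longlonglongrightarrow> (\<integral>x. w' x * cos (c + s * X' x) \<partial>M')"
    and f: "continuous_on UNIV f" "\<And>x. \<bar>f x\<bar> \<le> C"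
  shows "(\<lambda>n. \<integral>x. w n x * f (X n x) \<partial>M n) \<longlonglongrightarrow> (\<integral>x. w' x * f (X' x) \<partial>M')"
proof -
  define E where "E n = (\<integral>x. w n x \<partial>M n)" for n
  define E' where "E' = (\<integral>x. w' x \<partial>M')"
  define \<mu> where "\<mu> n = distr (density (M n) (\<lambda>x. ennreal (w n x / E n))) borel (X n)" for n
  define \<mu>' where "\<mu>' = distr (density M' (\<lambda>x. ennreal (w' x / E'))) borel X'"
  note law = weighted_law[OF M(1) X(1) w, folded E_def, folded \<mu>_def]
  note law' = weighted_law[OF M(2) X(2) w', folded E'_def, folded \<mu>'_def]
  have law3: "(\<integral>x. h x \<partial>\<mu> n) = (\<integral>x. w n x * h (X n x) \<partial>M n) / E n" if "h \<in> borel_measurable borel" for h n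
    unfolding \<mu>_def E_def using that by (rule weighted_law(3)[OF M(1) X(1) w])
  have law3': "(\<integral>x. h x \<partial>\<mu>') = (\<integral>x. w' x * h (X' x) \<partial>M') / E'" if "h \<in> borel_measurable borel" for h
    unfolding \<mu>'_def E'_def using that by (rule weighted_law(3)[OF M(2) X(2) w'])
  have E: "E \<longlonglongrightarrow> E'" using lim[of 0 0] by (simp add: E_def[abs_def] E'_def)
  have E0: "E' \<noteq> 0" "E n \<noteq> 0" for n using law(1)[of n] law'(1) by auto
  have conv: "(\<lambda>n. \<integral>x. cos (c + s * x) \<partial>\<mu> n) \<longlonglongrightarrow> (\<integral>x. cos (c + s * x) \<partial>\<mu>')" for c s
  proof -
    have m: "(\<lambda>x. cos (c + s * x)) \<in> borel_measurable borel" by measurable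
    show ?thesis unfolding law3[OF m] law3'[OF m] by (intro tendsto_divide lim E E0)
  qed
  have "weak_conv_m \<mu> \<mu>'"
  proof (rule levy_continuity)
    show "(\<lambda>n. char (\<mu> n) t) \<longlonglongrightarrow> char \<mu>' t" for t
      unfolding char_eq_cos_integrals[OF law(2)] char_eq_cos_integrals[OF law'(2)]
      by (intro tendsto_Complex conv)
  qed (rule law(2) law'(2))+
  then have "(\<lambda>n. \<integral>x. f x \<partial>\<mu> n) \<longlonglongrightarrow> (\<integral>x. f x \<partial>\<mu>')"
    using law(2) law'(2) f
    by (intro weak_conv_imp_integral_bdd_continuous_conv[where B = C])
       (auto simp: continuous_on_eq_continuous_at)
  moreover have fm: "f \<in> borel_measurable borel" using f by (intro borel_measurable_continuous_onI)
  ultimately have "(\<lambda>n. (\<integral>x. w n x * f (X n x) \<partial>M n) / E n * E n) \<longlonglongrightarrow> (\<integral>x. w' x * f (X' x) \<partial>M') / E' * E'"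
    unfolding law3[OF fm] law3'[OF fm] by (intro tendsto_mult E)
  then show ?thesis using E0 by simp
qed

text \<open>One-dimensional convergence is applied to tilted laws: to \<open>X\<close> with weight
  \<open>2 + cos (d + t * Y)\<close>, which settles the products
  \<open>f(X) cos (d + t * Y)\<close>, and then to \<open>Y\<close> with weight
  \<open>1 + f(X)\<close>. The constants 2 and 1 make the weights at least 1; their contributions
  are subtracted again using the one-variable limits \<open>cf\<close> and
  \<open>cg\<close>.\<close>

lemma bivariate_weak_convergence:
  fixes M :: "nat \<Rightarrow> 'a measure" and M' :: "'a measure" and f g :: "real \<Rightarrow> real"
  assumes M: "\<And>n. prob_space (M n)" "prob_space M'"
    and X: "\<And>n. X n \<in> borel_measurable (M n)" "X' \<in> borel_measurable M'"
    and Y: "\<And>n. Y n \<in> borel_measurable (M n)" "Y' \<in> borel_measurable M'"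
    and lim: "\<And>c s t. (\<lambda>n. \<integral>x. cos (c + s * X n x + t * Y n x) \<partial>M n) \<longlonglongrightarrow> (\<integral>x. cos (c + s * X' x + t * Y' x) \<partial>M')"
    and f: "continuous_on UNIV f" "\<And>x. 0 \<le> f x" "\<And>x. f x \<le> C"
    and g: "continuous_on UNIV g" "\<And>x. 0 \<le> g x" "\<And>x. g x \<le> C"
  shows "(\<lambda>n. \<integral>x. f (X n x) * g (Y n x) \<partial>M n) \<longlonglongrightarrow> (\<integral>x. f (X' x) * g (Y' x) \<partial>M')"
proof -
  note [measurable] = X Y
  have [measurable]: "f \<in> borel_measurable borel" "g \<in> borel_measurable borel"
    using f g by (auto intro!: borel_measurable_continuous_onI)
  define conv where "conv H \<longleftrightarrow> (\<lambda>n. \<integral>x. H (X n x) (Y n x) \<partial>M n) \<longlonglongrightarrow> (\<integral>x. H (X' x) (Y' x) \<partial>M')"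
    for H :: "real \<Rightarrow> real \<Rightarrow> real"
  define bdd where "bdd H \<longleftrightarrow> case_prod H \<in> borel_measurable (borel \<Otimes>\<^sub>M borel) \<and> (\<exists>K. \<forall>x y. \<bar>H x y\<bar> \<le> K)"
    for H :: "real \<Rightarrow> real \<Rightarrow> real"
  have int: "integrable N (\<lambda>x. H (U x) (V x))"
    if "prob_space N" and [measurable]: "U \<in> borel_measurable N" "V \<in> borel_measurable N" and H: "bdd H"
    for N :: "'a measure" and U V H
  proof -
    interpret prob_space N by fact
    obtain K where "\<And>x y. \<bar>H x y\<bar> \<le> K" and [measurable]: "case_prod H \<in> borel_measurable (borel \<Otimes>\<^sub>M borel)"
      using H by (auto simp: bdd_def)
    then show ?thesis by (intro integrable_const_bound[where B = K]) auto
  qed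
  have lin: "conv (\<lambda>x y. a * H x y + b * H' x y)" if "conv H" "conv H'" "bdd H" "bdd H'" for a b H H'
  proof -
    have "(\<lambda>n. a * (\<integral>x. H (X n x) (Y n x) \<partial>M n) + b * (\<integral>x. H' (X n x) (Y n x) \<partial>M n))
      \<longlonglongrightarrow> a * (\<integral>x. H (X' x) (Y' x) \<partial>M') + b * (\<integral>x. H' (X' x) (Y' x) \<partial>M')"
      using that unfolding conv_def by (intro tendsto_intros)
    then show ?thesis
      unfolding conv_def using int[OF M(1) X(1) Y(1)] int[OF M(2) X(2) Y(2)] that by simp
  qed
  have fle: "\<bar>f x\<bar> \<le> C" "\<bar>g x\<bar> \<le> C" for x using f(2,3)[of x] g(2,3)[of x] by auto
  have C: "0 \<le> C" using f(2,3)[of 0] by simp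
  have bcos: "bdd (\<lambda>x y. cos (c + s * x + t * y))" for c s t
    unfolding bdd_def by (intro conjI exI[of _ 1]) auto
  have bcos2: "bdd (\<lambda>x y. cos (d + t * y) * cos (c + s * x))" for c s d t
    unfolding bdd_def by (intro conjI exI[of _ 1]) (auto simp: abs_mult mult_le_one)
  have bf: "bdd (\<lambda>x y. f x)" and bg: "bdd (\<lambda>x y. g y)"
    unfolding bdd_def using fle by (auto intro!: exI[of _ C])
  have fC: "\<bar>f x * w\<bar> \<le> C * K" if "\<bar>w\<bar> \<le> K" for x w K
    using mult_mono[OF fle(1)[of x] that] C by (simp add: abs_mult)
  have bfc: "bdd (\<lambda>x y. f x * cos (d + t * y))" for d t
    unfolding bdd_def using fC[OF abs_cos_le_one] by (intro conjI exI[of _ "C * 1"] allI) auto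
  have bfg: "bdd (\<lambda>x y. f x * g y)"
    unfolding bdd_def using fC[OF fle(2)] by (intro conjI exI[of _ "C * C"] allI) auto
  have ccos: "conv (\<lambda>x y. cos (c + s * x + t * y))" for c s t
    unfolding conv_def by (rule lim)
  have ccos2: "conv (\<lambda>x y. cos (d + t * y) * cos (c + s * x))" for c s d t
  proof -
    have "cos (d + t * y) * cos (c + s * x) =
        1/2 * cos ((c + d) + s * x + t * y) + 1/2 * cos ((c - d) + s * x + (- t) * y)" for x y :: real
      by (simp add: cos_times_cos algebra_simps)
    then show ?thesis by (simp only: lin[OF ccos ccos bcos bcos])
  qed
  have cf: "conv (\<lambda>x y. f x)"
  proof -
    have "(\<lambda>n. \<integral>x. 1 * f (X n x) \<partial>M n) \<longlonglongrightarrow> (\<integral>x. 1 * f (X' x) \<partial>M')"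
      by (rule weighted_weak_convergence[where B = 1 and C = C])
         (use M X f(1) fle ccos[of _ _ 0] in \<open>auto simp: conv_def\<close>)
    then show ?thesis by (simp add: conv_def)
  qed
  have cg: "conv (\<lambda>x y. g y)"
  proof -
    have "(\<lambda>n. \<integral>x. 1 * g (Y n x) \<partial>M n) \<longlonglongrightarrow> (\<integral>x. 1 * g (Y' x) \<partial>M')"
      by (rule weighted_weak_convergence[where B = 1 and C = C])
         (use M Y g(1) fle ccos[of _ 0] in \<open>auto simp: conv_def\<close>)
    then show ?thesis by (simp add: conv_def)
  qed
  have cfc: "conv (\<lambda>x y. f x * cos (d + t * y))" for d t
  proof -
    have ge: "1 \<le> 2 + cos y" for y :: real using cos_ge_minus_one[of y] by linarith
    have c: "conv (\<lambda>x y. (2 + cos (d + t * y)) * cos (c + s * x))" for c s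
      using lin[OF ccos[of c s 0] ccos2[of d t c s] bcos bcos2, of 2 1] by (simp add: distrib_right)
    have 1: "conv (\<lambda>x y. (2 + cos (d + t * y)) * f x)"
      unfolding conv_def
      by (rule weighted_weak_convergence[where B = 3 and C = C and X = X and X' = X'
            and w = "\<lambda>n x. 2 + cos (d + t * Y n x)" and w' = "\<lambda>x. 2 + cos (d + t * Y' x)",
            OF M X _ ge _ _ ge _ c[unfolded conv_def] f(1) fle(1)]) auto
    have "\<bar>2 + cos y\<bar> \<le> 3" for y :: real using ge[of y] by simp
    from fC[OF this] have "bdd (\<lambda>x y. (2 + cos (d + t * y)) * f x)"
      unfolding bdd_def by (intro conjI exI[of _ "C * 3"] allI) (auto simp: mult.commute)
    from lin[OF 1 cf this bf, of 1 "-2"] show ?thesis by (simp add: algebra_simps)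
  qed
  have c: "conv (\<lambda>x y. (1 + f x) * cos (c + s * y))" for c s
    using lin[OF ccos[of c 0 s] cfc[of c s] bcos bfc, of 1 1] by (simp add: distrib_right)
  have 2: "conv (\<lambda>x y. (1 + f x) * g y)"
    unfolding conv_def
    by (rule weighted_weak_convergence[where B = "1 + C" and C = C and X = Y and X' = Y'
          and w = "\<lambda>n x. 1 + f (X n x)" and w' = "\<lambda>x. 1 + f (X' x)",
          OF M Y _ _ _ _ _ _ c[unfolded conv_def] g(1) fle(2)]) (use f(2,3) in auto)
  have "bdd (\<lambda>x y. (1 + f x) * g y)"
    unfolding bdd_def using f(2,3) g(2,3) C
    by (intro conjI exI[of _ "(1 + C) * C"] allI) (auto simp: abs_mult abs_of_nonneg intro!: mult_mono)
  from lin[OF 2 cg this bg, of 1 "-1"] show ?thesis by (simp add: algebra_simps conv_def)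
qed

section \<open>Gaussian pairs as limits of the correlated walk\<close>

lemma prob_space_std_gaussian: "prob_space std_gaussian"
  unfolding std_gaussian_def by (rule prob_space_normal_density) simp

lemma space_std_gaussian [simp]: "space std_gaussian = UNIV"
  and sets_std_gaussian [simp, measurable_cong]: "sets std_gaussian = sets borel"
  by (simp_all add: std_gaussian_def)

lemma emeasure_std_gaussian_UNIV [simp]: "emeasure std_gaussian UNIV = 1"
  using prob_space.emeasure_space_1[OF prob_space_std_gaussian] by simp

lemma integral_cos_std_gaussian:
  "(\<integral>x. cos (c + t * x) \<partial>std_gaussian) = cos c * exp (- t\<^sup>2 / 2)"
proof -
  interpret prob_space std_gaussian by (rule prob_space_std_gaussian)
  interpret real_distribution std_gaussian by standard auto
  have i: "integrable std_gaussian (\<lambda>x. iexp (t * x))" by (rule integrable_iexp) auto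
  have *: "char std_gaussian t = complex_of_real (exp (- t\<^sup>2 / 2))"
    using char_std_normal_distribution by (simp add: std_gaussian_def)
  have c: "(\<integral>x. cos (t * x) \<partial>std_gaussian) = exp (- t\<^sup>2 / 2)"
    using * integral_Re[OF i] by (simp add: char_def Re_exp)
  have s: "(\<integral>x. sin (t * x) \<partial>std_gaussian) = 0"
    using * integral_Im[OF i] by (simp add: char_def Im_exp)
  have "(\<integral>x. cos (c + t * x) \<partial>std_gaussian) = (\<integral>x. cos c * cos (t * x) - sin c * sin (t * x) \<partial>std_gaussian)"
    by (simp add: cos_add)
  also have "\<dots> = cos c * (\<integral>x. cos (t * x) \<partial>std_gaussian) - sin c * (\<integral>x. sin (t * x) \<partial>std_gaussian)"
    by (subst Bochner_Integration.integral_diff) (auto intro!: integrable_const_bound[where B = 1])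
  finally show ?thesis by (simp add: c s)
qed

abbreviation gauss_pair :: "(real \<times> real) measure" where
  "gauss_pair \<equiv> std_gaussian \<Otimes>\<^sub>M std_gaussian"

abbreviation correlate :: "real \<Rightarrow> real \<times> real \<Rightarrow> real" where
  "correlate \<rho> z \<equiv> \<rho> * fst z + sqrt (1 - \<rho>\<^sup>2) * snd z"

text \<open>The variances add up to \<open>(s + t \<rho>)^2 + t^2 (1 - \<rho>^2) = s^2 + 2 \<rho> s
  t + t^2\<close>, the exponent found for the walk.\<close>

lemma gaussian_pair_cos:
  fixes s t c \<rho> :: real
  assumes "\<bar>\<rho>\<bar> \<le> 1"
  shows "(\<integral>z. cos (c + s * fst z + t * (correlate \<rho> z)) \<partial>gauss_pair)
    = cos c * exp (- (s\<^sup>2 + 2 * \<rho> * s * t + t\<^sup>2) / 2)"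
proof -
  interpret G: prob_space std_gaussian by (rule prob_space_std_gaussian)
  interpret P: pair_prob_space std_gaussian std_gaussian by standard
  have "(\<integral>z. cos (c + s * fst z + t * (correlate \<rho> z)) \<partial>gauss_pair)
    = (\<integral>x. \<integral>y. cos ((c + (s + t * \<rho>) * x) + (t * sqrt (1 - \<rho>\<^sup>2)) * y) \<partial>std_gaussian \<partial>std_gaussian)"
    by (subst P.integral_fst'[symmetric]) (auto intro!: P.integrable_const_bound[where B = 1] simp: algebra_simps)
  also have "\<dots> = (\<integral>x. cos (c + (s + t * \<rho>) * x) \<partial>std_gaussian) * exp (- (t * sqrt (1 - \<rho>\<^sup>2))\<^sup>2 / 2)"
    by (simp only: integral_cos_std_gaussian integral_mult_left_zero)
  also have "\<dots> = cos c * (exp (- (s + t * \<rho>)\<^sup>2 / 2) * exp (- (t * sqrt (1 - \<rho>\<^sup>2))\<^sup>2 / 2))"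
    by (simp add: integral_cos_std_gaussian)
  also have "exp (- (s + t * \<rho>)\<^sup>2 / 2) * exp (- (t * sqrt (1 - \<rho>\<^sup>2))\<^sup>2 / 2) = exp (- (s\<^sup>2 + 2 * \<rho> * s * t + t\<^sup>2) / 2)"
  proof -
    have "\<rho>\<^sup>2 \<le> 1" using assms by (simp add: abs_square_le_1)
    then have "(sqrt (1 - \<rho>\<^sup>2))\<^sup>2 = 1 - \<rho>\<^sup>2" by simp
    then show ?thesis
      by (simp add: power_mult_distrib flip: exp_add) (simp add: power2_eq_square field_simps)
  qed
  finally show ?thesis .
qed

text \<open>Limit of the walk inequality at step length \<open>1 / sqrt n\<close>. The convergence
  \<open>main\<close> is needed for the pairs \<open>(F, 1)\<close>, \<open>(1, G)\<close> and
  \<open>(F^a, G^a)\<close>.\<close>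

lemma gaussian_power_inequality_continuous:
  fixes F G :: "real \<Rightarrow> real" and a :: nat
  assumes "a \<ge> 1" and F: "continuous_on UNIV F" "\<And>x. 0 \<le> F x" "\<And>x. F x \<le> C"
    and G: "continuous_on UNIV G" "\<And>x. 0 \<le> G x" "\<And>x. G x \<le> C"
  defines "\<rho> \<equiv> 1 - 1 / real a"
  shows "(\<integral>z. F (fst z) \<partial>gauss_pair) ^ a
      * (\<integral>z. G (correlate \<rho> z) \<partial>gauss_pair) ^ a
    \<le> (\<integral>z. F (fst z) ^ a * G (correlate \<rho> z) ^ a \<partial>gauss_pair)"
proof -
  interpret Gs: prob_space std_gaussian by (rule prob_space_std_gaussian)
  interpret P: pair_prob_space std_gaussian std_gaussian by standard
  have rho: "\<bar>\<rho>\<bar> \<le> 1" using \<open>a \<ge> 1\<close> by (auto simp: \<rho>_def)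
  define M where "M n = measure_pmf (walk_pmf \<rho> (1 / sqrt (real n)) n (0,0))" for n
  have main: "(\<lambda>n. \<integral>z. f (fst z) * g (snd z) \<partial>M n)
     \<longlonglongrightarrow> (\<integral>z. f (fst z) * g (correlate \<rho> z) \<partial>gauss_pair)"
    if "continuous_on UNIV f" "\<And>x. 0 \<le> f x" "\<And>x. f x \<le> K"
     "continuous_on UNIV g" "\<And>x. 0 \<le> g x" "\<And>x. g x \<le> K" for f g :: "real \<Rightarrow> real" and K
  proof (rule bivariate_weak_convergence[where C = K and X = "\<lambda>_. fst" and Y = "\<lambda>_. snd" and X' = fst
      and Y' = "\<lambda>z. correlate \<rho> z"])
    fix c s t
    have "(\<lambda>n. cos c * ((1 + \<rho>)/2 * cos ((1 / sqrt (real n)) * (s + t)) + (1 - \<rho>)/2 * cos ((1 / sqrt (real n)) * (s - t))) ^ n)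
      \<longlonglongrightarrow> cos c * exp (- (s\<^sup>2 + 2 * \<rho> * s * t + t\<^sup>2) / 2)"
      by (intro tendsto_intros walk_cos_limit rho)
    then show "(\<lambda>n. \<integral>x. cos (c + s * fst x + t * snd x) \<partial>M n)
      \<longlonglongrightarrow> (\<integral>x. cos (c + s * fst x + t * correlate \<rho> x) \<partial>gauss_pair)"
      using expectation_walk_pmf_cos[OF rho, of _ _ 0 0 c s t]
      by (simp add: gaussian_pair_cos[OF rho] M_def case_prod_beta')
  qed (use that P.prob_space_axioms in \<open>auto simp: M_def measure_pmf.prob_space_axioms\<close>)
  have "(\<lambda>n. (\<integral>z. F (fst z) * 1 \<partial>M n) ^ a * (\<integral>z. 1 * G (snd z) \<partial>M n) ^ a)
    \<longlonglongrightarrow> (\<integral>z. F (fst z) * 1 \<partial>gauss_pair) ^ a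
      * (\<integral>z. 1 * G (correlate \<rho> z) \<partial>gauss_pair) ^ a"
    \<comment> \<open>The constant function 1 is one of the test functions, hence the common bound
      \<open>max 1 C\<close>.\<close>
    by (intro tendsto_mult tendsto_power main[of _ "max 1 C"]) (use F G in \<open>auto simp: le_max_iff_disj\<close>)
  moreover have "(\<lambda>n. \<integral>z. F (fst z) ^ a * G (snd z) ^ a \<partial>M n)
     \<longlonglongrightarrow> (\<integral>z. F (fst z) ^ a * G (correlate \<rho> z) ^ a \<partial>gauss_pair)"
    by (intro main[of _ "C ^ a"]) (use F G in \<open>auto intro!: continuous_intros power_mono\<close>)
  moreover have "(\<integral>z. F (fst z) * 1 \<partial>M n) ^ a * (\<integral>z. 1 * G (snd z) \<partial>M n) ^ a
     \<le> (\<integral>z. F (fst z) ^ a * G (snd z) ^ a \<partial>M n)" for n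
    using walk_pmf_power_inequality[OF \<open>a \<ge> 1\<close> F(2) G(2), of "1 / sqrt (real n)" n "(0,0)"]
    by (simp add: M_def \<rho>_def case_prod_beta')
  ultimately show ?thesis
    by (intro LIMSEQ_le[where X = "\<lambda>n. (\<integral>z. F (fst z) * 1 \<partial>M n) ^ a * (\<integral>z. 1 * G (snd z) \<partial>M n) ^ a"]) auto
qed

section \<open>The Gaussian power inequality\<close>

lemma distr_eq_std_gaussianI:
  assumes "prob_space N" and [measurable]: "X \<in> borel_measurable N"
    and cos: "\<And>c t. (\<integral>x. cos (c + t * X x) \<partial>N) = cos c * exp (- t\<^sup>2 / 2)"
  shows "distr N borel X = std_gaussian" (is "?D = _")
proof (rule Levy_uniqueness)
  interpret N: prob_space N by fact
  interpret G: prob_space std_gaussian by (rule prob_space_std_gaussian)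
  show 1: "real_distribution ?D"
    by (intro real_distribution.intro real_distribution_axioms.intro N.prob_space_distr) auto
  show 2: "real_distribution std_gaussian" by standard auto
  show "char ?D = char std_gaussian"
  proof
    fix t
    have "(\<integral>x. cos (c + t * x) \<partial>?D) = (\<integral>x. cos (c + t * x) \<partial>std_gaussian)" for c
      using cos[of c t] by (subst integral_distr) (auto simp: integral_cos_std_gaussian)
    then show "char ?D t = char std_gaussian t"
      unfolding char_eq_cos_integrals[OF 1] char_eq_cos_integrals[OF 2] by (simp only:)
  qed
qed

lemma distr_gaussian_pair:
  assumes "\<bar>\<rho>\<bar> \<le> 1"
  shows "distr gauss_pair borel (correlate \<rho>) = std_gaussian"
proof (rule distr_eq_std_gaussianI)
  show "prob_space gauss_pair" by (intro prob_space_pair prob_space_std_gaussian)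
qed (use gaussian_pair_cos[OF assms, of _ 0] in auto)

text \<open>Clipping continuous approximants to \<open>[0, C]\<close> keeps them continuous and does
  not disturb the limit, since \<open>f\<close> already lies in that range. Lebesgue null sets are
  null for the Gaussian because it has a density.\<close>

lemma bounded_measurable_ae_limit_continuous:
  fixes f :: "real \<Rightarrow> real"
  assumes [measurable]: "f \<in> borel_measurable borel" and f: "\<And>x. 0 \<le> f x" "\<And>x. f x \<le> C"
  obtains g where "\<And>n. continuous_on UNIV (g n)" "\<And>n x. 0 \<le> g n x" "\<And>n x. g n x \<le> C"
    "AE x in std_gaussian. (\<lambda>n. g n x) \<longlonglongrightarrow> f x"
proof -
  have "f measurable_on UNIV"
    by (intro lebesgue_measurable_imp_measurable_on) (auto intro: measurable_completion)
  then obtain N h where N: "negligible N" and h: "\<And>n. continuous_on UNIV (h n)"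
    "\<And>x. x \<notin> N \<Longrightarrow> (\<lambda>n. h n x) \<longlonglongrightarrow> f x"
    unfolding measurable_on_def by auto
  define g where "g n x = max 0 (min C (h n x))" for n and x :: real
  have "AE x in lebesgue. x \<notin> N"
    using N by (simp add: negligible_iff_null_sets AE_not_in)
  then have "AE x in lborel. x \<notin> N" by (simp add: AE_completion_iff)
  then have "AE x in lborel. (\<lambda>n. g n x) \<longlonglongrightarrow> f x"
  proof eventually_elim
    case (elim x)
    have "(\<lambda>n. g n x) \<longlonglongrightarrow> max 0 (min C (f x))"
      unfolding g_def by (intro tendsto_intros h elim)
    then show ?case using f[of x] by (simp add: max_absorb2 min_absorb2)
  qed
  then have "AE x in std_gaussian. (\<lambda>n. g n x) \<longlonglongrightarrow> f x"
    unfolding std_gaussian_def by (auto simp: AE_density elim: eventually_mono)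
  moreover have "0 \<le> C" using f(1)[of 0] f(2)[of 0] by simp
  ultimately show ?thesis
    using h by (intro that[of g]) (auto simp: g_def intro!: continuous_intros)
qed

lemma gaussian_power_inequality_measurable:
  fixes F G :: "real \<Rightarrow> real" and a :: nat
  assumes "a \<ge> 1" and F: "F \<in> borel_measurable borel" "\<And>x. 0 \<le> F x" "\<And>x. F x \<le> C"
    and G: "G \<in> borel_measurable borel" "\<And>x. 0 \<le> G x" "\<And>x. G x \<le> C"
  defines "\<rho> \<equiv> 1 - 1 / real a"
  shows "(\<integral>z. F (fst z) \<partial>gauss_pair) ^ a
      * (\<integral>z. G (correlate \<rho> z) \<partial>gauss_pair) ^ a
    \<le> (\<integral>z. F (fst z) ^ a * G (correlate \<rho> z) ^ a \<partial>gauss_pair)"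
proof -
  note [measurable] = F(1) G(1)
  interpret Gs: prob_space std_gaussian by (rule prob_space_std_gaussian)
  interpret P: pair_prob_space std_gaussian std_gaussian by standard
  let ?P = "gauss_pair"
  let ?m = "\<lambda>z. correlate \<rho> z"
  have rho: "\<bar>\<rho>\<bar> \<le> 1" using \<open>a \<ge> 1\<close> by (auto simp: \<rho>_def)
  have C0: "0 \<le> C" using F(2,3)[of 0] by simp
  obtain f where f: "\<And>n. continuous_on UNIV (f n)" "\<And>n x. 0 \<le> f n x" "\<And>n x. f n x \<le> C"
    "AE x in std_gaussian. (\<lambda>n. f n x) \<longlonglongrightarrow> F x"
    using bounded_measurable_ae_limit_continuous[OF F] by blast
  obtain g where g: "\<And>n. continuous_on UNIV (g n)" "\<And>n x. 0 \<le> g n x" "\<And>n x. g n x \<le> C"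
    "AE x in std_gaussian. (\<lambda>n. g n x) \<longlonglongrightarrow> G x"
    using bounded_measurable_ae_limit_continuous[OF G] by blast
  have [measurable]: "f n \<in> borel_measurable borel" "g n \<in> borel_measurable borel" for n
    using f(1) g(1) by (auto intro!: borel_measurable_continuous_onI)
  have ae_f: "AE z in ?P. (\<lambda>n. f n (fst z)) \<longlonglongrightarrow> F (fst z)"
  proof -
    have "AE x in std_gaussian. AE y in std_gaussian. (\<lambda>n. f n x) \<longlonglongrightarrow> F x"
      using f(4) by eventually_elim simp
    moreover have "{z \<in> space ?P. (\<lambda>n. f n (fst z)) \<longlonglongrightarrow> F (fst z)} \<in> sets ?P"
    proof -
      have "{x \<in> space borel. (\<lambda>n. f n x) \<longlonglongrightarrow> F x} \<in> sets borel" by measurable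
      from measurable_sets[OF measurable_fst[of std_gaussian std_gaussian], of "{x. (\<lambda>n. f n x) \<longlonglongrightarrow> F x}"] this
      show ?thesis by (simp add: vimage_def Int_def conj_commute)
    qed
    ultimately show ?thesis by (intro P.AE_pair_measure) auto
  qed
  \<comment> \<open>\<open>correlate\<close> has a standard Gaussian law, so the exceptional set for
    \<open>G\<close> pulls back to a null set of pairs.\<close>
  have "AE x in distr ?P borel ?m. (\<lambda>n. g n x) \<longlonglongrightarrow> G x"
    using g(4) unfolding distr_gaussian_pair[OF rho] .
  then have ae_g: "AE z in ?P. (\<lambda>n. g n (?m z)) \<longlonglongrightarrow> G (?m z)"
    by (subst (asm) AE_distr_iff) auto
  have l1: "(\<lambda>n. \<integral>z. f n (fst z) \<partial>?P) \<longlonglongrightarrow> (\<integral>z. F (fst z) \<partial>?P)"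
    by (rule integral_dominated_convergence[where w = "\<lambda>_. C"]) (use f ae_f in auto)
  have l2: "(\<lambda>n. \<integral>z. g n (?m z) \<partial>?P) \<longlonglongrightarrow> (\<integral>z. G (?m z) \<partial>?P)"
    by (rule integral_dominated_convergence[where w = "\<lambda>_. C"]) (use g ae_g in auto)
  have l3: "(\<lambda>n. \<integral>z. f n (fst z) ^ a * g n (?m z) ^ a \<partial>?P) \<longlonglongrightarrow> (\<integral>z. F (fst z) ^ a * G (?m z) ^ a \<partial>?P)"
  proof (rule integral_dominated_convergence[where w = "\<lambda>_. C ^ a * C ^ a"])
    show "AE z in ?P. (\<lambda>n. f n (fst z) ^ a * g n (?m z) ^ a) \<longlonglongrightarrow> F (fst z) ^ a * G (?m z) ^ a"
      using ae_f ae_g by eventually_elim (intro tendsto_intros)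
    show "AE z in ?P. norm (f n (fst z) ^ a * g n (?m z) ^ a) \<le> C ^ a * C ^ a" for n
      using f g C0 by (auto intro!: AE_I2 mult_mono power_mono simp: abs_mult)
  qed auto
  show ?thesis
    by (rule LIMSEQ_le[OF tendsto_mult[OF tendsto_power[OF l1] tendsto_power[OF l2]] l3])
       (use gaussian_power_inequality_continuous[OF \<open>a \<ge> 1\<close> f(1-3) g(1-3)] in \<open>auto simp: \<rho>_def\<close>)
qed

text \<open>Extended nonnegative values allow the tensorization to use Tonelli freely; the finite
  bound makes the passage to real functions lossless.\<close>

lemma gaussian_power_inequality:
  fixes F G :: "real \<Rightarrow> ennreal" and a :: nat
  assumes "a \<ge> 1" and F: "F \<in> borel_measurable borel" "\<And>x. F x \<le> ennreal C"
    and G: "G \<in> borel_measurable borel" "\<And>x. G x \<le> ennreal C"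
  defines "\<rho> \<equiv> 1 - 1 / real a"
  shows "(\<integral>\<^sup>+x. F x \<partial>std_gaussian) ^ a * (\<integral>\<^sup>+x. G x \<partial>std_gaussian) ^ a
    \<le> (\<integral>\<^sup>+x. \<integral>\<^sup>+y. F x ^ a * G (\<rho> * x + sqrt (1 - \<rho>\<^sup>2) * y) ^ a \<partial>std_gaussian \<partial>std_gaussian)"
proof -
  interpret Gs: prob_space std_gaussian by (rule prob_space_std_gaussian)
  interpret P: pair_prob_space std_gaussian std_gaussian by standard
  let ?P = "gauss_pair"
  let ?m = "\<lambda>z. correlate \<rho> z"
  have rho: "\<bar>\<rho>\<bar> \<le> 1" using \<open>a \<ge> 1\<close> by (auto simp: \<rho>_def)
  \<comment> \<open>\<open>C\<close> may be negative, in which case \<open>ennreal C\<close> is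
    0.\<close>
  define D where "D = max 0 C"
  have D: "0 \<le> D" "ennreal C \<le> ennreal D" by (auto simp: D_def ennreal_leI)
  define f where "f x = enn2real (F x)" for x
  define g where "g x = enn2real (G x)" for x
  have Ff: "F x = ennreal (f x)" and Gg: "G x = ennreal (g x)" for x
    using F(2)[of x] G(2)[of x] unfolding f_def g_def
    by (auto intro!: ennreal_enn2real[symmetric] elim: le_less_trans)
  have f: "f \<in> borel_measurable borel" "\<And>x. 0 \<le> f x" "\<And>x. f x \<le> D"
    using F D unfolding f_def[abs_def]
    by (auto intro!: enn2real_leI order.trans[OF F(2)])
  have g: "g \<in> borel_measurable borel" "\<And>x. 0 \<le> g x" "\<And>x. g x \<le> D"
    using G D unfolding g_def[abs_def]
    by (auto intro!: enn2real_leI order.trans[OF G(2)])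
  note [measurable] = f(1) g(1) F(1) G(1)
  have nn: "(\<integral>\<^sup>+z. ennreal (h z) \<partial>?P) = ennreal (\<integral>z. h z \<partial>?P)"
    if "h \<in> borel_measurable ?P" "\<And>z. 0 \<le> h z" "\<And>z. h z \<le> K" for h K
    using that by (intro nn_integral_eq_integral P.integrable_const_bound[where B = K]) auto
  have "(\<integral>\<^sup>+x. F x \<partial>std_gaussian) = (\<integral>\<^sup>+z. ennreal (f (fst z)) \<partial>?P)"
    by (subst Gs.nn_integral_fst[symmetric]) (auto simp: Ff intro!: nn_integral_cong)
  also have "\<dots> = ennreal (\<integral>z. f (fst z) \<partial>?P)" using f by (intro nn[of _ D]) auto
  finally have 1: "(\<integral>\<^sup>+x. F x \<partial>std_gaussian) = ennreal (\<integral>z. f (fst z) \<partial>?P)" .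
  have "(\<integral>\<^sup>+x. G x \<partial>std_gaussian) = (\<integral>\<^sup>+x. G x \<partial>distr ?P borel ?m)"
    by (simp add: distr_gaussian_pair[OF rho])
  also have "\<dots> = (\<integral>\<^sup>+z. ennreal (g (?m z)) \<partial>?P)"
    by (subst nn_integral_distr) (auto simp: Gg)
  also have "\<dots> = ennreal (\<integral>z. g (?m z) \<partial>?P)" using g by (intro nn[of _ D]) auto
  finally have 2: "(\<integral>\<^sup>+x. G x \<partial>std_gaussian) = ennreal (\<integral>z. g (?m z) \<partial>?P)" .
  have "(\<integral>\<^sup>+x. \<integral>\<^sup>+y. F x ^ a * G (\<rho> * x + sqrt (1 - \<rho>\<^sup>2) * y) ^ a \<partial>std_gaussian \<partial>std_gaussian)
     = (\<integral>\<^sup>+z. ennreal (f (fst z) ^ a * g (?m z) ^ a) \<partial>?P)"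
    using f g by (subst Gs.nn_integral_fst[symmetric]) (auto simp: Ff Gg ennreal_mult ennreal_power)
  also have "\<dots> = ennreal (\<integral>z. f (fst z) ^ a * g (?m z) ^ a \<partial>?P)"
    using f g D by (intro nn[of _ "D ^ a * D ^ a"]) (auto intro!: mult_mono power_mono)
  also have "\<dots> \<ge> ennreal ((\<integral>z. f (fst z) \<partial>?P) ^ a * (\<integral>z. g (?m z) \<partial>?P) ^ a)"
    using gaussian_power_inequality_measurable[OF \<open>a \<ge> 1\<close> f g] by (intro ennreal_leI) (simp add: \<rho>_def)
  finally show ?thesis
    unfolding 1 2 using f g by (simp add: ennreal_mult ennreal_power Bochner_Integration.integral_nonneg)
qed

section \<open>Gaussian vectors and tensorization over the coordinates\<close>

definition mix :: "nat \<Rightarrow> real \<Rightarrow> rvec \<Rightarrow> rvec \<Rightarrow> rvec" where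
  "mix d \<rho> u g = (\<lambda>i\<in>{..<d}. \<rho> * u i + sqrt (1 - \<rho>\<^sup>2) * g i)"

lemma prob_space_gaussian_vec: "prob_space (gaussian_vec d)"
  unfolding gaussian_vec_def by (intro prob_space_PiM prob_space_std_gaussian)

lemma sets_gaussian_vec [measurable_cong, simp]: "sets (gaussian_vec d) = sets (vec_space d)"
  unfolding gaussian_vec_def vec_space_def by (intro sets_PiM_cong) auto

lemma space_gaussian_vec [simp]: "space (gaussian_vec d) = space (vec_space d)"
  by (rule sets_eq_imp_space_eq) simp

lemma emeasure_gaussian_vec_space [simp]: "emeasure (gaussian_vec d) (space (vec_space d)) = 1"
  using prob_space.emeasure_space_1[OF prob_space_gaussian_vec] by simp

lemma space_vec_space: "space (vec_space d) = {..<d} \<rightarrow>\<^sub>E UNIV"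
  by (simp add: vec_space_def space_PiM)

lemma mix_measurable [measurable (raw)]:
  assumes [measurable]: "f \<in> M \<rightarrow>\<^sub>M vec_space d" "g \<in> M \<rightarrow>\<^sub>M vec_space d"
  shows "(\<lambda>x. mix d \<rho> (f x) (g x)) \<in> M \<rightarrow>\<^sub>M vec_space d"
proof -
  have "(\<lambda>x. f x i) \<in> borel_measurable M" "(\<lambda>x. g x i) \<in> borel_measurable M" if "i < d" for i
    using assms that by (auto simp: vec_space_def intro: measurable_PiM_component_rev measurable_component_singleton[THEN measurable_compose[rotated]])
  then show ?thesis
    unfolding mix_def vec_space_def by (intro measurable_restrict) auto
qed

text \<open>Induction on the dimension, splitting off the last coordinate. The one-dimensional
  inequality is applied to the functions of that coordinate obtained by integrating out the others;
  both sides carry the same power \<open>a\<close>, so the constant stays 1 in every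
  dimension.\<close>

lemma gaussian_vec_power_inequality:
  fixes F G :: "rvec \<Rightarrow> ennreal" and a :: nat
  assumes "a \<ge> 1" and "F \<in> borel_measurable (vec_space d)" "\<And>x. F x \<le> ennreal C"
    and "G \<in> borel_measurable (vec_space d)" "\<And>x. G x \<le> ennreal C"
  defines "\<rho> \<equiv> 1 - 1 / real a"
  shows "(\<integral>\<^sup>+u. F u \<partial>gaussian_vec d) ^ a * (\<integral>\<^sup>+u. G u \<partial>gaussian_vec d) ^ a
    \<le> (\<integral>\<^sup>+u. \<integral>\<^sup>+g. F u ^ a * G (mix d \<rho> u g) ^ a \<partial>gaussian_vec d \<partial>gaussian_vec d)"
  using assms(2-5)
proof (induction d arbitrary: F G)
  case 0
  have "gaussian_vec 0 = count_space {\<lambda>_. undefined}"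
    by (simp add: gaussian_vec_def PiM_empty)
  moreover have "mix 0 \<rho> u g = (\<lambda>_. undefined)" for u g by (auto simp: mix_def)
  ultimately show ?case by (simp add: nn_integral_count_space_finite)
next
  case (Suc d)
  let ?\<gamma> = "gaussian_vec d" and ?\<gamma>' = "gaussian_vec (Suc d)" and ?s = "std_gaussian"
  interpret Gs: prob_space std_gaussian by (rule prob_space_std_gaussian)
  interpret product_sigma_finite "\<lambda>_::nat. std_gaussian" by standard
  interpret g: prob_space ?\<gamma> by (rule prob_space_gaussian_vec)
  interpret g': prob_space ?\<gamma>' by (rule prob_space_gaussian_vec)
  interpret Q: pair_sigma_finite ?\<gamma> ?s by standard
  note [measurable] = Suc.prems(1,3)
  have upd[measurable]: "(\<lambda>z. (fst z)(d := snd z)) \<in> vec_space d \<Otimes>\<^sub>M borel \<rightarrow>\<^sub>M vec_space (Suc d)"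
    unfolding vec_space_def lessThan_Suc
    using measurable_add_dim[of d "{..<d}" "\<lambda>_. borel::real measure"] by (simp add: case_prod_beta')
  have updm[measurable (raw)]: "(\<lambda>x. (f x)(d := h x)) \<in> M \<rightarrow>\<^sub>M vec_space (Suc d)"
    if [measurable]: "f \<in> M \<rightarrow>\<^sub>M vec_space d" "h \<in> M \<rightarrow>\<^sub>M borel" for f h and M :: "'z measure"
    using measurable_compose[OF measurable_Pair[OF that] upd] by simp
  have split: "(\<integral>\<^sup>+u. H u \<partial>?\<gamma>') = (\<integral>\<^sup>+x. \<integral>\<^sup>+u. H (u(d := x)) \<partial>?\<gamma> \<partial>?s)"
    if "H \<in> borel_measurable (vec_space (Suc d))" for H
    unfolding gaussian_vec_def lessThan_Suc
    by (rule product_nn_integral_insert_rev)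
       (use that in \<open>auto simp flip: lessThan_Suc gaussian_vec_def cong: measurable_cong_sets\<close>)
  define F' where "F' x = (\<integral>\<^sup>+u. F (u(d := x)) \<partial>?\<gamma>)" for x
  define G' where "G' x = (\<integral>\<^sup>+u. G (u(d := x)) \<partial>?\<gamma>)" for x
  have m: "mix (Suc d) \<rho> (u(d := x)) (g(d := y)) = (mix d \<rho> u g)(d := \<rho> * x + sqrt (1 - \<rho>\<^sup>2) * y)" for u g x y
    by (auto simp: mix_def fun_eq_iff restrict_def)
  have bd: "(\<integral>\<^sup>+u. H u \<partial>?\<gamma>) \<le> ennreal C" if "\<And>u. H u \<le> ennreal C" for H
    using nn_integral_mono[of ?\<gamma> H "\<lambda>_. ennreal C"] that by simp
  have "(\<integral>\<^sup>+u. F u \<partial>?\<gamma>') ^ a * (\<integral>\<^sup>+u. G u \<partial>?\<gamma>') ^ a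
     = (\<integral>\<^sup>+x. F' x \<partial>?s) ^ a * (\<integral>\<^sup>+x. G' x \<partial>?s) ^ a"
    by (simp add: split F'_def G'_def)
  also have "\<dots> \<le> (\<integral>\<^sup>+x. \<integral>\<^sup>+y. F' x ^ a * G' (\<rho> * x + sqrt (1 - \<rho>\<^sup>2) * y) ^ a \<partial>?s \<partial>?s)"
    unfolding \<rho>_def
    by (rule gaussian_power_inequality[OF \<open>a \<ge> 1\<close>, where C = C])
       (auto simp: F'_def[abs_def] G'_def[abs_def] intro!: bd Suc.prems)
  \<comment> \<open>For fixed \<open>x\<close> and \<open>y\<close> the integrand is the left side
    of the inequality in dimension \<open>d\<close> for two slices, so the induction hypothesis
    applies inside the outer integrals. Fubini then brings \<open>x\<close> next to \<open>u\<close>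
    and \<open>y\<close> next to \<open>g\<close>.\<close>
  also have "\<dots> \<le> (\<integral>\<^sup>+x. \<integral>\<^sup>+y. \<integral>\<^sup>+u. \<integral>\<^sup>+g. F (u(d := x)) ^ a *
      G ((mix d \<rho> u g)(d := \<rho> * x + sqrt (1 - \<rho>\<^sup>2) * y)) ^ a \<partial>?\<gamma> \<partial>?\<gamma> \<partial>?s \<partial>?s)"
    unfolding F'_def G'_def
    by (intro nn_integral_mono Suc.IH Suc.prems; measurable)
  also have "\<dots> = (\<integral>\<^sup>+x. \<integral>\<^sup>+u. \<integral>\<^sup>+y. \<integral>\<^sup>+g. F (u(d := x)) ^ a *
      G ((mix d \<rho> u g)(d := \<rho> * x + sqrt (1 - \<rho>\<^sup>2) * y)) ^ a \<partial>?\<gamma> \<partial>?s \<partial>?\<gamma> \<partial>?s)"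
    by (intro nn_integral_cong Q.Fubini') measurable
  also have "\<dots> = (\<integral>\<^sup>+x. \<integral>\<^sup>+u. \<integral>\<^sup>+g. F (u(d := x)) ^ a *
      G (mix (Suc d) \<rho> (u(d := x)) g) ^ a \<partial>?\<gamma>' \<partial>?\<gamma> \<partial>?s)"
  proof (intro nn_integral_cong)
    fix x u assume "u \<in> space ?\<gamma>"
    then have c: "u(d := x) \<in> space (vec_space (Suc d))"
      by (auto simp: space_vec_space PiE_def extensional_def)
    have [measurable]: "(\<lambda>_. u(d := x)) \<in> vec_space (Suc d) \<rightarrow>\<^sub>M vec_space (Suc d)"
      by (rule measurable_const[OF c])
    have "(\<lambda>g. F (u(d := x)) ^ a * G (mix (Suc d) \<rho> (u(d := x)) g) ^ a) \<in> borel_measurable (vec_space (Suc d))"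
      by measurable
    then show "(\<integral>\<^sup>+y. \<integral>\<^sup>+g. F (u(d := x)) ^ a *
      G ((mix d \<rho> u g)(d := \<rho> * x + sqrt (1 - \<rho>\<^sup>2) * y)) ^ a \<partial>?\<gamma> \<partial>?s)
      = (\<integral>\<^sup>+g. F (u(d := x)) ^ a * G (mix (Suc d) \<rho> (u(d := x)) g) ^ a \<partial>?\<gamma>')"
      by (subst split) (auto simp: m)
  qed
  also have "\<dots> = (\<integral>\<^sup>+u. \<integral>\<^sup>+g. F u ^ a * G (mix (Suc d) \<rho> u g) ^ a \<partial>?\<gamma>' \<partial>?\<gamma>')"
    by (subst split) auto
  finally show ?case .
qed

section \<open>Survival of walks\<close>

lemma measure_gaussian_vec_space [simp]: "measure (gaussian_vec d) (space (vec_space d)) = 1"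
  by (simp add: measure_def)

text \<open>The Ornstein--Uhlenbeck noise operator, in Mehler's form.\<close>

definition smooth :: "nat \<Rightarrow> real \<Rightarrow> (rvec \<Rightarrow> real) \<Rightarrow> rvec \<Rightarrow> real" where
  "smooth d \<rho> f u = (\<integral>g. f (mix d \<rho> u g) \<partial>gaussian_vec d)"

lemma smooth_measurable [measurable]:
  assumes [measurable]: "f \<in> borel_measurable (vec_space d)"
  shows "smooth d \<rho> f \<in> borel_measurable (vec_space d)"
proof -
  interpret prob_space "gaussian_vec d" by (rule prob_space_gaussian_vec)
  show ?thesis unfolding smooth_def[abs_def] by measurable
qed

lemma integrable_gaussian_vec_bounded:
  fixes f :: "rvec \<Rightarrow> real"
  assumes "f \<in> borel_measurable (vec_space d)" "\<And>u. u \<in> space (vec_space d) \<Longrightarrow> \<bar>f u\<bar> \<le> B"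
  shows "integrable (gaussian_vec d) f"
proof -
  interpret prob_space "gaussian_vec d" by (rule prob_space_gaussian_vec)
  show ?thesis using assms by (intro integrable_const_bound[where B = B]) auto
qed

lemma mix_measurable_right [measurable]: "u \<in> space (vec_space d) \<Longrightarrow> mix d \<rho> u \<in> vec_space d \<rightarrow>\<^sub>M vec_space d"
  by (rule mix_measurable) auto

lemma smooth_bounds:
  assumes [measurable]: "f \<in> borel_measurable (vec_space d)" and f: "\<And>u. 0 \<le> f u" "\<And>u. f u \<le> 1"
  shows "0 \<le> smooth d \<rho> f u" "smooth d \<rho> f u \<le> 1"
proof -
  interpret prob_space "gaussian_vec d" by (rule prob_space_gaussian_vec)
  show "0 \<le> smooth d \<rho> f u" unfolding smooth_def using f by simp
  show "smooth d \<rho> f u \<le> 1"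
  proof (cases "integrable (gaussian_vec d) (\<lambda>g. f (mix d \<rho> u g))")
    case True
    then have "smooth d \<rho> f u \<le> (\<integral>g. 1 \<partial>gaussian_vec d)"
      unfolding smooth_def using f by (intro integral_mono) auto
    then show ?thesis by simp
  \<comment> \<open>A non-integrable integrand has Bochner integral 0, so the bound holds for every
    \<open>u\<close>.\<close>
  qed (simp add: smooth_def not_integrable_integral_eq)
qed

text \<open>Pairing \<open>f\<close> with \<open>G = (T f + \<eta>)\<^bsup>-1/a\<^esup>\<close> on \<open>A\<close> in the power inequality bounds the negative
  moment of \<open>T f\<close> on \<open>A\<close>; Cauchy--Schwarz turns this into a bound for the positive moment.\<close>

lemma smooth_root_integral_ge_regularized:
  assumes "a \<ge> 1" and [measurable]: "f \<in> borel_measurable (vec_space d)" "A \<in> sets (vec_space d)"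
    and f: "\<And>u. 0 \<le> f u" "\<And>u. f u \<le> 1" and "\<eta> > 0"
  defines "\<rho> \<equiv> 1 - 1 / real a"
  shows "(measure (gaussian_vec d) A)\<^sup>2 * (\<integral>u. root a (f u) \<partial>gaussian_vec d)
     \<le> (\<integral>u. indicator A u * root a (smooth d \<rho> f u + \<eta>) \<partial>gaussian_vec d)"
proof -
  let ?\<gamma> = "gaussian_vec d"
  interpret prob_space ?\<gamma> by (rule prob_space_gaussian_vec)
  have a: "a > 0" using \<open>a \<ge> 1\<close> by simp
  note sb = smooth_bounds[OF \<open>f \<in> _\<close> f, of \<rho>]
  define h where "h u = smooth d \<rho> f u + \<eta>" for u
  have h: "\<eta> \<le> h u" "h u \<le> 1 + \<eta>" "0 < h u" "smooth d \<rho> f u \<le> h u" for u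
    using sb[of u] \<open>\<eta> > 0\<close> by (auto simp: h_def)
  have [measurable]: "h \<in> borel_measurable (vec_space d)" unfolding h_def[abs_def] by measurable
  define F where "F u = root a (f u)" for u
  define G where "G u = indicator A u * root a (1 / h u)" for u
  have [measurable]: "F \<in> borel_measurable (vec_space d)" "G \<in> borel_measurable (vec_space d)"
    unfolding F_def[abs_def] G_def[abs_def] by measurable
  \<comment> \<open>The power inequality needs a common bound; for \<open>G\<close> it exists
    because \<open>\<eta>\<close> keeps the denominator away from 0.\<close>
  define B where "B = max 1 (root a (1 / \<eta>))"
  have F: "0 \<le> F u" "F u \<le> B" "F u ^ a = f u" for u
    using f[of u] a unfolding F_def B_def
    by (auto simp: real_root_pow_pos2 le_max_iff_disj real_root_le_1_iff)
  have G: "0 \<le> G u" "G u \<le> B" "G u ^ a = indicator A u * (1 / h u)" for u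
  proof -
    show "0 \<le> G u" using h[of u] a by (simp add: G_def)
    have "root a (1 / h u) \<le> root a (1 / \<eta>)" using h[of u] a \<open>\<eta> > 0\<close> by (simp add: frac_le)
    then show "G u \<le> B" by (auto simp: G_def B_def indicator_def)
    have "0 \<le> 1 / h u" using h(3)[of u] by simp
    then have "root a (1 / h u) ^ a = 1 / h u" using a by (intro real_root_pow_pos2) auto
    then show "G u ^ a = indicator A u * (1 / h u)" using a by (auto simp: G_def indicator_def)
  qed
  have iF: "integrable ?\<gamma> F" and iG: "integrable ?\<gamma> G"
    using F G by (auto intro!: integrable_gaussian_vec_bounded[where B = B])
  have nF: "(\<integral>\<^sup>+u. ennreal (F u) \<partial>?\<gamma>) = ennreal (\<integral>u. F u \<partial>?\<gamma>)"
    and nG: "(\<integral>\<^sup>+u. ennreal (G u) \<partial>?\<gamma>) = ennreal (\<integral>u. G u \<partial>?\<gamma>)"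
    using iF iG F G by (auto intro!: nn_integral_eq_integral)
  have E0: "0 \<le> (\<integral>u. F u \<partial>?\<gamma>)" "0 \<le> (\<integral>u. G u \<partial>?\<gamma>)" using F G by auto
  have "(\<integral>\<^sup>+u. ennreal (G u) \<partial>?\<gamma>) ^ a * (\<integral>\<^sup>+u. ennreal (F u) \<partial>?\<gamma>) ^ a
     \<le> (\<integral>\<^sup>+u. \<integral>\<^sup>+g. ennreal (G u) ^ a * ennreal (F (mix d \<rho> u g)) ^ a \<partial>?\<gamma> \<partial>?\<gamma>)"
    unfolding \<rho>_def
    by (rule gaussian_vec_power_inequality[where C = B]) (use \<open>a \<ge> 1\<close> F G in \<open>auto intro!: ennreal_leI\<close>)
  also have "\<dots> \<le> (\<integral>\<^sup>+u. 1 \<partial>?\<gamma>)"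
  proof (rule nn_integral_mono)
    fix u assume "u \<in> space ?\<gamma>"
    then have [measurable]: "u \<in> space (vec_space d)" by simp
    have "(\<integral>\<^sup>+g. ennreal (G u) ^ a * ennreal (F (mix d \<rho> u g)) ^ a \<partial>?\<gamma>)
       = (\<integral>\<^sup>+g. ennreal (indicator A u * (1 / h u)) * ennreal (f (mix d \<rho> u g)) \<partial>?\<gamma>)"
      using F G by (simp add: ennreal_power)
    also have "\<dots> = ennreal (indicator A u * (1 / h u)) * (\<integral>\<^sup>+g. ennreal (f (mix d \<rho> u g)) \<partial>?\<gamma>)"
      by (rule nn_integral_cmult) measurable
    also have "(\<integral>\<^sup>+g. ennreal (f (mix d \<rho> u g)) \<partial>?\<gamma>) = ennreal (smooth d \<rho> f u)"
      unfolding smooth_def using f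
      by (intro nn_integral_eq_integral integrable_gaussian_vec_bounded[where B = 1]) auto
    \<comment> \<open>Integrating out the innovation has turned \<open>F^a\<close> into
      \<open>smooth d \<rho> f\<close>, and \<open>T f / (T f + \<eta>)\<close> is at most
      1.\<close>
    also have "ennreal (indicator A u * (1 / h u)) * ennreal (smooth d \<rho> f u) \<le> 1"
      using h[of u] sb[of u]
      by (auto simp: indicator_def ennreal_mult[symmetric] divide_le_eq_1 simp flip: ennreal_1 intro!: ennreal_leI)
    finally show "(\<integral>\<^sup>+g. ennreal (G u) ^ a * ennreal (F (mix d \<rho> u g)) ^ a \<partial>?\<gamma>) \<le> 1" .
  qed
  finally have "ennreal (((\<integral>u. G u \<partial>?\<gamma>) * (\<integral>u. F u \<partial>?\<gamma>)) ^ a) \<le> ennreal 1"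
    using E0 by (simp add: nF nG ennreal_mult ennreal_power power_mult_distrib)
  then have "((\<integral>u. G u \<partial>?\<gamma>) * (\<integral>u. F u \<partial>?\<gamma>)) ^ a \<le> 1 ^ a"
    using E0 by (subst (asm) ennreal_le_iff) auto
  then have le1: "(\<integral>u. G u \<partial>?\<gamma>) * (\<integral>u. F u \<partial>?\<gamma>) \<le> 1"
    using E0 a by (subst (asm) power_mono_iff) auto
  define E where "E = (\<integral>u. F u \<partial>?\<gamma>)"
  define c where "c = measure ?\<gamma> A * E"
  have iH: "integrable ?\<gamma> (\<lambda>u. indicator A u * root a (h u))"
    using h a \<open>\<eta> > 0\<close> by (intro integrable_gaussian_vec_bounded[where B = "root a (1 + \<eta>)"])
       (auto simp: indicator_def less_imp_le)
  have iA: "integrable ?\<gamma> (indicator A :: _ \<Rightarrow> real)"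
    by (intro integrable_gaussian_vec_bounded[where B = 1]) auto
  \<comment> \<open>A pointwise form of Cauchy--Schwarz, namely \<open>(r - c)^2 / r >= 0\<close>
    for \<open>r = root a (h u)\<close>. After integration, with the integral of \<open>G\<close> at
    most \<open>1 / E\<close> by \<open>le1\<close>, the lower bound is
    \<open>2 * c * measure ?\<gamma> A - c^2 / E\<close>; the value chosen for \<open>c\<close>
    maximises it when \<open>E > 0\<close>.\<close>
  have AH: "2 * c * indicator A u - c\<^sup>2 * G u \<le> indicator A u * root a (h u)" for u
  proof (cases "u \<in> A")
    case True
    define r where "r = root a (h u)"
    have r: "r > 0" using h[of u] a by (simp add: r_def)
    have G1: "G u = 1 / r" using True a by (simp add: G_def r_def real_root_divide)
    have "0 \<le> (r - c)\<^sup>2 / r" using r by simp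
    also have "\<dots> = r - 2 * c + c\<^sup>2 * (1 / r)" using r by (simp add: power2_eq_square field_simps)
    finally show ?thesis using True G1 by (simp add: r_def)
  qed (simp add: G_def)
  have "(measure ?\<gamma> A)\<^sup>2 * E = 2 * c * measure ?\<gamma> A - (measure ?\<gamma> A)\<^sup>2 * E * 1"
    by (simp add: c_def power2_eq_square)
  also have "\<dots> \<le> 2 * c * measure ?\<gamma> A - (measure ?\<gamma> A)\<^sup>2 * E * ((\<integral>u. G u \<partial>?\<gamma>) * E)"
    using le1 E0 by (intro diff_left_mono mult_left_mono) (auto simp: E_def)
  also have "\<dots> = (\<integral>u. 2 * c * indicator A u - c\<^sup>2 * G u \<partial>?\<gamma>)"
    using iA iG by (simp add: c_def power2_eq_square field_simps)
  also have "\<dots> \<le> (\<integral>u. indicator A u * root a (h u) \<partial>?\<gamma>)"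
    using iA iG iH AH by (intro integral_mono) auto
  finally show ?thesis unfolding E_def F_def h_def .
qed

text \<open>The regularisation is removed by dominated convergence along \<open>1 / Suc n\<close>.
  Continuity of the root covers the points where \<open>smooth d \<rho> f\<close> vanishes.\<close>

lemma smooth_root_integral_ge:
  assumes "a \<ge> 1" and m[measurable]: "f \<in> borel_measurable (vec_space d)" "A \<in> sets (vec_space d)"
    and f: "\<And>u. 0 \<le> f u" "\<And>u. f u \<le> 1"
  defines "\<rho> \<equiv> 1 - 1 / real a"
  shows "(measure (gaussian_vec d) A)\<^sup>2 * (\<integral>u. root a (f u) \<partial>gaussian_vec d)
     \<le> (\<integral>u. indicator A u * root a (smooth d \<rho> f u) \<partial>gaussian_vec d)"
proof (rule LIMSEQ_le_const)
  let ?\<gamma> = "gaussian_vec d"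
  interpret prob_space ?\<gamma> by (rule prob_space_gaussian_vec)
  have a: "a > 0" using \<open>a \<ge> 1\<close> by simp
  note sb = smooth_bounds[OF m(1) f, of \<rho>]
  show "(\<lambda>n. \<integral>u. indicator A u * root a (smooth d \<rho> f u + 1 / real (Suc n)) \<partial>?\<gamma>)
    \<longlonglongrightarrow> (\<integral>u. indicator A u * root a (smooth d \<rho> f u) \<partial>?\<gamma>)"
  proof (rule integral_dominated_convergence[where w = "\<lambda>_. root a 2"])
    have "(\<lambda>n. indicator A u * root a (smooth d \<rho> f u + 1 / real (Suc n)))
       \<longlonglongrightarrow> indicator A u * root a (smooth d \<rho> f u + 0)" for u
      by (intro tendsto_intros LIMSEQ_Suc lim_1_over_n)
    then show "AE u in ?\<gamma>. (\<lambda>n. indicator A u * root a (smooth d \<rho> f u + 1 / real (Suc n)))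
       \<longlonglongrightarrow> indicator A u * root a (smooth d \<rho> f u)" by simp
    show "AE u in ?\<gamma>. norm (indicator A u * root a (smooth d \<rho> f u + 1 / real (Suc n))) \<le> root a 2" for n
    proof (rule AE_I2)
      fix u
      have "1 / real (Suc n) \<le> 1" by simp
      then have "smooth d \<rho> f u + 1 / real (Suc n) \<le> 2" using sb[of u] by linarith
      moreover have "0 \<le> smooth d \<rho> f u + 1 / real (Suc n)" using sb[of u] by simp
      ultimately show "norm (indicator A u * root a (smooth d \<rho> f u + 1 / real (Suc n))) \<le> root a 2"
        using a by (auto simp: indicator_def)
    qed
  qed auto
  show "\<exists>N. \<forall>n\<ge>N. (measure ?\<gamma> A)\<^sup>2 * (\<integral>u. root a (f u) \<partial>?\<gamma>)
     \<le> (\<integral>u. indicator A u * root a (smooth d \<rho> f u + 1 / real (Suc n)) \<partial>?\<gamma>)"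
    using smooth_root_integral_ge_regularized[OF \<open>a \<ge> 1\<close> m f, of "1 / real (Suc _)"]
    by (auto simp: \<rho>_def)
qed

text \<open>The tangent of the convex function \<open>t^a\<close> at \<open>m\<close>. Summed over
  vertices and integrated, it acts as Jensen's inequality for both averages at once.\<close>

lemma power_ge_tangent:
  fixes t m :: real
  assumes "0 \<le> t" "0 \<le> m" "a \<ge> 1"
  shows "m ^ a + real a * m ^ (a - 1) * (t - m) \<le> t ^ a"
proof (cases "m = 0")
  case True
  then show ?thesis using assms by (cases "a = 1") (auto simp: power_0_left)
next
  case False
  then have m: "m > 0" using assms by simp
  have "1 + real a * (t / m - 1) \<le> (1 + (t / m - 1)) ^ a"
    using assms m by (intro Bernoulli_inequality) auto
  then have "m ^ a * (1 + real a * (t / m - 1)) \<le> m ^ a * (t / m) ^ a" using m by simp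
  also have "m ^ a * (t / m) ^ a = t ^ a" using m by (simp add: power_divide)
  also have "m ^ a * (1 + real a * (t / m - 1)) = m ^ a + real a * m ^ (a - 1) * (t - m)"
    using m \<open>a \<ge> 1\<close> by (cases a) (auto simp: field_simps)
  finally show ?thesis .
qed

section \<open>Survival probabilities inside a vertex set\<close>

definition edge_event :: "nat \<Rightarrow> (rvec \<Rightarrow> (nat \<times> nat) set) \<Rightarrow> nat \<Rightarrow> nat \<Rightarrow> rvec set" where
  "edge_event d M x y = {u \<in> space (vec_space d). (x, y) \<in> M u}"

text \<open>The conditional probability that a walk inside \<open>S\<close> started at \<open>x\<close> survives \<open>k\<close> steps, given that
  its first direction is \<open>u\<close>.\<close>

fun survival :: "nat \<Rightarrow> real \<Rightarrow> (rvec \<Rightarrow> (nat \<times> nat) set) \<Rightarrow> nat set \<Rightarrow> nat \<Rightarrow> nat \<Rightarrow> rvec \<Rightarrow> real" where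
  "survival d \<rho> M S 0 x u = 1"
| "survival d \<rho> M S (Suc k) x u =
     (\<Sum>y\<in>S. indicator (edge_event d M x y) u * smooth d \<rho> (survival d \<rho> M S k y) u)"

locale matching_family =
  fixes n d :: nat and M :: "rvec \<Rightarrow> (nat \<times> nat) set"
  assumes matching: "\<And>u. u \<in> space (vec_space d) \<Longrightarrow> directed_matching n (M u)"
    and edge_sets [measurable]: "\<And>x y. edge_event d M x y \<in> sets (vec_space d)"
begin

abbreviation "edge \<equiv> edge_event d M"
abbreviation "surv \<equiv> \<lambda>\<rho>. survival d \<rho> M"

lemma matching_edge_unique:
  assumes "u \<in> space (vec_space d)" "e \<in> M u" "e' \<in> M u" "z \<in> {fst e, snd e}" "z \<in> {fst e', snd e'}"
  shows "e = e'"
  using matching[OF assms(1)] assms(2-) unfolding directed_matching_def by blast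

lemma out_unique: "u \<in> edge x y \<Longrightarrow> u \<in> edge x y' \<Longrightarrow> y = y'"
  using matching_edge_unique[of u "(x, y)" "(x, y')" x] by (auto simp: edge_event_def)

lemma in_unique: "u \<in> edge x y \<Longrightarrow> u \<in> edge x' y \<Longrightarrow> x = x'"
  using matching_edge_unique[of u "(x, y)" "(x', y)" y] by (auto simp: edge_event_def)

lemma sum_out_edges:
  fixes h :: "nat \<Rightarrow> 'b :: semiring_1"
  assumes "finite S" "y \<in> S" "u \<in> edge x y"
  shows "(\<Sum>y\<in>S. indicator (edge x y) u * h y) = h y"
proof -
  have "(\<Sum>y\<in>S. indicator (edge x y) u * h y) = (\<Sum>z\<in>S. if z = y then h y else 0)"
    using assms(3) by (intro sum.cong) (auto simp: indicator_def dest: out_unique)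
  then show ?thesis using assms by simp
qed

lemma survival_measurable [measurable]: "surv \<rho> S k x \<in> borel_measurable (vec_space d)"
proof (induction k arbitrary: x)
  case 0 then show ?case by (simp add: survival.simps(1)[abs_def])
next
  case (Suc k)
  note [measurable] = Suc
  show ?case unfolding survival.simps(2)[abs_def] by measurable
qed

lemma survival_bounds:
  assumes "finite S"
  shows "0 \<le> surv \<rho> S k x u" "surv \<rho> S k x u \<le> 1"
proof (induction k arbitrary: x u)
  case 0
  { case 1 show ?case by simp next case 2 show ?case by simp }
next
  case (Suc k)
  have b: "0 \<le> smooth d \<rho> (surv \<rho> S k y) u" "smooth d \<rho> (surv \<rho> S k y) u \<le> 1" for y u
    using Suc by (auto intro!: smooth_bounds)
  { case 1 show ?case using b by (auto intro!: sum_nonneg)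
  next
    case 2
    show ?case
    proof (cases "\<exists>y\<in>S. u \<in> edge x y")
      case True
      then obtain y where "y \<in> S" "u \<in> edge x y" by blast
      then show ?thesis using b by (simp add: sum_out_edges[OF assms])
    next
      case False
      then have "indicator (edge x y) u = (0::real)" if "y \<in> S" for y
        using that by (auto simp: indicator_def)
      then show ?thesis by simp
    qed
  }
qed

text \<open>The root passes through the sum because a vertex has at most one outgoing edge, so at
  most one summand is nonzero.\<close>

lemma root_survival_Suc:
  assumes "finite S" "a > 0"
  shows "root a (surv \<rho> S (Suc k) x u) =
    (\<Sum>y\<in>S. indicator (edge x y) u * root a (smooth d \<rho> (surv \<rho> S k y) u))"
proof (cases "\<exists>y\<in>S. u \<in> edge x y")
  case True
  then obtain y where "y \<in> S" "u \<in> edge x y" by blast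
  then show ?thesis by (simp add: sum_out_edges[OF assms(1)])
next
  case False
  then have "indicator (edge x y) u = (0::real)" if "y \<in> S" for y using that by (auto simp: indicator_def)
  then show ?thesis by simp
qed

text \<open>After the sums are exchanged, the edges into a fixed \<open>y\<close> come from disjoint
  events, whose union \<open>A y\<close> has as its measure the in-degree, at least
  \<open>\<beta>\<close>. The moment inequality on \<open>A y\<close> then costs
  \<open>\<beta>^2\<close> per step, independently of \<open>a\<close> and of the dimension.\<close>

lemma sum_root_survival_ge:
  assumes S: "finite S" and "a \<ge> 1" and "\<beta> \<ge> 0"
    and deg: "\<And>y. y \<in> S \<Longrightarrow> \<beta> \<le> (\<Sum>x\<in>S. measure (gaussian_vec d) (edge x y))"
  defines "\<rho> \<equiv> 1 - 1 / real a"
  shows "\<beta> ^ (2 * k) * real (card S) \<le> (\<Sum>x\<in>S. \<integral>u. root a (surv \<rho> S k x u) \<partial>gaussian_vec d)"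
proof (induction k)
  case 0
  interpret prob_space "gaussian_vec d" by (rule prob_space_gaussian_vec)
  show ?case using \<open>a \<ge> 1\<close> by simp
next
  case (Suc k)
  let ?\<gamma> = "gaussian_vec d"
  interpret prob_space ?\<gamma> by (rule prob_space_gaussian_vec)
  have a: "a > 0" using \<open>a \<ge> 1\<close> by simp
  define r where "r y u = root a (smooth d \<rho> (surv \<rho> S k y) u)" for y u
  define A where "A y = (\<Union>x\<in>S. edge x y)" for y
  have sb: "0 \<le> smooth d \<rho> (surv \<rho> S k y) u" "smooth d \<rho> (surv \<rho> S k y) u \<le> 1" for y u
    using survival_bounds[OF S] by (auto intro!: smooth_bounds)
  have r: "0 \<le> r y u" "r y u \<le> 1" for y u
    using sb[of y u] a by (auto simp: r_def real_root_le_1_iff)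
  have [measurable]: "r y \<in> borel_measurable (vec_space d)" for y unfolding r_def[abs_def] by measurable
  have [measurable]: "A y \<in> sets (vec_space d)" for y unfolding A_def using S by (intro sets.finite_UN) auto
  have disj: "disjoint_family_on (\<lambda>x. edge x y) S" for y
    using in_unique by (fastforce simp: disjoint_family_on_def)
  have iedge: "integrable ?\<gamma> (\<lambda>u. indicator (edge x y) u * r y u)" for x y
    using r by (intro integrable_gaussian_vec_bounded[where B = 1]) (auto simp: indicator_def)
  have mA: "measure ?\<gamma> (A y) = (\<Sum>x\<in>S. measure ?\<gamma> (edge x y))" for y
    unfolding A_def using S disj by (intro finite_measure_finite_Union) auto
  have indA: "(\<Sum>x\<in>S. indicator (edge x y) u) = (indicator (A y) u :: real)" for y u
    unfolding A_def by (subst indicator_UN_disjoint[OF S disj]) (rule refl)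
  have "\<beta> ^ (2 * Suc k) * real (card S) = \<beta>\<^sup>2 * (\<beta> ^ (2 * k) * real (card S))"
    by (simp add: power2_eq_square)
  also have "\<dots> \<le> \<beta>\<^sup>2 * (\<Sum>y\<in>S. \<integral>u. root a (surv \<rho> S k y u) \<partial>?\<gamma>)"
    by (intro mult_left_mono Suc.IH) auto
  also have "\<dots> \<le> (\<Sum>y\<in>S. (measure ?\<gamma> (A y))\<^sup>2 * (\<integral>u. root a (surv \<rho> S k y u) \<partial>?\<gamma>))"
    unfolding sum_distrib_left using deg survival_bounds[OF S] a \<open>\<beta> \<ge> 0\<close>
    by (intro sum_mono mult_right_mono power_mono integral_nonneg_AE) (auto simp: mA)
  also have "\<dots> \<le> (\<Sum>y\<in>S. \<integral>u. indicator (A y) u * r y u \<partial>?\<gamma>)"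
    unfolding \<rho>_def r_def using survival_bounds[OF S] \<open>a \<ge> 1\<close>
    by (intro sum_mono smooth_root_integral_ge) auto
  also have "\<dots> = (\<Sum>y\<in>S. \<Sum>x\<in>S. \<integral>u. indicator (edge x y) u * r y u \<partial>?\<gamma>)"
    by (simp add: sum_distrib_right iedge flip: indA)
  also have "\<dots> = (\<Sum>x\<in>S. \<Sum>y\<in>S. \<integral>u. indicator (edge x y) u * r y u \<partial>?\<gamma>)"
    by (rule sum.swap)
  also have "\<dots> = (\<Sum>x\<in>S. \<integral>u. root a (surv \<rho> S (Suc k) x u) \<partial>?\<gamma>)"
    unfolding root_survival_Suc[OF S a] by (simp add: iedge flip: r_def)
  finally show ?case .
qed

text \<open>Jensen from the \<open>1/a\<close>-moment back to the first moment, by tangents at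
  \<open>m = \<beta>^(2 k)\<close>, a lower bound for the average of the roots over
  \<open>S\<close>. This is where the exponent acquires its factor \<open>a\<close>.\<close>

lemma sum_survival_ge:
  assumes S: "finite S" and "a \<ge> 1" and "\<beta> \<ge> 0"
    and deg: "\<And>y. y \<in> S \<Longrightarrow> \<beta> \<le> (\<Sum>x\<in>S. measure (gaussian_vec d) (edge x y))"
  defines "\<rho> \<equiv> 1 - 1 / real a"
  shows "\<beta> ^ (2 * k * a) * real (card S) \<le> (\<Sum>x\<in>S. \<integral>u. surv \<rho> S k x u \<partial>gaussian_vec d)"
proof -
  let ?\<gamma> = "gaussian_vec d"
  interpret prob_space ?\<gamma> by (rule prob_space_gaussian_vec)
  have a: "a > 0" using \<open>a \<ge> 1\<close> by simp
  define \<phi> where "\<phi> x u = root a (surv \<rho> S k x u)" for x u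
  define m where "m = \<beta> ^ (2 * k)"
  have m: "0 \<le> m" using \<open>\<beta> \<ge> 0\<close> by (simp add: m_def)
  note sb = survival_bounds[OF S, of \<rho> k]
  have p: "0 \<le> \<phi> x u" "\<phi> x u \<le> 1" "\<phi> x u ^ a = surv \<rho> S k x u" for x u
    using sb[of x u] a by (auto simp: \<phi>_def real_root_le_1_iff real_root_pow_pos2)
  have [measurable]: "\<phi> x \<in> borel_measurable (vec_space d)" for x unfolding \<phi>_def[abs_def] by measurable
  have i1: "integrable ?\<gamma> (\<phi> x)" and i2: "integrable ?\<gamma> (surv \<rho> S k x)" for x
    using p sb by (auto intro!: integrable_gaussian_vec_bounded[where B = 1])
  have "real (card S) * m ^ a \<le> (\<Sum>x\<in>S. m ^ a) + real a * m ^ (a - 1) * ((\<Sum>x\<in>S. \<integral>u. \<phi> x u \<partial>?\<gamma>) - real (card S) * m)"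
    using sum_root_survival_ge[OF S \<open>a \<ge> 1\<close> \<open>\<beta> \<ge> 0\<close> deg, of k] m
    by (simp add: \<phi>_def \<rho>_def m_def mult.commute)
  also have "\<dots> = (\<Sum>x\<in>S. \<integral>u. m ^ a + real a * m ^ (a - 1) * (\<phi> x u - m) \<partial>?\<gamma>)"
    using i1 by (simp add: sum.distrib sum_subtractf flip: sum_distrib_left)
  also have "\<dots> \<le> (\<Sum>x\<in>S. \<integral>u. surv \<rho> S k x u \<partial>?\<gamma>)"
    using i1 i2 power_ge_tangent[OF p(1) m \<open>a \<ge> 1\<close>]
    by (intro sum_mono integral_mono) (auto simp: p)
  finally show ?thesis unfolding m_def power_mult by (simp add: mult.commute)
qed

end

text \<open>\<open>S\<close> maximises the internal weight minus \<open>\<delta>/2\<close> per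
  vertex. By symmetry of \<open>p\<close>, deleting \<open>y\<close> lowers the internal weight by
  twice the degree of \<open>y\<close>, so maximality forces degree at least
  \<open>\<delta>/4\<close>. The maximum is at least its value on \<open>V\<close>, and with degrees
  at most 1 this bounds the size of \<open>S\<close>.\<close>

lemma dense_core:
  fixes p :: "'a \<Rightarrow> 'a \<Rightarrow> real"
  assumes V: "finite V" and p: "\<And>x y. p x y = p y x" "\<And>x. p x x = 0"
    and le1: "\<And>S y. S \<subseteq> V \<Longrightarrow> (\<Sum>x\<in>S. p x y) \<le> 1"
    and dens: "\<delta> * real (card V) \<le> (\<Sum>y\<in>V. \<Sum>x\<in>V. p x y)" and "\<delta> \<ge> 0"
  obtains S where "S \<subseteq> V" "\<delta> / 2 * real (card V) \<le> real (card S)"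
    "\<And>y. y \<in> S \<Longrightarrow> \<delta> / 4 \<le> (\<Sum>x\<in>S. p x y)"
proof -
  define val where "val S = (\<Sum>y\<in>S. \<Sum>x\<in>S. p x y) - \<delta> / 2 * real (card S)" for S
  have fin: "finite (val ` Pow V)" using V by simp
  then have "Max (val ` Pow V) \<in> val ` Pow V" by (intro Max_in) auto
  then obtain S where S: "S \<subseteq> V" "val S = Max (val ` Pow V)" by auto
  have max: "val T \<le> val S" if "T \<subseteq> V" for T using that fin S(2) by auto
  have fS: "finite S" using S(1) V by (rule finite_subset)
  have "\<delta> / 2 * real (card V) \<le> val V" using dens by (simp add: val_def)
  also have "\<dots> \<le> val S" by (rule max) simp
  also have "\<dots> \<le> (\<Sum>y\<in>S. \<Sum>x\<in>S. p x y)" using \<open>\<delta> \<ge> 0\<close> by (simp add: val_def)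
  also have "\<dots> \<le> (\<Sum>y\<in>S. 1)" by (intro sum_mono le1 S(1))
  finally have card: "\<delta> / 2 * real (card V) \<le> real (card S)" by simp
  have "\<delta> / 4 \<le> (\<Sum>x\<in>S. p x y)" if y: "y \<in> S" for y
  proof -
    define T where "T = S - {y}"
    have ST: "S = insert y T" "y \<notin> T" "finite T" using y fS by (auto simp: T_def)
    have "(\<Sum>z\<in>S. \<Sum>x\<in>S. p x z) = (\<Sum>x\<in>S. p x y) + (\<Sum>z\<in>T. p y z + (\<Sum>x\<in>T. p x z))"
      unfolding ST(1) using ST(2,3) by simp
    also have "\<dots> = (\<Sum>x\<in>S. p x y) + (\<Sum>z\<in>T. p z y) + (\<Sum>z\<in>T. \<Sum>x\<in>T. p x z)"
      by (simp add: sum.distrib p(1)[of y])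
    also have "(\<Sum>z\<in>T. p z y) = (\<Sum>x\<in>S. p x y)" unfolding ST(1) using ST(2,3) p(2) by simp
    finally have "val S - val T = 2 * (\<Sum>x\<in>S. p x y) - \<delta> / 2"
      using ST by (simp add: val_def algebra_simps)
    moreover have "val T \<le> val S" using S by (intro max) (auto simp: T_def)
    ultimately show ?thesis by simp
  qed
  with S(1) card show ?thesis using that by blast
qed

text \<open>A sum over walks from \<open>x\<close> to \<open>y\<close>, charged by \<open>c\<close>
  at each vertex of departure. Departure vertices lie in \<open>V\<close>, while the endpoint is
  unrestricted. Charge 1 detects and counts walks; exponential charges give the supermartingale used
  for confined walks.\<close>

fun walk_weight :: "nat \<Rightarrow> (rvec \<Rightarrow> (nat \<times> nat) set) \<Rightarrow> nat set \<Rightarrow> (nat \<Rightarrow> nat \<Rightarrow> ennreal) \<Rightarrow>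
    (nat \<Rightarrow> rvec) \<Rightarrow> nat \<Rightarrow> nat \<Rightarrow> nat \<Rightarrow> ennreal" where
  "walk_weight d M V c u x 0 y = (if y = x then 1 else 0)"
| "walk_weight d M V c u x (Suc k) y =
     (\<Sum>z\<in>V. walk_weight d M V c u x k z * c k z * indicator (edge_event d M z y) (u k))"

lemma walk_weight_cong:
  assumes "\<And>j. j < k \<Longrightarrow> u j = u' j" "\<And>j z. j < k \<Longrightarrow> c j z = c' j z"
  shows "walk_weight d M V c u x k y = walk_weight d M V c' u' x k y"
  using assms by (induction k arbitrary: y) auto

lemma walk_weight_nonzero_path:
  assumes "walk_weight d M V c u x k y \<noteq> 0"
  shows "\<exists>p. p 0 = x \<and> p k = y \<and> (\<forall>r<k. p r \<in> V \<and> u r \<in> edge_event d M (p r) (p (Suc r)))"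
  using assms
proof (induction k arbitrary: y)
  case 0
  then show ?case by (intro exI[of _ "\<lambda>_. x"]) (auto split: if_splits)
next
  case (Suc k)
  then obtain z where z: "z \<in> V" "walk_weight d M V c u x k z \<noteq> 0" "u k \<in> edge_event d M z y"
    by (auto simp: indicator_def split: if_splits elim!: sum.not_neutral_contains_not_neutral)
  from Suc.IH[OF z(2)] obtain p where p: "p 0 = x" "p k = z"
    "\<And>r. r < k \<Longrightarrow> p r \<in> V \<and> u r \<in> edge_event d M (p r) (p (Suc r))" by blast
  show ?case
    by (rule exI[of _ "p(Suc k := y)"]) (use p z in \<open>auto simp: less_Suc_eq\<close>)
qed

lemma walk_weight_path_ge:
  assumes "finite V" "p 0 = x" "\<And>r. r < k \<Longrightarrow> p r \<in> V"
    "\<And>r. r < k \<Longrightarrow> u r \<in> edge_event d M (p r) (p (Suc r))"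
  shows "(\<Prod>r<k. c r (p r)) \<le> walk_weight d M V c u x k (p k)"
  using assms(3,4)
proof (induction k)
  case 0 then show ?case using assms by simp
next
  case (Suc k)
  have "(\<Prod>r<Suc k. c r (p r)) \<le> walk_weight d M V c u x k (p k) * c k (p k)"
    using Suc by (auto intro!: mult_right_mono)
  also have "\<dots> = walk_weight d M V c u x k (p k) * c k (p k) * indicator (edge_event d M (p k) (p (Suc k))) (u k)"
    using Suc.prems(2)[of k] by simp
  also have "\<dots> \<le> walk_weight d M V c u x (Suc k) (p (Suc k))"
    unfolding walk_weight.simps using assms(1) Suc.prems(1)[of k]
    by (intro member_le_sum[where f = "\<lambda>z. walk_weight d M V c u x k z * c k z * indicator (edge_event d M z (p (Suc k))) (u k)"]) auto
  finally show ?case .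
qed

section \<open>The Ornstein--Uhlenbeck chain and its exponential moments\<close>

fun ou :: "nat \<Rightarrow> real \<Rightarrow> (nat \<Rightarrow> rvec) \<Rightarrow> nat \<Rightarrow> rvec" where
  "ou d \<rho> g 0 = g 0"
| "ou d \<rho> g (Suc k) = mix d \<rho> (ou d \<rho> g k) (g (Suc k))"

lemma ou_cong: "(\<And>j. j \<le> k \<Longrightarrow> g j = g' j) \<Longrightarrow> ou d \<rho> g k = ou d \<rho> g' k"
  by (induction k) auto

definition noise :: "nat \<Rightarrow> nat \<Rightarrow> (nat \<Rightarrow> rvec) measure" where
  "noise d K = (\<Pi>\<^sub>M k\<in>{..<K}. gaussian_vec d)"

lemma noise_component [measurable (raw)]: "k < K \<Longrightarrow> (\<lambda>g. g k) \<in> noise d K \<rightarrow>\<^sub>M vec_space d"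
  unfolding noise_def
  using measurable_component_singleton[of k "{..<K}" "\<lambda>_. gaussian_vec d"]
  by (simp cong: measurable_cong_sets)

lemma ou_measurable [measurable (raw)]: "k < K \<Longrightarrow> (\<lambda>g. ou d \<rho> g k) \<in> noise d K \<rightarrow>\<^sub>M vec_space d"
proof (induction k)
  case (Suc k)
  then have [measurable]: "(\<lambda>g. ou d \<rho> g k) \<in> noise d K \<rightarrow>\<^sub>M vec_space d"
    "(\<lambda>g. g (Suc k)) \<in> noise d K \<rightarrow>\<^sub>M vec_space d" by (auto intro: noise_component)
  show ?case unfolding ou.simps by measurable
qed (auto intro: noise_component)

lemma prob_space_noise: "prob_space (noise d K)"
  unfolding noise_def by (intro prob_space_PiM prob_space_gaussian_vec)

lemma nn_integral_noise_Suc: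
  assumes "H \<in> borel_measurable (noise d (Suc k))"
  shows "(\<integral>\<^sup>+g. H g \<partial>noise d (Suc k)) = (\<integral>\<^sup>+g. \<integral>\<^sup>+w. H (g(k := w)) \<partial>gaussian_vec d \<partial>noise d k)"
proof -
  interpret g: prob_space "gaussian_vec d" by (rule prob_space_gaussian_vec)
  interpret product_sigma_finite "\<lambda>_::nat. gaussian_vec d" by standard
  show ?thesis
    using assms unfolding noise_def lessThan_Suc
    by (intro product_nn_integral_insert) auto
qed

text \<open>Innovations that the integrand ignores integrate to 1. Measurability is asked at all
  larger indices because the induction passes through them.\<close>

lemma nn_integral_noise_extend:
  assumes "k \<le> K" and H: "\<And>j. k \<le> j \<Longrightarrow> H \<in> borel_measurable (noise d j)"
    and dep: "\<And>g g'. (\<And>j. j < k \<Longrightarrow> g j = g' j) \<Longrightarrow> H g = H g'"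
  shows "(\<integral>\<^sup>+g. H g \<partial>noise d K) = (\<integral>\<^sup>+g. H g \<partial>noise d k)"
  using assms(1)
proof (induction K rule: dec_induct)
  case (step K)
  have "H (g(K := w)) = H g" for g w using step(1) by (intro dep) auto
  then show ?case using step H[of "Suc K"] by (simp add: nn_integral_noise_Suc)
qed simp

lemma nn_integral_exp_std_gaussian:
  "(\<integral>\<^sup>+x. ennreal (exp (c * x)) \<partial>std_gaussian) = ennreal (exp (c\<^sup>2 / 2))"
proof -
  have "(\<integral>\<^sup>+x. ennreal (exp (c * x)) \<partial>std_gaussian) = (\<integral>\<^sup>+x. ennreal (std_normal_density x) * ennreal (exp (c * x)) \<partial>lborel)"
    unfolding std_gaussian_def by (subst nn_integral_density) auto
  also have "\<dots> = (\<integral>\<^sup>+x. ennreal (exp (c\<^sup>2 / 2)) * ennreal (normal_density c 1 x) \<partial>lborel)"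
  proof (intro nn_integral_cong)
    fix x
    have "- x\<^sup>2 / 2 + c * x = c\<^sup>2 / 2 + - (x - c)\<^sup>2 / 2" by (simp add: power2_eq_square field_simps)
    then have "exp (- x\<^sup>2 / 2) * exp (c * x) = exp (c\<^sup>2 / 2) * exp (- (x - c)\<^sup>2 / 2)"
      unfolding exp_add[symmetric] by simp
    then show "ennreal (std_normal_density x) * ennreal (exp (c * x)) = ennreal (exp (c\<^sup>2 / 2)) * ennreal (normal_density c 1 x)"
      by (simp add: normal_density_def flip: ennreal_mult)
  qed
  also have "\<dots> = ennreal (exp (c\<^sup>2 / 2)) * (\<integral>\<^sup>+x. ennreal (normal_density c 1 x) \<partial>lborel)"
    by (rule nn_integral_cmult) auto
  also have "(\<integral>\<^sup>+x. ennreal (normal_density c 1 x) \<partial>lborel) = 1"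
    by (subst nn_integral_eq_integral) auto
  finally show ?thesis by simp
qed

lemma vdot_self: "vdot d z z = (vnorm d z)\<^sup>2"
  by (simp add: vdot_def vnorm_def L2_set_def power2_eq_square sum_nonneg)

lemma nn_integral_exp_gaussian_vec:
  "(\<integral>\<^sup>+g. ennreal (exp (c * vdot d z g)) \<partial>gaussian_vec d) = ennreal (exp (c\<^sup>2 * (vnorm d z)\<^sup>2 / 2))"
proof -
  interpret Gs: prob_space std_gaussian by (rule prob_space_std_gaussian)
  interpret product_sigma_finite "\<lambda>_::nat. std_gaussian" by standard
  have "(\<integral>\<^sup>+g. ennreal (exp (c * vdot d z g)) \<partial>gaussian_vec d) = (\<integral>\<^sup>+g. (\<Prod>i<d. ennreal (exp (c * z i * g i))) \<partial>gaussian_vec d)"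
    by (simp add: vdot_def sum_distrib_left exp_sum prod_ennreal mult.assoc)
  also have "\<dots> = (\<Prod>i<d. \<integral>\<^sup>+x. ennreal (exp (c * z i * x)) \<partial>std_gaussian)"
    unfolding gaussian_vec_def by (intro product_nn_integral_prod) auto
  also have "\<dots> = ennreal (exp (\<Sum>i<d. (c * z i)\<^sup>2 / 2))"
    by (simp add: nn_integral_exp_std_gaussian exp_sum prod_ennreal)
  also have "(\<Sum>i<d. (c * z i)\<^sup>2 / 2) = c\<^sup>2 * (vnorm d z)\<^sup>2 / 2"
    unfolding vdot_self[symmetric] vdot_def
    by (simp add: power2_eq_square sum_distrib_left sum_divide_distrib mult_ac)
  finally show ?thesis .
qed

lemma vdot_measurable [measurable (raw)]:
  assumes "f \<in> N \<rightarrow>\<^sub>M vec_space d"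
  shows "(\<lambda>x. vdot d z (f x)) \<in> borel_measurable N"
proof -
  have [measurable]: "(\<lambda>x. f x i) \<in> borel_measurable N" if "i \<in> {..<d}" for i
    using measurable_compose[OF assms[unfolded vec_space_def] measurable_component_singleton[OF that]] .
  show ?thesis unfolding vdot_def by measurable
qed

lemma vdot_mix: "vdot d z (mix d \<rho> u g) = \<rho> * vdot d z u + sqrt (1 - \<rho>\<^sup>2) * vdot d z g"
  by (simp add: vdot_def mix_def sum_distrib_left sum.distrib algebra_simps)

text \<open>Stationarity: since \<open>\<rho>^2 + (1 - \<rho>^2) = 1\<close>, one step of the chain
  preserves the Gaussian moment generating function. It feeds the union bound over vertices.\<close>

lemma nn_integral_exp_ou:
  assumes "\<bar>\<rho>\<bar> \<le> 1" "k < K"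
  shows "(\<integral>\<^sup>+g. ennreal (exp (c * vdot d z (ou d \<rho> g k))) \<partial>noise d K) = ennreal (exp (c\<^sup>2 * (vnorm d z)\<^sup>2 / 2))"
proof -
  have m: "(\<lambda>g. ennreal (exp (c * vdot d z (ou d \<rho> g k)))) \<in> borel_measurable (noise d j)" if "k < j" for c k j
    using that by measurable
  have "(\<integral>\<^sup>+g. ennreal (exp (c * vdot d z (ou d \<rho> g k))) \<partial>noise d (Suc k)) = ennreal (exp (c\<^sup>2 * (vnorm d z)\<^sup>2 / 2))"
  proof (induction k arbitrary: c)
    case 0
    interpret prob_space "noise d 0" by (rule prob_space_noise)
    show ?case using m[of 0 "Suc 0"] by (subst nn_integral_noise_Suc) (simp_all add: nn_integral_exp_gaussian_vec emeasure_space_1)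
  next
    case (Suc k)
    have eq: "ou d \<rho> (g(Suc k := w)) k = ou d \<rho> g k" for g w by (rule ou_cong) auto
    let ?s = "sqrt (1 - \<rho>\<^sup>2)"
    have "(\<integral>\<^sup>+g. ennreal (exp (c * vdot d z (ou d \<rho> g (Suc k)))) \<partial>noise d (Suc (Suc k)))
      = (\<integral>\<^sup>+g. \<integral>\<^sup>+w. ennreal (exp ((c * \<rho>) * vdot d z (ou d \<rho> g k))) * ennreal (exp ((c * ?s) * vdot d z w)) \<partial>gaussian_vec d \<partial>noise d (Suc k))"
      using m[of "Suc k" "Suc (Suc k)"]
      by (subst nn_integral_noise_Suc) (simp_all add: eq vdot_mix distrib_left exp_add ennreal_mult mult.assoc)
    also have "\<dots> = (\<integral>\<^sup>+g. ennreal (exp ((c * \<rho>) * vdot d z (ou d \<rho> g k))) * ennreal (exp ((c * ?s)\<^sup>2 * (vnorm d z)\<^sup>2 / 2)) \<partial>noise d (Suc k))"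
      by (subst nn_integral_cmult) (auto simp: nn_integral_exp_gaussian_vec)
    also have "\<dots> = ennreal (exp ((c * \<rho>)\<^sup>2 * (vnorm d z)\<^sup>2 / 2)) * ennreal (exp ((c * ?s)\<^sup>2 * (vnorm d z)\<^sup>2 / 2))"
      by (subst nn_integral_multc) (auto simp: Suc.IH intro!: m)
    also have "\<dots> = ennreal (exp (c\<^sup>2 * (vnorm d z)\<^sup>2 / 2))"
    proof -
      have "\<rho>\<^sup>2 \<le> 1" using assms by (simp add: abs_square_le_1)
      then have "(c * \<rho>)\<^sup>2 * (vnorm d z)\<^sup>2 / 2 + (c * ?s)\<^sup>2 * (vnorm d z)\<^sup>2 / 2 = c\<^sup>2 * (vnorm d z)\<^sup>2 / 2"
        by (simp add: power_mult_distrib field_simps)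
      then show ?thesis by (simp flip: ennreal_mult exp_add)
    qed
    finally show ?case .
  qed
  moreover have "(\<integral>\<^sup>+g. ennreal (exp (c * vdot d z (ou d \<rho> g k))) \<partial>noise d K) = (\<integral>\<^sup>+g. ennreal (exp (c * vdot d z (ou d \<rho> g k))) \<partial>noise d (Suc k))"
  proof (rule nn_integral_noise_extend)
    fix g g' :: "nat \<Rightarrow> rvec" assume "\<And>j. j < Suc k \<Longrightarrow> g j = g' j"
    then have "ou d \<rho> g k = ou d \<rho> g' k" by (intro ou_cong) auto
    then show "ennreal (exp (c * vdot d z (ou d \<rho> g k))) = ennreal (exp (c * vdot d z (ou d \<rho> g' k)))" by simp
  qed (use assms m in auto)
  ultimately show ?thesis by simp
qed

context matching_family
begin

abbreviation "weight \<equiv> walk_weight d M"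

lemma walk_weight_measurable [measurable (raw)]:
  assumes "\<And>j. j < k \<Longrightarrow> (\<lambda>g. u g j) \<in> N \<rightarrow>\<^sub>M vec_space d"
    "\<And>j z. j < k \<Longrightarrow> (\<lambda>g. c g j z) \<in> borel_measurable N"
  shows "(\<lambda>g. weight V (c g) (u g) x k y) \<in> borel_measurable N"
  using assms
proof (induction k arbitrary: y)
  case (Suc k)
  have [measurable]: "(\<lambda>g. u g k) \<in> N \<rightarrow>\<^sub>M vec_space d" "\<And>z. (\<lambda>g. c g k z) \<in> borel_measurable N"
    "\<And>y. (\<lambda>g. weight V (c g) (u g) x k y) \<in> borel_measurable N" using Suc by auto
  show ?case unfolding walk_weight.simps by measurable
qed simp

lemma sum_out_indicator_le:
  assumes "finite V" shows "(\<Sum>y\<in>V. indicator (edge z y) u) \<le> (1 :: ennreal)"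
proof (cases "\<exists>y\<in>V. u \<in> edge z y")
  case True
  then obtain y where "y \<in> V" "u \<in> edge z y" by blast
  then show ?thesis using sum_out_edges[OF assms, of y u z "\<lambda>_. 1 :: ennreal"] by simp
next
  case False
  then have "indicator (edge z y) u = (0::ennreal)" if "y \<in> V" for y
    using that by (auto simp: indicator_def)
  then show ?thesis by simp
qed

text \<open>At most one edge leaves a vertex, so appending an edge cannot increase the total mass.
  It yields both the bound 1 for uncharged walks and the supermartingale property for charged
  ones.\<close>

lemma sum_walk_weight_Suc_le:
  assumes "finite V"
  shows "(\<Sum>y\<in>V. weight V c u x (Suc k) y) \<le> (\<Sum>z\<in>V. weight V c u x k z * c k z)"
proof -
  have "(\<Sum>y\<in>V. weight V c u x (Suc k) y)
     = (\<Sum>z\<in>V. weight V c u x k z * c k z * (\<Sum>y\<in>V. indicator (edge z y) (u k)))"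
    unfolding walk_weight.simps sum_distrib_left by (rule sum.swap)
  also have "\<dots> \<le> (\<Sum>z\<in>V. weight V c u x k z * c k z * 1)"
    by (intro sum_mono mult_left_mono sum_out_indicator_le assms) auto
  finally show ?thesis by simp
qed

lemma sum_walk_weight_le_1:
  assumes "finite V"
  shows "(\<Sum>y\<in>V. weight V (\<lambda>_ _. 1) u x k y) \<le> 1"
proof (induction k)
  case 0 then show ?case using assms by (simp add: sum.delta)
next
  case (Suc k)
  then show ?case using sum_walk_weight_Suc_le[OF assms, of "\<lambda>_ _. 1" u x k] by simp
qed

text \<open>The Markov property: the right side depends only on \<open>k + j\<close>, so explicit
  steps can be traded for survival steps. Hence the induction on \<open>k\<close> with
  \<open>j\<close> arbitrary.\<close>

lemma nn_integral_walks_survival: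
  assumes S: "finite S" and "x \<in> S"
  shows "(\<integral>\<^sup>+g. (\<Sum>y\<in>S. weight S (\<lambda>_ _. 1) (ou d \<rho> g) x k y * ennreal (surv \<rho> S j y (ou d \<rho> g k)))
      \<partial>noise d (Suc k)) = (\<integral>\<^sup>+u. ennreal (surv \<rho> S (k + j) x u) \<partial>gaussian_vec d)"
proof (induction k arbitrary: j)
  case 0
  interpret prob_space "noise d 0" by (rule prob_space_noise)
  have e: "(\<Sum>y\<in>S. weight S (\<lambda>_ _. 1) (ou d \<rho> g) x 0 y * ennreal (surv \<rho> S j y (ou d \<rho> g 0)))
     = ennreal (surv \<rho> S j x (g 0))" for g
  proof -
    have "(\<Sum>y\<in>S. weight S (\<lambda>_ _. 1) (ou d \<rho> g) x 0 y * ennreal (surv \<rho> S j y (ou d \<rho> g 0)))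
      = (\<Sum>y\<in>S. if y = x then ennreal (surv \<rho> S j x (g 0)) else 0)"
      by (intro sum.cong) auto
    then show ?thesis using assms by simp
  qed
  show ?case unfolding e
    using measurable_compose[OF noise_component[of 0 "Suc 0" d] survival_measurable]
    by (subst nn_integral_noise_Suc) (simp_all add: emeasure_space_1)
next
  case (Suc k)
  let ?T = "\<lambda>y. smooth d \<rho> (surv \<rho> S j y)"
  let ?u = "\<lambda>g. ou d \<rho> g k"
  let ?w = "\<lambda>g. weight S (\<lambda>_ _. 1) (ou d \<rho> g) x"
  note sb = survival_bounds[OF S, of \<rho>]
  have eq: "ou d \<rho> (g(Suc k := w)) i = ou d \<rho> g i" if "i \<le> k" for g w i using that by (intro ou_cong) auto
  have eqw: "?w (g(Suc k := w)) (Suc k) y = ?w g (Suc k) y" for g w y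
    by (intro walk_weight_cong) (auto simp: eq)
  have mw[measurable]: "(\<lambda>g. ?w g i y) \<in> borel_measurable (noise d K)" if "i \<le> K" for i y K
    using that by (intro walk_weight_measurable ou_measurable) auto
  have sm: "(\<integral>\<^sup>+w. ennreal (surv \<rho> S j y (mix d \<rho> u w)) \<partial>gaussian_vec d)
    = ennreal (?T y u)" if u: "u \<in> space (vec_space d)" for u y
  proof -
    note [measurable] = u
    show ?thesis unfolding smooth_def using sb
      by (intro nn_integral_eq_integral integrable_gaussian_vec_bounded[where B = 1]) auto
  qed
  have sb0: "0 \<le> ?T y u" for y u using sb by (intro smooth_bounds) auto
  have [measurable]: "(\<lambda>g. ou d \<rho> g (Suc k)) \<in> noise d (Suc (Suc k)) \<rightarrow>\<^sub>M vec_space d"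
    "\<And>y. (\<lambda>g. ?w g (Suc k) y) \<in> borel_measurable (noise d (Suc (Suc k)))"
    by (rule ou_measurable mw, simp)+
  have mm: "(\<lambda>g. \<Sum>y\<in>S. ?w g (Suc k) y * ennreal (surv \<rho> S j y (ou d \<rho> g (Suc k))))
      \<in> borel_measurable (noise d (Suc (Suc k)))"
    by measurable
  have "(\<integral>\<^sup>+g. (\<Sum>y\<in>S. ?w g (Suc k) y * ennreal (surv \<rho> S j y (ou d \<rho> g (Suc k)))) \<partial>noise d (Suc (Suc k)))
    = (\<integral>\<^sup>+g. \<integral>\<^sup>+w. (\<Sum>y\<in>S. ?w g (Suc k) y * ennreal (surv \<rho> S j y (mix d \<rho> (?u g) w))) \<partial>gaussian_vec d \<partial>noise d (Suc k))"
    by (subst nn_integral_noise_Suc[OF mm]) (simp add: eq eqw del: walk_weight.simps)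
  \<comment> \<open>A walk of \<open>k + 1\<close> steps uses the directions up to index
    \<open>k\<close>, so the newest innovation occurs only in the survival factor and averages it to
    \<open>smooth\<close>.\<close>
  also have "\<dots> = (\<integral>\<^sup>+g. (\<Sum>y\<in>S. ?w g (Suc k) y * ennreal (?T y (?u g))) \<partial>noise d (Suc k))"
  proof (intro nn_integral_cong)
    fix g assume g: "g \<in> space (noise d (Suc k))"
    have u[measurable]: "?u g \<in> space (vec_space d)"
      using measurable_space[OF ou_measurable[of k "Suc k" d \<rho>] g] by simp
    show "(\<integral>\<^sup>+w. (\<Sum>y\<in>S. ?w g (Suc k) y * ennreal (surv \<rho> S j y (mix d \<rho> (?u g) w))) \<partial>gaussian_vec d)
      = (\<Sum>y\<in>S. ?w g (Suc k) y * ennreal (?T y (?u g)))"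
      by (subst nn_integral_sum) (auto simp: nn_integral_cmult sm[OF u] simp del: walk_weight.simps)
  qed
  \<comment> \<open>The last edge of the walk has direction index \<open>k\<close> and is absorbed
    as the first step of a survival of length \<open>Suc j\<close>.\<close>
  also have "\<dots> = (\<integral>\<^sup>+g. (\<Sum>z\<in>S. ?w g k z * ennreal (surv \<rho> S (Suc j) z (?u g))) \<partial>noise d (Suc k))"
  proof (intro nn_integral_cong)
    fix g
    have "(\<Sum>y\<in>S. ?w g (Suc k) y * ennreal (?T y (?u g)))
      = (\<Sum>y\<in>S. \<Sum>z\<in>S. ?w g k z * (indicator (edge z y) (?u g) * ennreal (?T y (?u g))))"
      by (simp add: sum_distrib_right mult.assoc)
    also have "\<dots> = (\<Sum>z\<in>S. ?w g k z * (\<Sum>y\<in>S. indicator (edge z y) (?u g) * ennreal (?T y (?u g))))"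
      unfolding sum_distrib_left by (rule sum.swap)
    also have "\<dots> = (\<Sum>z\<in>S. ?w g k z * ennreal (surv \<rho> S (Suc j) z (?u g)))"
    proof (intro sum.cong refl arg_cong2[where f = "(*)"])
      fix z
      have "ennreal (surv \<rho> S (Suc j) z (?u g)) =
         (\<Sum>y\<in>S. ennreal (indicator (edge z y) (?u g) * ?T y (?u g)))"
        unfolding survival.simps using sb0 by (subst sum_ennreal) auto
      then show "(\<Sum>y\<in>S. indicator (edge z y) (?u g) * ennreal (?T y (?u g)))
         = ennreal (surv \<rho> S (Suc j) z (?u g))"
        by (auto simp: indicator_def intro!: sum.cong)
    qed
    finally show "(\<Sum>y\<in>S. ?w g (Suc k) y * ennreal (?T y (?u g)))
      = (\<Sum>z\<in>S. ?w g k z * ennreal (surv \<rho> S (Suc j) z (?u g)))" .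
  qed
  also have "\<dots> = (\<integral>\<^sup>+u. ennreal (surv \<rho> S (k + Suc j) x u) \<partial>gaussian_vec d)"
    by (rule Suc.IH)
  finally show ?case by simp
qed

text \<open>The case \<open>j = 0\<close>. The noise has one component more than the walk uses
  because the survival identity also refers to the direction at time \<open>k\<close>.\<close>

lemma expected_walks_ge:
  assumes S: "finite S" and "a \<ge> 1" and "\<beta> \<ge> 0"
    and deg: "\<And>y. y \<in> S \<Longrightarrow> \<beta> \<le> (\<Sum>x\<in>S. measure (gaussian_vec d) (edge x y))"
  defines "\<rho> \<equiv> 1 - 1 / real a"
  shows "ennreal (\<beta> ^ (2 * k * a) * real (card S)) \<le>
    (\<Sum>x\<in>S. \<integral>\<^sup>+g. (\<Sum>y\<in>S. weight S (\<lambda>_ _. 1) (ou d \<rho> g) x k y) \<partial>noise d (Suc k))"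
proof -
  note sb = survival_bounds[OF S, of \<rho>]
  have "(\<Sum>x\<in>S. \<integral>\<^sup>+g. (\<Sum>y\<in>S. weight S (\<lambda>_ _. 1) (ou d \<rho> g) x k y) \<partial>noise d (Suc k))
     = (\<Sum>x\<in>S. \<integral>\<^sup>+u. ennreal (surv \<rho> S k x u) \<partial>gaussian_vec d)"
    using nn_integral_walks_survival[OF S, where \<rho> = \<rho> and k = k and j = 0] by (intro sum.cong) auto
  also have "\<dots> = (\<Sum>x\<in>S. ennreal (\<integral>u. surv \<rho> S k x u \<partial>gaussian_vec d))"
    using sb by (intro sum.cong refl nn_integral_eq_integral integrable_gaussian_vec_bounded[where B = 1]) auto
  also have "\<dots> = ennreal (\<Sum>x\<in>S. \<integral>u. surv \<rho> S k x u \<partial>gaussian_vec d)"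
    using sb by (intro sum_ennreal) auto
  finally show ?thesis
    using sum_survival_ge[OF S \<open>a \<ge> 1\<close> \<open>\<beta> \<ge> 0\<close> deg, of k] by (auto simp: \<rho>_def intro!: ennreal_leI)
qed

end

section \<open>Walks confined to a ball\<close>

text \<open>To be read with \<open>A j\<close> and \<open>B j\<close> as the products of direction
  \<open>j\<close> with the displacements before and after step \<open>j\<close>, and
  \<open>C j\<close> as that of innovation \<open>j\<close> with the displacement before it. The
  recursion of the chain then gives the hypothesis on \<open>A (Suc j)\<close>.\<close>

lemma summation_by_parts:
  fixes A B C :: "nat \<Rightarrow> real"
  assumes "A 0 = s * C 0" "\<And>j. A (Suc j) = \<rho> * B j + s * C (Suc j)"
  shows "(\<Sum>j<Suc m. B j - A j) = B m + (1 - \<rho>) * (\<Sum>j<m. B j) - s * (\<Sum>j<Suc m. C j)"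
  by (induction m) (simp_all add: assms algebra_simps)

lemma vdot_vminus: "vdot d (vminus d a b) u = vdot d a u - vdot d b u"
  by (simp add: vdot_def vminus_def left_diff_distrib sum_subtractf)

context matching_family
begin

text \<open>Along a walk that stays in \<open>V\<close>, summation by parts turns the total stretch into terms
  \<open>z \<cdot> u\<^sub>k\<close>, controlled by a union bound, and a martingale, whose exponential is the walk weight.\<close>

lemma confined_walk_bound:
  fixes v :: "nat \<Rightarrow> rvec" and R :: nat
  defines "\<rho> \<equiv> 1 - 1 / real R"
  defines "z \<equiv> \<lambda>x y. vminus d (v y) (v x)"
  assumes V: "finite V" and R: "R \<ge> 1"
    and stretch: "\<And>u x y. u \<in> edge x y \<Longrightarrow> \<sigma> \<le> vdot d (vminus d (v y) (v x)) u"
    and p: "p 0 = x" "\<And>r. r \<le> R \<Longrightarrow> p r \<in> V"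
      "\<And>r. r < R \<Longrightarrow> ou d \<rho> g r \<in> edge (p r) (p (Suc r))"
    and "\<sigma> \<ge> 0" "\<kappa> \<ge> 0" "\<theta> \<ge> 0"
  shows "1 \<le> (\<Sum>y\<in>V. \<Sum>k<R. ennreal (exp (\<kappa> * vdot d (z x y) (ou d \<rho> g k)) * exp (- \<kappa> * (real R * \<sigma> / 4))))
     + ennreal (exp (- \<theta> * (real R * \<sigma> / 2))) *
       (\<Sum>y\<in>V. weight V (\<lambda>k y. ennreal (exp (- (\<theta> * sqrt (1 - \<rho>\<^sup>2)) * vdot d (z x y) (g k)))) (ou d \<rho> g) x R y)"
    (is "1 \<le> ?X + ?Y")
proof (cases "\<exists>y\<in>V. \<exists>k<R. real R * \<sigma> / 4 \<le> vdot d (z x y) (ou d \<rho> g k)")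
  case True
  then obtain y k where yk: "y \<in> V" "k < R" "real R * \<sigma> / 4 \<le> vdot d (z x y) (ou d \<rho> g k)" by blast
  let ?f = "\<lambda>y k. ennreal (exp (\<kappa> * vdot d (z x y) (ou d \<rho> g k)) * exp (- \<kappa> * (real R * \<sigma> / 4)))"
  have "1 \<le> ?f y k"
    using mult_left_mono[OF yk(3) \<open>\<kappa> \<ge> 0\<close>]
    by (simp flip: exp_add ennreal_1 add: ennreal_le_iff)
  also have "\<dots> \<le> (\<Sum>k<R. ?f y k)" using yk by (intro member_le_sum) auto
  also have "\<dots> \<le> (\<Sum>y\<in>V. \<Sum>k<R. ?f y k)"
    using yk V by (intro member_le_sum[where f = "\<lambda>y. \<Sum>k<R. ?f y k"]) auto
  also have "\<dots> \<le> ?X + ?Y" by simp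
  finally show ?thesis .
next
  case False
  let ?s = "sqrt (1 - \<rho>\<^sup>2)"
  define A where "A j = vdot d (z x (p j)) (ou d \<rho> g j)" for j
  define B where "B j = vdot d (z x (p (Suc j))) (ou d \<rho> g j)" for j
  define C where "C j = vdot d (z x (p j)) (g j)" for j
  \<comment> \<open>The walk starts at \<open>x\<close>, so displacement 0 vanishes. Hence
    \<open>A 0 = s * C 0\<close> although the first direction is \<open>g 0\<close> without the
    factor \<open>s\<close>.\<close>
  have z0: "vdot d (z x x) w = 0" for w by (simp add: z_def vdot_vminus)
  have parts: "(\<Sum>j<Suc m. B j - A j) = B m + (1 - \<rho>) * (\<Sum>j<m. B j) - ?s * (\<Sum>j<Suc m. C j)" for m
    by (rule summation_by_parts) (simp_all add: A_def B_def C_def p(1) z0 vdot_mix)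
  obtain m where m: "R = Suc m" using R by (cases R) auto
  have Bt: "B j \<le> real R * \<sigma> / 4" if "j < R" for j
    using False p(2)[of "Suc j"] that unfolding B_def by force
  have "real R * \<sigma> = (\<Sum>j<R. \<sigma>)" by simp
  also have "\<dots> \<le> (\<Sum>j<R. B j - A j)"
    using stretch[OF p(3)] unfolding A_def B_def z_def by (intro sum_mono) (auto simp: vdot_vminus)
  also have "\<dots> = B m + (1 - \<rho>) * (\<Sum>j<m. B j) - ?s * (\<Sum>j<R. C j)" unfolding m by (rule parts)
  \<comment> \<open>Outside the union-bound event each \<open>B j\<close> is at most
    \<open>R \<sigma> / 4\<close>. The coefficient \<open>1 - \<rho> = 1/R\<close> offsets the
    number of terms in the sum, so together the \<open>B\<close> terms account for at most half of
    the stretch and the martingale must supply the rest.\<close>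
  also have "\<dots> \<le> real R * \<sigma> / 4 + (1 - \<rho>) * (\<Sum>j<m. real R * \<sigma> / 4) - ?s * (\<Sum>j<R. C j)"
    using m by (intro diff_right_mono add_mono mult_left_mono sum_mono Bt) (auto simp: \<rho>_def)
  also have "(1 - \<rho>) * (\<Sum>j<m. real R * \<sigma> / 4) = real m * \<sigma> / 4"
    using R by (simp add: \<rho>_def)
  finally have le: "real R * \<sigma> \<le> real R * \<sigma> / 4 + real m * \<sigma> / 4 - ?s * (\<Sum>j<R. C j)" .
  have "real m * \<sigma> \<le> real R * \<sigma>" using \<open>\<sigma> \<ge> 0\<close> m by (intro mult_right_mono) auto
  with le have "real R * \<sigma> / 2 \<le> - (?s * (\<Sum>j<R. C j))" by simp
  from mult_left_mono[OF this \<open>\<theta> \<ge> 0\<close>]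
  have "0 \<le> - \<theta> * (real R * \<sigma> / 2) + (\<Sum>j<R. - (\<theta> * ?s) * C j)"
    by (simp add: sum_distrib_left sum_negf mult.assoc)
  then have "1 \<le> ennreal (exp (- \<theta> * (real R * \<sigma> / 2))) * (\<Prod>j<R. ennreal (exp (- (\<theta> * ?s) * C j)))"
    by (simp add: prod_ennreal exp_sum[symmetric] ennreal_mult[symmetric] exp_add[symmetric] flip: ennreal_1)
  also have "\<dots> \<le> ennreal (exp (- \<theta> * (real R * \<sigma> / 2))) *
     weight V (\<lambda>k y. ennreal (exp (- (\<theta> * ?s) * vdot d (z x y) (g k)))) (ou d \<rho> g) x R (p R)"
    using V p(1) walk_weight_path_ge[of V p x R "ou d \<rho> g" d M "\<lambda>k y. ennreal (exp (- (\<theta> * ?s) * vdot d (z x y) (g k)))"] p(2,3)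
    by (intro mult_left_mono) (auto simp: C_def)
  also have "\<dots> \<le> ?Y" using V p(2)[of R] by (intro mult_left_mono member_le_sum) auto
  also have "\<dots> \<le> ?X + ?Y" by simp
  finally show ?thesis .
qed

text \<open>A supermartingale bound: the charge at time \<open>k\<close> involves the fresh
  innovation \<open>g k\<close> and a displacement fixed by the earlier ones, so its conditional
  mean is at most \<open>exp (\<mu>^2 * L / 2)\<close>.\<close>

lemma confined_walk_weight_integral:
  fixes \<rho> \<mu> L :: real
  assumes V: "finite V" and L: "\<And>y. y \<in> V \<Longrightarrow> (vnorm d (z y))\<^sup>2 \<le> L"
  shows "(\<integral>\<^sup>+g. (\<Sum>y\<in>V. weight V (\<lambda>k y. ennreal (exp (\<mu> * vdot d (z y) (g k)))) (ou d \<rho> g) x k y) \<partial>noise d k)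
    \<le> ennreal (exp (\<mu>\<^sup>2 * L / 2) ^ k)"
proof (induction k)
  case 0
  interpret prob_space "noise d 0" by (rule prob_space_noise)
  have "(\<integral>\<^sup>+g. (\<Sum>y\<in>V. weight V (\<lambda>k y. ennreal (exp (\<mu> * vdot d (z y) (g k)))) (ou d \<rho> g) x 0 y) \<partial>noise d 0)
    \<le> (\<integral>\<^sup>+g. 1 \<partial>noise d 0)"
    using V by (intro nn_integral_mono) (auto simp: sum.delta)
  then show ?case by (simp add: emeasure_space_1)
next
  case (Suc k)
  let ?c = "\<lambda>g k y. ennreal (exp (\<mu> * vdot d (z y) (g k)))"
  have mc: "(\<lambda>w. c * ennreal (exp (\<mu> * vdot d (z y) w))) \<in> borel_measurable (gaussian_vec d)" for c y
    by measurable
  have mv: "(\<lambda>w. ennreal (exp (\<mu> * vdot d (z y) w))) \<in> borel_measurable (gaussian_vec d)" for y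
    by measurable
  define W where "W g = weight V (?c g) (ou d \<rho> g) x k" for g
  have eqw: "W (g(k := w)) y = W g y" for g w y
    unfolding W_def by (intro walk_weight_cong ou_cong) (auto intro!: ou_cong)
  have mw: "(\<lambda>g. W g y) \<in> borel_measurable (noise d K)" if "k \<le> K" for y K
    unfolding W_def using that
    by (intro walk_weight_measurable ou_measurable) (auto intro!: noise_component vdot_measurable measurable_compose[OF _ measurable_ennreal] borel_measurable_exp borel_measurable_times)
  have [measurable]: "\<And>y. (\<lambda>g. W g y) \<in> borel_measurable (noise d k)"
    "\<And>y. (\<lambda>g. W g y) \<in> borel_measurable (noise d (Suc k))"
    "(\<lambda>g. g k) \<in> noise d (Suc k) \<rightarrow>\<^sub>M vec_space d"
    by (rule mw noise_component, simp)+
  \<comment> \<open>The edge indicator depends on direction \<open>k\<close> and hence on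
    \<open>g k\<close>. Summing over endpoints bounds it by 1 before \<open>g k\<close> is
    integrated.\<close>
  have "(\<integral>\<^sup>+g. (\<Sum>y\<in>V. weight V (?c g) (ou d \<rho> g) x (Suc k) y) \<partial>noise d (Suc k))
      \<le> (\<integral>\<^sup>+g. (\<Sum>y\<in>V. W g y * ?c g k y) \<partial>noise d (Suc k))"
    unfolding W_def by (intro nn_integral_mono sum_walk_weight_Suc_le V)
  also have "\<dots> = (\<integral>\<^sup>+g. \<integral>\<^sup>+w. (\<Sum>y\<in>V. W g y * ennreal (exp (\<mu> * vdot d (z y) w))) \<partial>gaussian_vec d \<partial>noise d k)"
    by (subst nn_integral_noise_Suc) (measurable, simp add: eqw)
  also have "\<dots> = (\<integral>\<^sup>+g. (\<Sum>y\<in>V. W g y * ennreal (exp (\<mu>\<^sup>2 * (vnorm d (z y))\<^sup>2 / 2))) \<partial>noise d k)"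
  proof (intro nn_integral_cong)
    fix g
    have "(\<integral>\<^sup>+w. (\<Sum>y\<in>V. W g y * ennreal (exp (\<mu> * vdot d (z y) w))) \<partial>gaussian_vec d)
       = (\<Sum>y\<in>V. \<integral>\<^sup>+w. W g y * ennreal (exp (\<mu> * vdot d (z y) w)) \<partial>gaussian_vec d)"
      by (rule nn_integral_sum[OF mc])
    also have "\<dots> = (\<Sum>y\<in>V. W g y * ennreal (exp (\<mu>\<^sup>2 * (vnorm d (z y))\<^sup>2 / 2)))"
      by (simp only: nn_integral_cmult[OF mv] nn_integral_exp_gaussian_vec)
    finally show "(\<integral>\<^sup>+w. (\<Sum>y\<in>V. W g y * ennreal (exp (\<mu> * vdot d (z y) w))) \<partial>gaussian_vec d)
       = (\<Sum>y\<in>V. W g y * ennreal (exp (\<mu>\<^sup>2 * (vnorm d (z y))\<^sup>2 / 2)))" .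
  qed
  also have "\<dots> \<le> (\<integral>\<^sup>+g. (\<Sum>y\<in>V. W g y) * ennreal (exp (\<mu>\<^sup>2 * L / 2)) \<partial>noise d k)"
    unfolding sum_distrib_right using L
    by (intro nn_integral_mono sum_mono mult_left_mono ennreal_leI) (auto intro!: mult_left_mono)
  also have "\<dots> = (\<integral>\<^sup>+g. (\<Sum>y\<in>V. W g y) \<partial>noise d k) * ennreal (exp (\<mu>\<^sup>2 * L / 2))"
    by (rule nn_integral_multc) measurable
  also have "\<dots> \<le> ennreal (exp (\<mu>\<^sup>2 * L / 2) ^ k) * ennreal (exp (\<mu>\<^sup>2 * L / 2))"
    using Suc.IH by (intro mult_right_mono) (auto simp: W_def)
  finally show ?case by (simp flip: ennreal_mult add: mult.commute)
qed

end

section \<open>Reflection symmetry and measurability of the pair counts\<close>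

lemma distr_std_gaussian_uminus: "distr std_gaussian borel uminus = std_gaussian"
proof (rule distr_eq_std_gaussianI[OF prob_space_std_gaussian])
  show "(\<integral>x. cos (c + t * - x) \<partial>std_gaussian) = cos c * exp (- t\<^sup>2 / 2)" for c t
    using integral_cos_std_gaussian[of c "- t"] by simp
qed simp

lemma distr_gaussian_vec_vuminus: "distr (gaussian_vec d) (vec_space d) (vuminus d) = gaussian_vec d"
proof -
  have "distr (PiM {..<d} (\<lambda>_. std_gaussian)) (PiM {..<d} (\<lambda>_. std_gaussian)) (compose {..<d} uminus)
     = PiM {..<d} (\<lambda>_. distr std_gaussian std_gaussian uminus)"
    by (rule distr_PiM_finite_prob_space') (auto intro: prob_space_std_gaussian cong: measurable_cong_sets)
  moreover have "distr std_gaussian std_gaussian uminus = distr std_gaussian borel uminus"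
    by (rule distr_cong) auto
  moreover have "distr (gaussian_vec d) (vec_space d) (vuminus d) = distr (gaussian_vec d) (gaussian_vec d) (vuminus d)"
    by (rule distr_cong) auto
  moreover have "vuminus d = compose {..<d} uminus" by (auto simp: fun_eq_iff vuminus_def compose_def)
  ultimately show ?thesis
    by (simp add: distr_std_gaussian_uminus flip: gaussian_vec_def)
qed

lemma vuminus_measurable [measurable]: "vuminus d \<in> vec_space d \<rightarrow>\<^sub>M vec_space d"
  unfolding vuminus_def[abs_def] vec_space_def by (intro measurable_restrict) measurable

lemma measurable_map_list_space:
  assumes h: "\<And>k. k < j \<Longrightarrow> h k \<in> N \<rightarrow>\<^sub>M S"
  shows "(\<lambda>g. map (\<lambda>k. h k g) [0..<j]) \<in> N \<rightarrow>\<^sub>M list_space S"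
proof (rule measurableI)
  show "map (\<lambda>k. h k g) [0..<j] \<in> space (list_space S)" if "g \<in> space N" for g
    using measurable_space[OF h that] by (auto simp: space_list_space)
  fix A assume "A \<in> sets (list_space S)"
  then have A: "{f \<in> space (\<Pi>\<^sub>M i\<in>{..<j}. S). map f [0..<j] \<in> A} \<in> sets (\<Pi>\<^sub>M i\<in>{..<j}. S)"
    by (auto simp: sets_list_space)
  have m: "(\<lambda>g. \<lambda>k\<in>{..<j}. h k g) \<in> N \<rightarrow>\<^sub>M (\<Pi>\<^sub>M i\<in>{..<j}. S)"
    using h by (intro measurable_restrict) auto
  have "map (\<lambda>k\<in>{..<j}. h k g) [0..<j] = map (\<lambda>k. h k g) [0..<j]" for g
    by (intro map_cong) auto
  then have "(\<lambda>g. map (\<lambda>k. h k g) [0..<j]) -` A \<inter> space N =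
     (\<lambda>g. \<lambda>k\<in>{..<j}. h k g) -` {f \<in> space (\<Pi>\<^sub>M i\<in>{..<j}. S). map f [0..<j] \<in> A} \<inter> space N"
    using measurable_space[OF m] by (auto simp del: map_eq_conv)
  then show "(\<lambda>g. map (\<lambda>k. h k g) [0..<j]) -` A \<inter> space N \<in> sets N"
    using measurable_sets[OF m A] by simp
qed

definition long_pairs :: "nat \<Rightarrow> nat \<Rightarrow> (nat \<Rightarrow> rvec) \<Rightarrow> (rvec \<Rightarrow> (nat \<times> nat) set) \<Rightarrow> real \<Rightarrow> rvec list \<Rightarrow> (nat \<times> nat) set" where
  "long_pairs n d v M L us = {(x, y). (x, y) \<in> chain_graph n M us \<and> (vnorm d (vminus d (v x) (v y)))\<^sup>2 \<ge> L}"

lemma long_pairs_subset: "long_pairs n d v M L us \<subseteq> {1..n} \<times> {1..n}"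
  by (auto simp: long_pairs_def chain_graph_def)

lemma finite_long_pairs: "finite (long_pairs n d v M L us)"
  using finite_subset[OF long_pairs_subset] by auto

lemma card_long_pairs_le: "card (long_pairs n d v M L us) \<le> n * n"
  using card_mono[OF _ long_pairs_subset] by auto

context matching_family
begin

lemma edge_subset: "u \<in> edge x y \<Longrightarrow> x \<in> {1..n} \<and> y \<in> {1..n}"
  using matching[of u] by (auto simp: edge_event_def directed_matching_def)

text \<open>The existence of a path becomes the non-vanishing of a measurable function of the
  directions. Inner vertices lie in \<open>{1..n}\<close> because edges of a matching do.\<close>

lemma chain_graph_iff_walk_weight:
  fixes r :: nat
  assumes f: "\<And>j. j < r \<Longrightarrow> f j \<in> space (vec_space d)"
  shows "(x, y) \<in> chain_graph n M (map f [0..<r]) \<longleftrightarrow>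
    x \<in> {1..n} \<and> y \<in> {1..n} \<and> weight {1..n} (\<lambda>_ _. 1) f x r y \<noteq> 0" (is "?l \<longleftrightarrow> ?r")
proof
  assume ?l
  then obtain p where xy: "x \<in> {1..n}" "y \<in> {1..n}" and p: "p 0 = x" "p r = y" "\<And>j. j < r \<Longrightarrow> (p j, p (Suc j)) \<in> M (f j)"
    by (auto simp: chain_graph_def)
  have e: "f j \<in> edge (p j) (p (Suc j))" if "j < r" for j
    using that p f by (auto simp: edge_event_def)
  have "(\<Prod>j<r. (1::ennreal)) \<le> weight {1..n} (\<lambda>_ _. 1) f x r (p r)"
    using edge_subset[OF e] e p(1) by (intro walk_weight_path_ge[where c = "\<lambda>_ _. 1"]) auto
  then show ?r using xy p by auto
next
  assume r: ?r
  then obtain p where "p 0 = x" "p r = y" "\<forall>j<r. p j \<in> {1..n} \<and> f j \<in> edge (p j) (p (Suc j))"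
    using walk_weight_nonzero_path by blast
  then show ?l using r by (auto simp: chain_graph_def edge_event_def intro!: exI[of _ p])
qed

lemma chain_graph_sets:
  "{us \<in> space (list_space (vec_space d)). (x, y) \<in> chain_graph n M us} \<in> sets (list_space (vec_space d))"
  unfolding sets_list_space
proof (intro CollectI conjI allI)
  show "{us \<in> space (list_space (vec_space d)). (x, y) \<in> chain_graph n M us} \<subseteq> lists (space (vec_space d))"
    by (auto simp: space_list_space)
  fix r :: nat
  let ?P = "\<Pi>\<^sub>M i\<in>{..<r}. vec_space d"
  have sp: "f j \<in> space (vec_space d)" if "f \<in> space ?P" "j < r" for f j
    using that by (auto simp: space_PiM)
  have "{f \<in> space ?P. map f [0..<r] \<in> {us \<in> space (list_space (vec_space d)). (x, y) \<in> chain_graph n M us}}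
     = {f \<in> space ?P. x \<in> {1..n} \<and> y \<in> {1..n} \<and> weight {1..n} (\<lambda>_ _. 1) f x r y \<noteq> 0}"
    using sp chain_graph_iff_walk_weight[of r _ x y] by (auto simp: space_list_space)
  also have "\<dots> \<in> sets ?P"
  proof -
    have [measurable]: "(\<lambda>f. weight {1..n} (\<lambda>_ _. 1) f x r y) \<in> borel_measurable ?P"
      by (rule walk_weight_measurable[where u = "\<lambda>f. f" and c = "\<lambda>f _ _. 1"]) auto
    show ?thesis by measurable
  qed
  finally show "{f \<in> space ?P. map f [0..<r] \<in> {us \<in> space (list_space (vec_space d)). (x, y) \<in> chain_graph n M us}} \<in> sets ?P" .
qed

lemma card_long_pairs_measurable [measurable]:
  "(\<lambda>us. real (card (long_pairs n d v M L us))) \<in> borel_measurable (list_space (vec_space d))"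
proof -
  let ?C = "\<lambda>x y. {us \<in> space (list_space (vec_space d)). (x, y) \<in> chain_graph n M us}"
  have [measurable]: "?C x y \<in> sets (list_space (vec_space d))" for x y by (rule chain_graph_sets)
  have "(\<lambda>us. \<Sum>x\<in>{1..n}. \<Sum>y\<in>{1..n}. of_bool (L \<le> (vnorm d (vminus d (v x) (v y)))\<^sup>2) * indicator (?C x y) us :: real)
    \<in> borel_measurable (list_space (vec_space d))" (is "?F \<in> _") by measurable
  moreover have "real (card (long_pairs n d v M L us)) = ?F us" if "us \<in> space (list_space (vec_space d))" for us
  proof -
    have "real (card (long_pairs n d v M L us)) = (\<Sum>e\<in>{1..n} \<times> {1..n}. of_bool (e \<in> long_pairs n d v M L us))"
      using long_pairs_subset[of n d v M L us] by (simp add: Int_absorb1 sum_of_bool_eq)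
    also have "\<dots> = ?F us"
      unfolding sum.cartesian_product using that
      by (intro sum.cong) (auto simp: long_pairs_def indicator_def)
    finally show ?thesis .
  qed
  ultimately show ?thesis by (subst measurable_cong) auto
qed

end

lemma vnorm_vminus_commute: "vnorm d (vminus d a b) = vnorm d (vminus d b a)"
  by (simp add: vnorm_def vminus_def L2_set_def power2_commute)

section \<open>Combining survival and confinement\<close>

locale stretched_cover = matching_family +
  fixes v :: "nat \<Rightarrow> rvec" and \<sigma> \<delta> :: real
  assumes \<sigma>: "\<sigma> > 0" and \<delta>: "\<delta> > 0"
    and stretch: "\<And>u x y. u \<in> edge x y \<Longrightarrow> \<sigma> \<le> vdot d (vminus d (v y) (v x)) u"
    and skew: "\<And>u x y. u \<in> space (vec_space d) \<Longrightarrow> (x, y) \<in> M u \<longleftrightarrow> (y, x) \<in> M (vuminus d u)"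
    and large: "\<delta> * real n \<le> (\<integral>u. real (card (M u)) \<partial>gaussian_vec d)"
begin

text \<open>Skew-symmetry together with invariance of the Gaussian under reflection. It supplies the
  symmetric weights for the dense core.\<close>

lemma edge_symmetric: "measure (gaussian_vec d) (edge x y) = measure (gaussian_vec d) (edge y x)"
proof -
  have "measure (gaussian_vec d) (edge x y) = measure (distr (gaussian_vec d) (vec_space d) (vuminus d)) (edge x y)"
    by (simp add: distr_gaussian_vec_vuminus)
  also have "\<dots> = measure (gaussian_vec d) (vuminus d -` edge x y \<inter> space (gaussian_vec d))"
    by (rule measure_distr) auto
  also have "vuminus d -` edge x y \<inter> space (gaussian_vec d) = edge y x"
    using skew[of _ y x] measurable_space[OF vuminus_measurable[of d]] by (auto simp: edge_event_def)
  finally show ?thesis .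
qed

lemma edge_irrefl: "edge x x = {}"
  using matching by (fastforce simp: edge_event_def directed_matching_def)

lemma sum_edges_ge: "\<delta> * real n \<le> (\<Sum>y\<in>{1..n}. \<Sum>x\<in>{1..n}. measure (gaussian_vec d) (edge x y))"
proof -
  interpret prob_space "gaussian_vec d" by (rule prob_space_gaussian_vec)
  have "real (card (M u)) = (\<Sum>y\<in>{1..n}. \<Sum>x\<in>{1..n}. indicator (edge x y) u)" if "u \<in> space (vec_space d)" for u
  proof -
    have "M u \<subseteq> {1..n} \<times> {1..n}" using matching[OF that] by (auto simp: directed_matching_def)
    then have "real (card (M u)) = (\<Sum>e\<in>{1..n} \<times> {1..n}. of_bool (e \<in> M u))"
      by (simp add: Int_absorb1 sum_of_bool_eq)
    also have "\<dots> = (\<Sum>x\<in>{1..n}. \<Sum>y\<in>{1..n}. indicator (edge x y) u)"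
      unfolding sum.cartesian_product using that by (intro sum.cong) (auto simp: edge_event_def)
    finally show ?thesis by (subst sum.swap)
  qed
  then have "(\<integral>u. real (card (M u)) \<partial>gaussian_vec d) = (\<integral>u. (\<Sum>y\<in>{1..n}. \<Sum>x\<in>{1..n}. indicator (edge x y) u) \<partial>gaussian_vec d)"
    by (intro Bochner_Integration.integral_cong) auto
  also have "\<dots> = (\<Sum>y\<in>{1..n}. \<Sum>x\<in>{1..n}. measure (gaussian_vec d) (edge x y))"
  proof -
    have i: "integrable (gaussian_vec d) (indicator (edge x y) :: _ \<Rightarrow> real)" for x y
      by (intro integrable_gaussian_vec_bounded[where B = 1]) auto
    have "edge x y \<inter> space (gaussian_vec d) = edge x y" for x y by (auto simp: edge_event_def)
    then show ?thesis using i by (simp add: Bochner_Integration.integral_sum)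
  qed
  finally show ?thesis using large by simp
qed

lemma dense_core_exists:
  obtains S where "S \<subseteq> {1..n}" "\<delta> / 2 * real n \<le> real (card S)"
    "\<And>y. y \<in> S \<Longrightarrow> \<delta> / 4 \<le> (\<Sum>x\<in>S. measure (gaussian_vec d) (edge x y))"
proof (rule dense_core[of "{1..n}" "\<lambda>x y. measure (gaussian_vec d) (edge x y)" \<delta>])
  interpret prob_space "gaussian_vec d" by (rule prob_space_gaussian_vec)
  fix S y assume "S \<subseteq> {1..n}"
  then have S: "finite S" by (rule finite_subset) simp
  have "(\<Sum>x\<in>S. measure (gaussian_vec d) (edge x y)) = measure (gaussian_vec d) (\<Union>x\<in>S. edge x y)"
    using S in_unique by (intro finite_measure_finite_Union[symmetric]) (fastforce simp: disjoint_family_on_def)+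
  then show "(\<Sum>x\<in>S. measure (gaussian_vec d) (edge x y)) \<le> 1" by simp
qed (use edge_symmetric edge_irrefl sum_edges_ge \<delta> that in auto)

end

context stretched_cover
begin

text \<open>A surviving walk from \<open>x\<close> either stays in the ball \<open>V x\<close>, and
  then one of the exceptional terms \<open>bad1\<close>, \<open>bad2\<close> is large, or some
  prefix ends outside and makes \<open>x\<close> the start of a long pair. Integrating this
  dichotomy compares the survival bound with the counts for all prefix lengths.\<close>

lemma expected_long_pairs_ge:
  fixes R :: nat and L :: real
  assumes R: "R \<ge> 1" and L: "L > 0"
  defines "\<rho> \<equiv> 1 - 1 / real R"
  shows "ennreal ((\<delta> / 4) ^ (2 * R * R) * (\<delta> / 2 * real n))
    \<le> (\<Sum>j\<in>{1..R}. \<integral>\<^sup>+g. ennreal (real (card (long_pairs n d v M L (map (ou d \<rho> g) [0..<j])))) \<partial>noise d (Suc R))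
      + ennreal (real n * (real n * real R * exp (- ((real R * \<sigma>)\<^sup>2 / (32 * L))) + exp (- ((real R * \<sigma>)\<^sup>2 / (16 * L)))))"
proof -
  let ?N = "noise d (Suc R)"
  let ?e1 = "exp (- ((real R * \<sigma>)\<^sup>2 / (32 * L)))" and ?e2 = "exp (- ((real R * \<sigma>)\<^sup>2 / (16 * L)))"
  define z where "z x y = vminus d (v y) (v x)" for x y
  define V where "V x = {y \<in> {1..n}. (vnorm d (z x y))\<^sup>2 < L}" for x
  \<comment> \<open>This value minimises both
    \<open>\<kappa>^2 * L / 2 - \<kappa> * (R * \<sigma> / 4)\<close>, the union-bound exponent, and
    \<open>\<kappa>^2 * L - \<kappa> * (R * \<sigma> / 2)\<close>, the martingale exponent, so it
    also serves as \<open>\<theta>\<close>.\<close>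
  define \<kappa> where "\<kappa> = real R * \<sigma> / (4 * L)"
  let ?s = "sqrt (1 - \<rho>\<^sup>2)"
  have kap: "\<kappa> \<ge> 0" using \<sigma> L by (simp add: \<kappa>_def)
  have rho: "\<bar>\<rho>\<bar> \<le> 1" using R by (auto simp: \<rho>_def)
  define bad1 where "bad1 x g = (\<Sum>y\<in>V x. \<Sum>k<R. ennreal (exp (\<kappa> * vdot d (z x y) (ou d \<rho> g k)) * exp (- \<kappa> * (real R * \<sigma> / 4))))" for x g
  define bad2 where "bad2 x g = ennreal (exp (- \<kappa> * (real R * \<sigma> / 2))) *
       (\<Sum>y\<in>V x. weight (V x) (\<lambda>k y. ennreal (exp (- (\<kappa> * ?s) * vdot d (z x y) (g k)))) (ou d \<rho> g) x R y)" for x g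
  define lp where "lp j g = long_pairs n d v M L (map (ou d \<rho> g) [0..<j])" for j g
  have fV: "finite (V x)" for x by (simp add: V_def)
  obtain S where S: "S \<subseteq> {1..n}" "\<delta> / 2 * real n \<le> real (card S)"
    "\<And>y. y \<in> S \<Longrightarrow> \<delta> / 4 \<le> (\<Sum>x\<in>S. measure (gaussian_vec d) (edge x y))"
    using dense_core_exists by blast
  have fS: "finite S" using S(1) by (rule finite_subset) simp
  define W where "W x g = (\<Sum>y\<in>S. weight S (\<lambda>_ _. 1) (ou d \<rho> g) x R y)" for x g
  have point1: "W x g \<le> bad1 x g + bad2 x g + (\<Sum>j\<in>{1..R}. of_bool (x \<in> fst ` lp j g))" if x: "x \<in> S" for x g
  proof (cases "W x g = 0")
    case False
    then obtain y where y: "y \<in> S" "weight S (\<lambda>_ _. 1) (ou d \<rho> g) x R y \<noteq> 0"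
      unfolding W_def by (rule sum.not_neutral_contains_not_neutral)
    from walk_weight_nonzero_path[OF y(2)] obtain p where p: "p 0 = x" "p R = y"
      "\<And>r. r < R \<Longrightarrow> p r \<in> S" "\<And>r. r < R \<Longrightarrow> ou d \<rho> g r \<in> edge (p r) (p (Suc r))" by blast
    have pS: "p r \<in> S" if "r \<le> R" for r using that p y by (cases "r = R") auto
    have "1 \<le> bad1 x g + bad2 x g + (\<Sum>j\<in>{1..R}. of_bool (x \<in> fst ` lp j g) :: ennreal)"
    proof (cases "\<forall>r\<le>R. p r \<in> V x")
      case True
      have "1 \<le> bad1 x g + bad2 x g"
        unfolding bad1_def bad2_def z_def \<rho>_def
        by (rule confined_walk_bound[where \<sigma> = \<sigma> and p = p])
           (use True p(1,4) fV R stretch \<sigma> kap in \<open>auto simp: \<rho>_def\<close>)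
      then show ?thesis by (rule add_increasing2[rotated]) simp
    next
      case False
      then obtain r where r: "r \<le> R" "p r \<notin> V x" by blast
      have n: "p r \<in> {1..n}" "x \<in> {1..n}" using pS[OF r(1)] S(1) x by auto
      have long: "L \<le> (vnorm d (z x (p r)))\<^sup>2" using r n by (auto simp: V_def)
      \<comment> \<open>A walk of length 0 has no displacement and \<open>L > 0\<close>, so the
        prefix length lies in the range \<open>{1..R}\<close> of the sum.\<close>
      have "r \<noteq> 0"
      proof
        assume "r = 0"
        then have "(vnorm d (z x (p r)))\<^sup>2 = 0"
          by (simp add: p z_def vnorm_def vminus_def L2_set_def)
        with long L show False by simp
      qed
      have "(x, p r) \<in> lp r g"
        unfolding lp_def long_pairs_def chain_graph_def
        using n p r(1) long
        by (auto simp: z_def vnorm_vminus_commute[of d "v x"] edge_event_def intro!: exI[of _ p])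
      then have "x \<in> fst ` lp r g" by force
      then have "1 = (of_bool (x \<in> fst ` lp r g) :: ennreal)" by simp
      also have "\<dots> \<le> (\<Sum>j\<in>{1..R}. of_bool (x \<in> fst ` lp j g) :: ennreal)"
        using r \<open>r \<noteq> 0\<close> by (intro member_le_sum) auto
      also have "\<dots> \<le> bad1 x g + bad2 x g + (\<Sum>j\<in>{1..R}. of_bool (x \<in> fst ` lp j g) :: ennreal)"
        by (rule add_increasing) auto
      finally show ?thesis .
    qed
    moreover have "W x g \<le> 1" unfolding W_def by (rule sum_walk_weight_le_1[OF fS])
    ultimately show ?thesis by (rule order.trans[rotated])
  qed simp
  have point: "(\<Sum>x\<in>S. W x g) \<le> (\<Sum>j\<in>{1..R}. ennreal (real (card (lp j g)))) + (\<Sum>x\<in>S. bad1 x g + bad2 x g)" for g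
  proof -
    have "(\<Sum>x\<in>S. W x g) \<le> (\<Sum>x\<in>S. bad1 x g + bad2 x g + (\<Sum>j\<in>{1..R}. of_bool (x \<in> fst ` lp j g)))"
      by (intro sum_mono point1)
    also have "\<dots> = (\<Sum>j\<in>{1..R}. \<Sum>x\<in>S. of_bool (x \<in> fst ` lp j g)) + (\<Sum>x\<in>S. bad1 x g + bad2 x g)"
      by (simp add: sum.distrib add.commute sum.swap[of _ S])
    also have "\<dots> \<le> (\<Sum>j\<in>{1..R}. ennreal (real (card (lp j g)))) + (\<Sum>x\<in>S. bad1 x g + bad2 x g)"
    proof (intro add_mono sum_mono order.refl)
      fix j
      \<comment> \<open>Different starting vertices belong to different pairs, so counting starts
        does not exceed counting pairs.\<close>
      have "(\<Sum>x\<in>S. of_bool (x \<in> fst ` lp j g) :: ennreal) = of_nat (card (S \<inter> fst ` lp j g))"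
        using fS by (simp add: sum_of_bool_eq)
      also have "\<dots> \<le> of_nat (card (lp j g))"
        unfolding of_nat_le_iff
        by (rule order.trans[OF card_mono card_image_le]) (auto simp: lp_def finite_long_pairs)
      finally show "(\<Sum>x\<in>S. of_bool (x \<in> fst ` lp j g) :: ennreal) \<le> ennreal (real (card (lp j g)))"
        by (simp add: ennreal_of_nat_eq_real_of_nat)
    qed
    finally show ?thesis .
  qed
  have m_ou[measurable]: "(\<lambda>g. ou d \<rho> g k) \<in> ?N \<rightarrow>\<^sub>M vec_space d" if "k \<le> R" for k
    using that by (intro ou_measurable) auto
  have m_lp: "(\<lambda>g. ennreal (real (card (lp j g)))) \<in> borel_measurable ?N" if "j \<in> {1..R}" for j
    unfolding lp_def using that
    by (intro measurable_compose[OF measurable_map_list_space[OF m_ou]] measurable_compose[OF card_long_pairs_measurable] measurable_ennreal) auto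
  have m_exp: "(\<lambda>g. ennreal (exp (\<kappa> * vdot d (z x y) (ou d \<rho> g k)) * exp (- \<kappa> * (real R * \<sigma> / 4)))) \<in> borel_measurable ?N"
    if "k < R" for x y k
    using that by (intro measurable_compose[OF _ measurable_ennreal] borel_measurable_times borel_measurable_exp
      borel_measurable_const vdot_measurable m_ou) auto
  have m_bad1: "bad1 x \<in> borel_measurable ?N" for x
    unfolding bad1_def[abs_def] by (intro borel_measurable_sum m_exp) auto
  have m_wt: "(\<lambda>g. weight V' (\<lambda>k y. ennreal (exp (\<mu> * vdot d (z x y) (g k)))) (ou d \<rho> g) x R y)
      \<in> borel_measurable (noise d K)" if "R \<le> K" for V' \<mu> x y K
    using that by (intro walk_weight_measurable ou_measurable)
      (auto intro!: noise_component vdot_measurable measurable_compose[OF _ measurable_ennreal] borel_measurable_exp borel_measurable_times)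
  have m_bad2: "bad2 x \<in> borel_measurable ?N" for x
    unfolding bad2_def[abs_def] by (intro borel_measurable_times_ennreal borel_measurable_sum m_wt borel_measurable_const) auto
  have m_W: "W x \<in> borel_measurable ?N" for x
    unfolding W_def[abs_def] by (intro borel_measurable_sum walk_weight_measurable m_ou) auto
  have i_bad1: "(\<integral>\<^sup>+g. bad1 x g \<partial>?N) \<le> ennreal (real n * real R * ?e1)" for x
  proof -
    have e1: "(\<integral>\<^sup>+g. ennreal (exp (\<kappa> * vdot d (z x y) (ou d \<rho> g k)) * exp (- \<kappa> * (real R * \<sigma> / 4))) \<partial>?N)
       \<le> ennreal (?e1)" if "k < R" "y \<in> V x" for y k
    proof -
      have [measurable]: "(\<lambda>g. vdot d (z x y) (ou d \<rho> g k)) \<in> borel_measurable ?N"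
        using that by (intro vdot_measurable m_ou) auto
      have "(\<integral>\<^sup>+g. ennreal (exp (\<kappa> * vdot d (z x y) (ou d \<rho> g k)) * exp (- \<kappa> * (real R * \<sigma> / 4))) \<partial>?N)
        = (\<integral>\<^sup>+g. ennreal (exp (\<kappa> * vdot d (z x y) (ou d \<rho> g k))) \<partial>?N) * ennreal (exp (- \<kappa> * (real R * \<sigma> / 4)))"
        by (subst nn_integral_multc[symmetric]) (auto simp: ennreal_mult)
      also have "\<dots> = ennreal (exp (\<kappa>\<^sup>2 * (vnorm d (z x y))\<^sup>2 / 2 - \<kappa> * (real R * \<sigma> / 4)))"
        using that by (subst nn_integral_exp_ou[OF rho]) (simp_all flip: ennreal_mult exp_add)
      also have "\<dots> \<le> ennreal (exp (\<kappa>\<^sup>2 * L / 2 - \<kappa> * (real R * \<sigma> / 4)))"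
        using that by (intro ennreal_leI) (auto simp: V_def intro!: mult_left_mono divide_right_mono)
      also have "\<kappa>\<^sup>2 * L / 2 - \<kappa> * (real R * \<sigma> / 4) = - ((real R * \<sigma>)\<^sup>2 / (32 * L))"
        using L by (simp add: \<kappa>_def power2_eq_square field_simps)
      finally show ?thesis .
    qed
    have "(\<integral>\<^sup>+g. bad1 x g \<partial>?N) = (\<Sum>y\<in>V x. \<integral>\<^sup>+g. (\<Sum>k<R. ennreal (exp (\<kappa> * vdot d (z x y) (ou d \<rho> g k)) * exp (- \<kappa> * (real R * \<sigma> / 4)))) \<partial>?N)"
      unfolding bad1_def by (intro nn_integral_sum borel_measurable_sum m_exp) simp
    also have "\<dots> = (\<Sum>y\<in>V x. \<Sum>k<R. \<integral>\<^sup>+g. ennreal (exp (\<kappa> * vdot d (z x y) (ou d \<rho> g k)) * exp (- \<kappa> * (real R * \<sigma> / 4))) \<partial>?N)"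
      by (intro sum.cong refl nn_integral_sum m_exp) simp
    also have "\<dots> \<le> (\<Sum>y\<in>V x. \<Sum>k<R. ennreal (?e1))"
      by (intro sum_mono e1) auto
    also have "\<dots> = ennreal (real (card (V x)) * real R * ?e1)"
      by (simp add: ennreal_of_nat_eq_real_of_nat ennreal_mult mult.assoc)
    also have "\<dots> \<le> ennreal (real n * real R * ?e1)"
    proof -
      have "V x \<subseteq> {1..n}" by (auto simp: V_def)
      then have "card (V x) \<le> n" using card_mono[of "{1..n}" "V x"] by simp
      then show ?thesis by (intro ennreal_leI mult_right_mono) auto
    qed
    finally show ?thesis .
  qed
  have i_bad2: "(\<integral>\<^sup>+g. bad2 x g \<partial>?N) \<le> ennreal (?e2)" for x
  proof -
    let ?h = "\<lambda>g. \<Sum>y\<in>V x. weight (V x) (\<lambda>k y. ennreal (exp (- (\<kappa> * ?s) * vdot d (z x y) (g k)))) (ou d \<rho> g) x R y"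
    have m: "?h \<in> borel_measurable (noise d K)" if "R \<le> K" for K
      using that by (intro borel_measurable_sum m_wt)
    have "(\<integral>\<^sup>+g. ?h g \<partial>?N) = (\<integral>\<^sup>+g. ?h g \<partial>noise d R)"
    proof (rule nn_integral_noise_extend)
      fix g g' :: "nat \<Rightarrow> rvec" assume "\<And>j. j < R \<Longrightarrow> g j = g' j"
      then show "?h g = ?h g'" by (intro sum.cong refl walk_weight_cong ou_cong) auto
    qed (use m in auto)
    also have "\<dots> \<le> ennreal (exp ((- (\<kappa> * ?s))\<^sup>2 * L / 2) ^ R)"
      by (rule confined_walk_weight_integral[OF fV]) (auto simp: V_def)
    also have "exp ((- (\<kappa> * ?s))\<^sup>2 * L / 2) ^ R = exp (real R * ((- (\<kappa> * ?s))\<^sup>2 * L / 2))"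
      by (rule exp_of_nat_mult[symmetric])
    \<comment> \<open>The variance over the whole walk:
      \<open>R * (1 - \<rho>^2) = 2 - 1/R\<close>.\<close>
    also have "ennreal \<dots> \<le> ennreal (exp (\<kappa>\<^sup>2 * L))"
    proof (intro ennreal_leI, subst exp_le_cancel_iff)
      have "\<rho>\<^sup>2 \<le> 1" using rho by (simp add: abs_square_le_1)
      then have "real R * ?s\<^sup>2 = real R * (1 - \<rho>\<^sup>2)" by simp
      also have "\<dots> = 2 - 1 / real R" using R by (simp add: \<rho>_def power2_eq_square field_simps)
      also have "\<dots> \<le> 2" by simp
      finally have "(\<kappa>\<^sup>2 * L / 2) * (real R * ?s\<^sup>2) \<le> (\<kappa>\<^sup>2 * L / 2) * 2" using L by (intro mult_left_mono) auto
      then show "real R * ((- (\<kappa> * ?s))\<^sup>2 * L / 2) \<le> \<kappa>\<^sup>2 * L"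
        by (simp add: power_mult_distrib mult_ac)
    qed
    finally have h: "(\<integral>\<^sup>+g. ?h g \<partial>?N) \<le> ennreal (exp (\<kappa>\<^sup>2 * L))" .
    have "(\<integral>\<^sup>+g. bad2 x g \<partial>?N) = ennreal (exp (- \<kappa> * (real R * \<sigma> / 2))) * (\<integral>\<^sup>+g. ?h g \<partial>?N)"
      unfolding bad2_def using m by (intro nn_integral_cmult) auto
    also have "\<dots> \<le> ennreal (exp (- \<kappa> * (real R * \<sigma> / 2))) * ennreal (exp (\<kappa>\<^sup>2 * L))"
      by (intro mult_left_mono h) auto
    also have "\<dots> = ennreal (exp (\<kappa>\<^sup>2 * L - \<kappa> * (real R * \<sigma> / 2)))"
      by (simp flip: ennreal_mult exp_add)
    also have "\<kappa>\<^sup>2 * L - \<kappa> * (real R * \<sigma> / 2) = - ((real R * \<sigma>)\<^sup>2 / (16 * L))"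
      using L by (simp add: \<kappa>_def power2_eq_square field_simps)
    finally show ?thesis .
  qed
  have "ennreal ((\<delta> / 4) ^ (2 * R * R) * (\<delta> / 2 * real n)) \<le> ennreal ((\<delta> / 4) ^ (2 * R * R) * real (card S))"
    using S(2) \<delta> by (intro ennreal_leI mult_left_mono) auto
  also have "\<dots> \<le> (\<Sum>x\<in>S. \<integral>\<^sup>+g. W x g \<partial>?N)"
    unfolding W_def \<rho>_def using S(3) fS R \<delta> by (intro expected_walks_ge) auto
  also have "\<dots> = (\<integral>\<^sup>+g. (\<Sum>x\<in>S. W x g) \<partial>?N)"
    by (rule nn_integral_sum[symmetric]) (rule m_W)
  also have "\<dots> \<le> (\<integral>\<^sup>+g. (\<Sum>j\<in>{1..R}. ennreal (real (card (lp j g)))) + (\<Sum>x\<in>S. bad1 x g + bad2 x g) \<partial>?N)"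
    by (intro nn_integral_mono point)
  also have "\<dots> = (\<Sum>j\<in>{1..R}. \<integral>\<^sup>+g. ennreal (real (card (lp j g))) \<partial>?N)
     + (\<Sum>x\<in>S. (\<integral>\<^sup>+g. bad1 x g \<partial>?N) + (\<integral>\<^sup>+g. bad2 x g \<partial>?N))"
  proof -
    have mb: "(\<lambda>g. bad1 x g + bad2 x g) \<in> borel_measurable ?N" for x
      using m_bad1 m_bad2 by measurable
    have "(\<integral>\<^sup>+g. (\<Sum>j\<in>{1..R}. ennreal (real (card (lp j g)))) + (\<Sum>x\<in>S. bad1 x g + bad2 x g) \<partial>?N)
      = (\<integral>\<^sup>+g. (\<Sum>j\<in>{1..R}. ennreal (real (card (lp j g)))) \<partial>?N)
        + (\<integral>\<^sup>+g. (\<Sum>x\<in>S. bad1 x g + bad2 x g) \<partial>?N)"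
      by (rule nn_integral_add) (intro borel_measurable_sum m_lp mb; assumption)+
    moreover have "(\<integral>\<^sup>+g. (\<Sum>j\<in>{1..R}. ennreal (real (card (lp j g)))) \<partial>?N)
      = (\<Sum>j\<in>{1..R}. \<integral>\<^sup>+g. ennreal (real (card (lp j g))) \<partial>?N)"
      by (rule nn_integral_sum) (rule m_lp)
    ultimately show ?thesis
      unfolding nn_integral_sum[OF mb] nn_integral_add[OF m_bad1 m_bad2] by (simp only:)
  qed
  also have "\<dots> \<le> (\<Sum>j\<in>{1..R}. \<integral>\<^sup>+g. ennreal (real (card (lp j g))) \<partial>?N)
     + (\<Sum>x\<in>{1..n}. ennreal (real n * real R * ?e1) + ennreal (?e2))"
    by (intro add_mono order.refl order.trans[OF sum_mono sum_mono2] i_bad1 i_bad2) (use S(1) in auto)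
  also have "(\<Sum>x\<in>{1..n}. ennreal (real n * real R * ?e1) + ennreal (?e2))
     = ennreal (real n * (real n * real R * ?e1 + ?e2))"
    by (simp add: ennreal_of_nat_eq_real_of_nat flip: ennreal_mult ennreal_plus)
  finally show ?thesis unfolding lp_def .
qed

end

section \<open>The sampler\<close>

definition block :: "nat \<Rightarrow> tape \<Rightarrow> nat \<Rightarrow> rvec" where
  "block d \<omega> k = (\<lambda>i\<in>{..<d}. fst (\<omega> (k * d + i)))"

text \<open>For \<open>u\<close> in \<open>[0, 1]\<close> this is the ceiling of
  \<open>u * R\<close>, written as the first counter value at which a loop can stop, since the
  machine has no rounding. The alternative \<open>R \<le> j\<close> bounds the loop on every tape,
  including values of \<open>u\<close> above 1.\<close>

definition sample_length :: "nat \<Rightarrow> real \<Rightarrow> nat" where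
  "sample_length R u = (LEAST j. R \<le> j \<or> u * real R \<le> real j)"

lemma sample_length_le: "sample_length R u \<le> R"
  unfolding sample_length_def by (rule Least_le) simp

lemma sample_length_stop: "R \<le> sample_length R u \<or> u * real R \<le> real (sample_length R u)"
  unfolding sample_length_def by (rule LeastI[of _ R]) simp

lemma sample_length_continue:
  assumes "j < sample_length R u" shows "j < R \<and> real j < u * real R"
  using not_less_Least[of j "\<lambda>j. R \<le> j \<or> u * real R \<le> real j"] assms
  by (auto simp: sample_length_def)

lemma sample_length_eqI:
  assumes "j \<in> {1..R}" "(real j - 1) / real R < u" "u \<le> real j / real R"
  shows "sample_length R u = j"
proof -
  have R: "real R > 0" using assms by simp
  have 1: "u * real R \<le> real j" "real j - 1 < u * real R" using assms R by (auto simp: field_simps)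
  have "sample_length R u \<le> j" unfolding sample_length_def by (rule Least_le) (use 1 in simp)
  moreover have "\<not> sample_length R u < j"
  proof
    assume "sample_length R u < j"
    then have "real (sample_length R u) \<le> real j - 1" "sample_length R u < R" using assms by auto
    then show False using sample_length_stop[of R u] 1 by linarith
  qed
  ultimately show ?thesis by simp
qed

definition rho_exp :: rexp where
  "rho_exp = RSub (RConst 1) (RDiv (RConst 1) (RNat (NVar 2)))"

text \<open>Variable 4 is kept at the product of the count and \<open>d\<close> by repeated
  addition, as natural numbers cannot be multiplied.\<close>

definition length_loop :: prog where
  "length_loop = While (TAnd (NLess (NVar 3) (NVar 2)) (RLess (RNat (NVar 3)) (RMul (Cell (NConst 0)) (RNat (NVar 2)))))
     (Seq (NAssign 3 (NAdd (NVar 3) (NConst 1))) (NAssign 4 (NAdd (NVar 4) (NVar 1))))"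

definition chain_loop :: prog where
  "chain_loop = While (NLess (NVar 5) (NVar 4))
     (Seq (DrawGauss (NVar 5)) (Seq
       (Cond (NLess (NVar 5) (NVar 1)) Skip
         (RAssign (NVar 5) (RAdd (RMul rho_exp (Cell (NSub (NVar 5) (NVar 1))))
            (RMul (RSqrt (RSub (RConst 1) (RMul rho_exp rho_exp))) (Cell (NVar 5))))))
       (NAssign 5 (NAdd (NVar 5) (NConst 1)))))"

text \<open>Variable 3 counts the output vectors, variable 4 the cells they occupy, and variable 5 the
  cells already filled.\<close>

definition sampler :: prog where
  "sampler = Seq (DrawUnif (NConst 0)) (Seq length_loop (Seq chain_loop (NAssign 0 (NVar 3))))"

text \<open>\<open>tpos\<close> is \<open>Suc m\<close> because the uniform draw took entry 0 of the
  tape and each filled cell took one more entry.\<close>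

definition sampler_state :: "nat \<Rightarrow> nat \<Rightarrow> nat \<Rightarrow> (nat \<Rightarrow> real) \<Rightarrow> nat \<Rightarrow> nat \<Rightarrow> ram_state" where
  "sampler_state n d R c r m =
     \<lparr>nvar = (\<lambda>_. 0)(0 := n, 1 := d, 2 := R, 3 := r, 4 := r * d, 5 := m), cell = c, tpos = Suc m\<rparr>"

text \<open>The induction descends from the final count. A round costs two assignments and one step
  of the loop itself.\<close>

lemma run_length_loop:
  assumes "j \<le> sample_length R (c 0)"
  shows "run \<omega> length_loop (sampler_state n d R c j 0)
    (Suc (3 * (sample_length R (c 0) - j))) (sampler_state n d R c (sample_length R (c 0)) 0)"
  using assms
proof (induction j rule: inc_induct)
  case base
  then show ?case
    unfolding length_loop_def using sample_length_stop[of R "c 0"]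
    by (auto intro!: run_WhileF[unfolded One_nat_def] simp: sampler_state_def)
next
  case (step j)
  let ?b = "Seq (NAssign 3 (NAdd (NVar 3) (NConst 1))) (NAssign 4 (NAdd (NVar 4) (NVar 1)))"
  have "run \<omega> ?b (sampler_state n d R c j 0) (1 + 1) (sampler_state n d R c (Suc j) 0)"
  proof (rule run_Seq)
    let ?s = "(sampler_state n d R c j 0)\<lparr>nvar := (nvar (sampler_state n d R c j 0))(3 := nval (NAdd (NVar 3) (NConst 1)) (sampler_state n d R c j 0))\<rparr>"
    show "run \<omega> (NAssign 3 (NAdd (NVar 3) (NConst 1))) (sampler_state n d R c j 0) 1 ?s" by (rule run_NAssign)
    have "sampler_state n d R c (Suc j) 0 = ?s\<lparr>nvar := (nvar ?s)(4 := nval (NAdd (NVar 4) (NVar 1)) ?s)\<rparr>"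
      by (auto simp: sampler_state_def fun_eq_iff)
    then show "run \<omega> (NAssign 4 (NAdd (NVar 4) (NVar 1))) ?s 1 (sampler_state n d R c (Suc j) 0)"
      using run_NAssign[of \<omega> 4 "NAdd (NVar 4) (NVar 1)" ?s] by simp
  qed
  moreover have "tval (TAnd (NLess (NVar 3) (NVar 2)) (RLess (RNat (NVar 3)) (RMul (Cell (NConst 0)) (RNat (NVar 2))))) (sampler_state n d R c j 0)"
    using sample_length_continue[OF step(2)] by (simp add: sampler_state_def)
  ultimately have "run \<omega> length_loop (sampler_state n d R c j 0)
     (Suc ((1 + 1) + Suc (3 * (sample_length R (c 0) - Suc j)))) (sampler_state n d R c (sample_length R (c 0)) 0)"
    using step(3) unfolding length_loop_def by (blast intro: run_WhileT)
  moreover have "Suc ((1 + 1) + Suc (3 * (sample_length R (c 0) - Suc j))) = Suc (3 * (sample_length R (c 0) - j))"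
    using step(2) by simp
  ultimately show ?case by (simp only:)
qed

definition chain_cells :: "nat \<Rightarrow> real \<Rightarrow> tape \<Rightarrow> (nat \<Rightarrow> real) \<Rightarrow> nat \<Rightarrow> nat \<Rightarrow> real" where
  "chain_cells d \<rho> \<omega> c m i = (if i < m then ou d \<rho> (block d (\<lambda>k. \<omega> (Suc k))) (i div d) (i mod d) else c i)"

text \<open>Cells \<open>m\<close> and \<open>m - d\<close> have the same remainder modulo
  \<open>d\<close> and consecutive quotients, that is, the same coordinate in consecutive
  vectors.\<close>

lemma chain_cells_Suc:
  assumes "d > 0"
  shows "chain_cells d \<rho> \<omega> c (Suc m) =
    (chain_cells d \<rho> \<omega> c m)(m := (if m < d then fst (\<omega> (Suc m))
       else \<rho> * chain_cells d \<rho> \<omega> c m (m - d) + sqrt (1 - \<rho>\<^sup>2) * fst (\<omega> (Suc m))))"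
proof -
  have "ou d \<rho> (block d (\<lambda>k. \<omega> (Suc k))) (m div d) (m mod d) = (if m < d then fst (\<omega> (Suc m))
       else \<rho> * chain_cells d \<rho> \<omega> c m (m - d) + sqrt (1 - \<rho>\<^sup>2) * fst (\<omega> (Suc m)))"
  proof (cases "m < d")
    case True then show ?thesis using assms by (simp add: block_def)
  next
    case False
    then have "m div d = Suc ((m - d) div d)" "m mod d = (m - d) mod d"
      using assms by (auto simp: le_div_geq le_mod_geq)
    moreover have "(m - d) mod d < d" using assms by simp
    moreover have "(m - d) div d * d + (m - d) mod d = m - d" by simp
    ultimately show ?thesis using False assms
      by (simp add: mix_def block_def chain_cells_def)
  qed
  then show ?thesis by (auto simp: chain_cells_def fun_eq_iff less_Suc_eq)
qed

text \<open>The factor 5 counts one draw, two steps for the conditional, the increment and the loop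
  itself.\<close>

lemma run_chain_loop:
  assumes "m \<le> r * d" "c' = chain_cells d (1 - 1 / real R) \<omega> c"
  shows "run \<omega> chain_loop (sampler_state n d R (c' m) r m)
    (Suc (5 * (r * d - m))) (sampler_state n d R (c' (r * d)) r (r * d))"
  using assms(1)
proof (induction m rule: inc_induct)
  case base
  show ?case unfolding chain_loop_def
    by (auto intro!: run_WhileF[unfolded One_nat_def] simp: sampler_state_def)
next
  case (step m)
  have d: "d > 0" using step(2) by (cases d) auto
  let ?s0 = "sampler_state n d R (c' m) r m"
  let ?a = "RAdd (RMul rho_exp (Cell (NSub (NVar 5) (NVar 1))))
            (RMul (RSqrt (RSub (RConst 1) (RMul rho_exp rho_exp))) (Cell (NVar 5)))"
  let ?s1 = "?s0\<lparr>cell := (cell ?s0)(nval (NVar 5) ?s0 := fst (\<omega> (tpos ?s0))), tpos := Suc (tpos ?s0)\<rparr>"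
  have 1: "run \<omega> (DrawGauss (NVar 5)) ?s0 1 ?s1" by (rule run_DrawGauss)
  let ?s2 = "?s1\<lparr>cell := c' (Suc m)\<rparr>"
  have 2: "run \<omega> (Cond (NLess (NVar 5) (NVar 1)) Skip (RAssign (NVar 5) ?a)) ?s1 (Suc 1) ?s2"
  proof (cases "m < d")
    case True
    then have e: "?s2 = ?s1" using d by (simp add: assms(2) chain_cells_Suc sampler_state_def)
    show ?thesis unfolding e
      by (rule run_CondT) (use True in \<open>simp_all add: sampler_state_def run_Skip[unfolded One_nat_def]\<close>)
  next
    case False
    \<comment> \<open>The draw into cell \<open>m\<close> must leave the cell read by the assignment
      unchanged.\<close>
    have "m - d \<noteq> m" using False d by auto
    then have e: "?s2 = ?s1\<lparr>cell := (cell ?s1)(nval (NVar 5) ?s1 := rval ?a ?s1)\<rparr>"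
      using d False by (simp add: assms(2) chain_cells_Suc sampler_state_def rho_exp_def power2_eq_square)
    show ?thesis unfolding e
      by (rule run_CondF, use False in \<open>simp add: sampler_state_def\<close>) (rule run_RAssign)
  qed
  have e3: "sampler_state n d R (c' (Suc m)) r (Suc m) = ?s2\<lparr>nvar := (nvar ?s2)(5 := nval (NAdd (NVar 5) (NConst 1)) ?s2)\<rparr>"
    by (auto simp: sampler_state_def fun_eq_iff)
  have 3: "run \<omega> (NAssign 5 (NAdd (NVar 5) (NConst 1))) ?s2 1 (sampler_state n d R (c' (Suc m)) r (Suc m))"
    unfolding e3 by (rule run_NAssign)
  have "tval (NLess (NVar 5) (NVar 4)) ?s0" using step(2) by (simp add: sampler_state_def)
  from run_WhileT[OF this run_Seq[OF 1 run_Seq[OF 2 3]] step(3)[unfolded chain_loop_def]]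
  have "run \<omega> chain_loop ?s0 (Suc (1 + (Suc 1 + 1) + Suc (5 * (r * d - Suc m)))) (sampler_state n d R (c' (r * d)) r (r * d))"
    unfolding chain_loop_def .
  moreover have "Suc (1 + (Suc 1 + 1) + Suc (5 * (r * d - Suc m))) = Suc (5 * (r * d - m))" using step(2) by simp
  ultimately show ?case by (simp only:)
qed

definition sample_list :: "nat \<Rightarrow> nat \<Rightarrow> tape \<Rightarrow> rvec list" where
  "sample_list d R \<omega> = map (ou d (1 - 1 / real R) (block d (\<lambda>k. \<omega> (Suc k)))) [0..<sample_length R (snd (\<omega> 0))]"

lemma ou_block_restrict: "(\<lambda>i\<in>{..<d}. ou d \<rho> (block d \<omega>) k i) = ou d \<rho> (block d \<omega>) k"
  by (cases k) (auto simp: block_def mix_def fun_eq_iff restrict_def)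

lemma run_sampler:
  obtains t s where "t \<le> 4 + 3 * R + 5 * (R * d)" "run \<omega> sampler (ram_init n d R) t s" "ram_output d s = sample_list d R \<omega>"
proof -
  let ?\<rho> = "1 - 1 / real R"
  define c where "c = (\<lambda>_ :: nat. 0 :: real)(0 := snd (\<omega> 0))"
  define c' where "c' = chain_cells d ?\<rho> \<omega> c"
  define r where "r = sample_length R (c 0)"
  have c'0: "c' 0 = c" by (simp add: c'_def chain_cells_def[abs_def])
  let ?i = "ram_init n d R"
  have e0: "sampler_state n d R c 0 0 = ?i\<lparr>cell := (cell ?i)(nval (NConst 0) ?i := snd (\<omega> (tpos ?i))), tpos := Suc (tpos ?i)\<rparr>"
    by (auto simp: sampler_state_def ram_init_def c_def fun_eq_iff)
  have 0: "run \<omega> (DrawUnif (NConst 0)) ?i 1 (sampler_state n d R c 0 0)"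
    unfolding e0 by (rule run_DrawUnif)
  have 1: "run \<omega> length_loop (sampler_state n d R c 0 0) (Suc (3 * (r - 0))) (sampler_state n d R c r 0)"
    unfolding r_def by (rule run_length_loop) simp
  have 2: "run \<omega> chain_loop (sampler_state n d R c r 0) (Suc (5 * (r * d - 0))) (sampler_state n d R (c' (r * d)) r (r * d))"
    using run_chain_loop[of 0 r d c' R \<omega> c n] by (simp add: c'_def[symmetric] c'0)
  let ?s = "sampler_state n d R (c' (r * d)) r (r * d)"
  let ?s' = "?s\<lparr>nvar := (nvar ?s)(0 := nval (NVar 3) ?s)\<rparr>"
  have 3: "run \<omega> (NAssign 0 (NVar 3)) ?s 1 ?s'" by (rule run_NAssign)
  let ?t = "1 + (Suc (3 * (r - 0)) + (Suc (5 * (r * d - 0)) + 1))"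
  have run: "run \<omega> sampler ?i ?t ?s'"
    unfolding sampler_def by (intro run_Seq[OF 0] run_Seq[OF 1] run_Seq[OF 2] 3)
  have rR: "r \<le> R" unfolding r_def by (rule sample_length_le)
  then have "r * d \<le> R * d" by simp
  with rR have t: "?t \<le> 4 + 3 * R + 5 * (R * d)" by linarith
  have "ram_output d ?s' = map (\<lambda>k. \<lambda>i\<in>{..<d}. c' (r * d) (k * d + i)) [0..<r]"
    by (simp add: ram_output_def sampler_state_def)
  also have "\<dots> = sample_list d R \<omega>"
    unfolding sample_list_def
  proof (rule map_cong)
    fix k assume "k \<in> set [0..<sample_length R (snd (\<omega> 0))]"
    then have k: "k < r" by (simp add: r_def c_def)
    have "c' (r * d) (k * d + i) = ou d ?\<rho> (block d (\<lambda>k. \<omega> (Suc k))) k i" if "i < d" for i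
    proof -
      have "k * d + i < Suc k * d" using that by simp
      also have "\<dots> \<le> r * d" using k by (intro mult_right_mono) auto
      finally show ?thesis using that by (simp add: c'_def chain_cells_def)
    qed
    then show "(\<lambda>i\<in>{..<d}. c' (r * d) (k * d + i)) = ou d ?\<rho> (block d (\<lambda>k. \<omega> (Suc k))) k"
      by (subst ou_block_restrict[symmetric]) (auto intro!: restrict_ext)
  qed (simp add: r_def c_def)
  finally show ?thesis using that[OF t run] by blast
qed

section \<open>The law of the random tape and of the sampled list\<close>

abbreviation tape_entry :: "(real \<times> real) measure" where
  "tape_entry \<equiv> std_gaussian \<Otimes>\<^sub>M uniform_measure lborel {0..1}"

lemma prob_space_uniform01: "prob_space (uniform_measure lborel {0..1::real})"
  by (rule prob_space_uniform_measure) auto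

lemma prob_space_tape_entry: "prob_space tape_entry"
  by (intro prob_space_pair prob_space_std_gaussian prob_space_uniform01)

lemma prob_space_random_tape: "prob_space random_tape"
  unfolding random_tape_def by (intro prob_space_PiM prob_space_tape_entry)

lemma tape_component [measurable]: "(\<lambda>\<omega>. \<omega> k) \<in> random_tape \<rightarrow>\<^sub>M tape_entry"
  unfolding random_tape_def by (rule measurable_component_singleton) simp

lemma tape_gauss [measurable]: "(\<lambda>\<omega>. fst (\<omega> k)) \<in> borel_measurable random_tape"
  using measurable_compose[OF tape_component[of k] measurable_fst] by (simp cong: measurable_cong_sets)

lemma tape_unif [measurable]: "(\<lambda>\<omega>. snd (\<omega> k)) \<in> borel_measurable random_tape"
  using measurable_compose[OF tape_component[of k] measurable_snd] by (simp cong: measurable_cong_sets)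

lemma block_measurable [measurable]: "(\<lambda>\<omega>. block d \<omega> k) \<in> random_tape \<rightarrow>\<^sub>M vec_space d"
  unfolding block_def vec_space_def by (intro measurable_restrict) measurable

lemma block_shift_measurable [measurable]:
  "(\<lambda>\<omega>. block d (\<lambda>i. \<omega> (Suc i)) k) \<in> random_tape \<rightarrow>\<^sub>M vec_space d"
  unfolding block_def vec_space_def by (intro measurable_restrict) measurable

lemma distr_block: "distr random_tape (vec_space d) (\<lambda>\<omega>. block d \<omega> k) = gaussian_vec d"
proof -
  have r: "distr random_tape (PiM {..<d} (\<lambda>_. tape_entry)) (\<lambda>\<omega>. \<lambda>i\<in>{..<d}. \<omega> (k * d + i)) = PiM {..<d} (\<lambda>_. tape_entry)"
    unfolding random_tape_def
    using distr_PiM_reindex[of UNIV "\<lambda>_. tape_entry" "\<lambda>i. k * d + i" "{..<d}"] prob_space_tape_entry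
    by (simp add: inj_on_def)
  have "distr (PiM {..<d} (\<lambda>_. tape_entry)) (PiM {..<d} (\<lambda>_. std_gaussian)) (compose {..<d} fst)
     = PiM {..<d} (\<lambda>_. distr tape_entry std_gaussian fst)"
    by (rule distr_PiM_finite_prob_space') (auto intro: prob_space_std_gaussian prob_space_tape_entry)
  also have "distr tape_entry std_gaussian fst = std_gaussian"
    by (rule prob_space.distr_pair_fst[OF prob_space_uniform01])
  finally have "gaussian_vec d = distr (distr random_tape (PiM {..<d} (\<lambda>_. tape_entry)) (\<lambda>\<omega>. \<lambda>i\<in>{..<d}. \<omega> (k * d + i))) (PiM {..<d} (\<lambda>_. std_gaussian)) (compose {..<d} fst)"
    unfolding gaussian_vec_def r ..
  also have "\<dots> = distr random_tape (PiM {..<d} (\<lambda>_. std_gaussian)) (compose {..<d} fst \<circ> (\<lambda>\<omega>. \<lambda>i\<in>{..<d}. \<omega> (k * d + i)))"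
  proof (rule distr_distr)
    show "compose {..<d} fst \<in> PiM {..<d} (\<lambda>_. tape_entry) \<rightarrow>\<^sub>M PiM {..<d} (\<lambda>_. std_gaussian)"
      unfolding compose_def by (intro measurable_restrict measurable_compose[OF measurable_component_singleton[where M = "\<lambda>_. tape_entry"] measurable_fst]) auto
    show "(\<lambda>\<omega>. \<lambda>i\<in>{..<d}. \<omega> (k * d + i)) \<in> random_tape \<rightarrow>\<^sub>M PiM {..<d} (\<lambda>_. tape_entry)"
      by (intro measurable_restrict tape_component)
  qed
  also have "\<dots> = distr random_tape (vec_space d) (\<lambda>\<omega>. block d \<omega> k)"
  proof (rule distr_cong)
    show "sets (PiM {..<d} (\<lambda>_. std_gaussian)) = sets (vec_space d)"
      using sets_gaussian_vec[of d] by (simp add: gaussian_vec_def)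
  qed (auto simp: compose_def block_def fun_eq_iff)
  finally show ?thesis ..
qed

text \<open>Blocks read disjoint intervals of the tape, hence are independent, and each has the law
  of a Gaussian vector.\<close>

lemma distr_blocks:
  assumes "K > 0"
  shows "distr random_tape (noise d K) (\<lambda>\<omega>. \<lambda>k\<in>{..<K}. block d \<omega> k) = noise d K"
proof -
  interpret T: prob_space random_tape by (rule prob_space_random_tape)
  have "T.indep_vars (\<lambda>_. tape_entry) (\<lambda>i \<omega>. \<omega> i) UNIV"
  proof (subst T.indep_vars_iff_distr_eq_PiM)
    have "distr random_tape tape_entry (\<lambda>\<omega>. \<omega> i) = tape_entry" for i
      unfolding random_tape_def using distr_PiM_component[of UNIV "\<lambda>_. tape_entry" i] prob_space_tape_entry by simp
    moreover have "distr random_tape random_tape (\<lambda>x. x) = random_tape" by (rule distr_id)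
    moreover have "(\<lambda>x. \<lambda>i\<in>UNIV. x i) = (\<lambda>x :: tape. x)" by (simp add: fun_eq_iff)
    ultimately show "distr random_tape (PiM UNIV (\<lambda>_. tape_entry)) (\<lambda>x. \<lambda>i\<in>UNIV. x i)
       = PiM UNIV (\<lambda>i. distr random_tape tape_entry (\<lambda>\<omega>. \<omega> i))"
      by (simp only:) (simp add: random_tape_def)
  qed auto
  moreover have "disjoint_family_on (\<lambda>k. {k * d..<Suc k * d}) {..<K}"
  proof (unfold disjoint_family_on_def, intro ballI impI)
    fix k l :: nat assume "k \<noteq> l"
    have "k * d + d \<le> l * d \<or> l * d + d \<le> k * d"
      using \<open>k \<noteq> l\<close> mult_right_mono[of "Suc k" l d] mult_right_mono[of "Suc l" k d] by (cases "k < l") auto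
    then show "{k * d..<Suc k * d} \<inter> {l * d..<Suc l * d} = {}" by auto
  qed
  ultimately have "T.indep_vars (\<lambda>k. PiM {k * d..<Suc k * d} (\<lambda>_. tape_entry)) (\<lambda>k \<omega>. restrict (\<lambda>i. \<omega> i) {k * d..<Suc k * d}) {..<K}"
    by (intro T.indep_vars_restrict) auto
  then have "T.indep_vars (\<lambda>_. vec_space d) (\<lambda>k \<omega>. block d (restrict (\<lambda>i. \<omega> i) {k * d..<Suc k * d}) k) {..<K}"
  proof (rule T.indep_vars_compose2)
    fix k
    show "(\<lambda>f. block d f k) \<in> PiM {k * d..<Suc k * d} (\<lambda>_. tape_entry) \<rightarrow>\<^sub>M vec_space d"
      unfolding block_def vec_space_def
    proof (rule measurable_restrict)
      fix i assume "i \<in> {..<d}"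
      then have "(\<lambda>f. f (k * d + i)) \<in> PiM {k * d..<Suc k * d} (\<lambda>_. tape_entry) \<rightarrow>\<^sub>M tape_entry"
        by (intro measurable_component_singleton) auto
      from measurable_compose[OF this measurable_fst]
      show "(\<lambda>f. fst (f (k * d + i))) \<in> borel_measurable (PiM {k * d..<Suc k * d} (\<lambda>_. tape_entry))"
        by (simp cong: measurable_cong_sets)
    qed
  qed
  moreover have "block d (restrict (\<lambda>i. \<omega> i) {k * d..<Suc k * d}) k = block d \<omega> k" for k and \<omega> :: tape
    by (auto simp: block_def fun_eq_iff restrict_def)
  ultimately have "T.indep_vars (\<lambda>_. vec_space d) (\<lambda>k \<omega>. block d \<omega> k) {..<K}" by simp
  then have "distr random_tape (PiM {..<K} (\<lambda>_. vec_space d)) (\<lambda>\<omega>. \<lambda>k\<in>{..<K}. block d \<omega> k) = noise d K"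
    using assms by (subst (asm) T.indep_vars_iff_distr_eq_PiM') (auto simp: distr_block noise_def)
  moreover have "distr random_tape (noise d K) (\<lambda>\<omega>. \<lambda>k\<in>{..<K}. block d \<omega> k)
     = distr random_tape (PiM {..<K} (\<lambda>_. vec_space d)) (\<lambda>\<omega>. \<lambda>k\<in>{..<K}. block d \<omega> k)"
    unfolding noise_def by (intro distr_cong sets_PiM_cong) auto
  ultimately show ?thesis by simp
qed

text \<open>Entry 0 decides the length and the later entries the vectors. Prepending an independent
  entry to a tape reproduces the tape law, which gives the factorisation.\<close>

lemma nn_integral_random_tape_split:
  assumes [measurable]: "\<phi> \<in> borel_measurable borel" and \<psi>: "\<psi> \<in> borel_measurable (noise d K)" and "K > 0"
  shows "(\<integral>\<^sup>+\<omega>. \<phi> (snd (\<omega> 0)) * \<psi> (\<lambda>k\<in>{..<K}. block d (\<lambda>i. \<omega> (Suc i)) k) \<partial>random_tape)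
    = (\<integral>\<^sup>+u. \<phi> u \<partial>uniform_measure lborel {0..1}) * (\<integral>\<^sup>+g. \<psi> g \<partial>noise d K)"
proof -
  interpret U: prob_space "uniform_measure lborel {0..1::real}" by (rule prob_space_uniform01)
  interpret G: prob_space std_gaussian by (rule prob_space_std_gaussian)
  interpret E: prob_space tape_entry by (rule prob_space_tape_entry)
  interpret T: prob_space random_tape by (rule prob_space_random_tape)
  interpret sequence_space tape_entry by standard
  have bm: "(\<lambda>\<omega>. \<lambda>k\<in>{..<K}. block d \<omega> k) \<in> random_tape \<rightarrow>\<^sub>M noise d K"
    unfolding noise_def by (intro measurable_restrict) (simp cong: measurable_cong_sets)
  have shift: "(\<lambda>\<omega> i. \<omega> (Suc i)) \<in> random_tape \<rightarrow>\<^sub>M random_tape"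
    unfolding random_tape_def by (rule measurable_PiM_single') (auto simp: space_PiM)
  note [measurable] = measurable_compose[OF measurable_compose[OF shift bm] \<psi>]
  have m2[measurable]: "(\<lambda>\<omega>. \<psi> (\<lambda>k\<in>{..<K}. block d \<omega> k)) \<in> borel_measurable random_tape"
    by (rule measurable_compose[OF bm \<psi>])
  have iter: "distr (tape_entry \<Otimes>\<^sub>M random_tape) random_tape (\<lambda>(s, \<omega>). case_nat s \<omega>) = random_tape"
    unfolding random_tape_def by (rule PiM_iter)
  have cm: "(\<lambda>(s, \<omega>). case_nat s \<omega>) \<in> tape_entry \<Otimes>\<^sub>M random_tape \<rightarrow>\<^sub>M random_tape"
    unfolding random_tape_def by measurable
  let ?H = "\<lambda>\<omega>. \<phi> (snd (\<omega> 0)) * \<psi> (\<lambda>k\<in>{..<K}. block d (\<lambda>i. \<omega> (Suc i)) k)"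
  have "(\<integral>\<^sup>+\<omega>. ?H \<omega> \<partial>random_tape) = (\<integral>\<^sup>+\<omega>. ?H \<omega> \<partial>distr (tape_entry \<Otimes>\<^sub>M random_tape) random_tape (\<lambda>(s, \<omega>). case_nat s \<omega>))"
    by (simp only: iter)
  also have "\<dots> = (\<integral>\<^sup>+p. ?H (case p of (s, \<omega>) \<Rightarrow> case_nat s \<omega>) \<partial>(tape_entry \<Otimes>\<^sub>M random_tape))"
  proof (subst nn_integral_distr[OF cm])
    have "?H \<in> borel_measurable random_tape" by measurable
    then show "?H \<in> borel_measurable (distr (tape_entry \<Otimes>\<^sub>M random_tape) random_tape (\<lambda>(s, \<omega>). case_nat s \<omega>))"
      by simp
  qed simp
  also have "\<dots> = (\<integral>\<^sup>+p. \<phi> (snd (fst p)) * \<psi> (\<lambda>k\<in>{..<K}. block d (snd p) k) \<partial>(tape_entry \<Otimes>\<^sub>M random_tape))"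
    by (intro nn_integral_cong) (auto split: prod.split)
  also have "\<dots> = (\<integral>\<^sup>+s. \<integral>\<^sup>+\<omega>. \<phi> (snd s) * \<psi> (\<lambda>k\<in>{..<K}. block d \<omega> k) \<partial>random_tape \<partial>tape_entry)"
  proof (subst T.nn_integral_fst[symmetric])
    have [measurable]: "(\<lambda>p. \<psi> (\<lambda>k\<in>{..<K}. block d (snd p) k)) \<in> borel_measurable (tape_entry \<Otimes>\<^sub>M random_tape)"
      by (rule measurable_compose[OF measurable_snd m2])
    show "(\<lambda>p. \<phi> (snd (fst p)) * \<psi> (\<lambda>k\<in>{..<K}. block d (snd p) k)) \<in> borel_measurable (tape_entry \<Otimes>\<^sub>M random_tape)"
      by measurable
  qed simp
  also have "\<dots> = (\<integral>\<^sup>+s. \<phi> (snd s) \<partial>tape_entry) * (\<integral>\<^sup>+\<omega>. \<psi> (\<lambda>k\<in>{..<K}. block d \<omega> k) \<partial>random_tape)"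
    by (simp add: nn_integral_cmult nn_integral_multc)
  also have "(\<integral>\<^sup>+s. \<phi> (snd s) \<partial>tape_entry) = (\<integral>\<^sup>+u. \<phi> u \<partial>uniform_measure lborel {0..1})"
    by (subst U.nn_integral_fst[symmetric]) (auto simp: nn_integral_cmult)
  also have "(\<integral>\<^sup>+\<omega>. \<psi> (\<lambda>k\<in>{..<K}. block d \<omega> k) \<partial>random_tape) = (\<integral>\<^sup>+g. \<psi> g \<partial>noise d K)"
  proof -
    have "(\<integral>\<^sup>+g. \<psi> g \<partial>noise d K) = (\<integral>\<^sup>+g. \<psi> g \<partial>distr random_tape (noise d K) (\<lambda>\<omega>. \<lambda>k\<in>{..<K}. block d \<omega> k))"
      by (simp only: distr_blocks[OF \<open>K > 0\<close>])
    also have "\<dots> = (\<integral>\<^sup>+\<omega>. \<psi> (\<lambda>k\<in>{..<K}. block d \<omega> k) \<partial>random_tape)"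
      using \<psi> by (subst nn_integral_distr[OF bm]) auto
    finally show ?thesis ..
  qed
  finally show ?thesis .
qed

text \<open>Length \<open>j\<close> is taken on the interval from \<open>(j - 1)/R\<close> to
  \<open>j/R\<close>, open on the left, which has measure \<open>1/R\<close>.\<close>

lemma emeasure_sample_length:
  assumes "j \<in> {1..R}"
  shows "ennreal (1 / real R) \<le> (\<integral>\<^sup>+u. indicator {u. sample_length R u = j} u \<partial>uniform_measure lborel {0..1})"
proof -
  have R: "real R > 0" "1 \<le> j" "j \<le> R" using assms by auto
  let ?A = "{(real j - 1) / real R<..real j / real R}"
  have "0 \<le> (real j - 1) / real R" "real j / real R \<le> 1" using R by auto
  then have sub: "?A \<subseteq> {0..1}" by auto
  have "ennreal (1 / real R) = ennreal (real j / real R - (real j - 1) / real R)"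
    using R by (simp add: field_simps)
  also have "\<dots> = emeasure lborel ?A" using R by (subst emeasure_lborel_Ioc) (auto simp: field_simps)
  also have "\<dots> = emeasure (uniform_measure lborel {0..1}) ?A"
    using sub by (subst emeasure_uniform_measure) (auto simp: Int_absorb1 divide_ennreal_def)
  also have "\<dots> = (\<integral>\<^sup>+u. indicator ?A u \<partial>uniform_measure lborel {0..1})"
    by simp
  also have "\<dots> \<le> (\<integral>\<^sup>+u. indicator {u. sample_length R u = j} u \<partial>uniform_measure lborel {0..1})"
    using sample_length_eqI[OF assms] by (intro nn_integral_mono) (auto simp: indicator_def)
  finally show ?thesis .
qed

lemma sample_length_measurable [measurable]: "sample_length R \<in> borel \<rightarrow>\<^sub>M count_space UNIV"
  unfolding sample_length_def[abs_def] by measurable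

lemma sample_list_measurable: "sample_list d R \<in> random_tape \<rightarrow>\<^sub>M list_space (vec_space d)"
proof -
  have ou: "(\<lambda>\<omega>. ou d \<rho> (block d (\<lambda>k. \<omega> (Suc k))) k) \<in> random_tape \<rightarrow>\<^sub>M vec_space d" for \<rho> k
  proof (induction k)
    case 0
    show ?case by simp
  next
    case (Suc k)
    note [measurable] = Suc
    show ?case unfolding ou.simps by measurable
  qed
  show ?thesis
    unfolding sample_list_def[abs_def]
    by (rule measurable_compose_countable[where g = "\<lambda>\<omega>. sample_length R (snd (\<omega> 0))"])
       (auto intro!: measurable_map_list_space ou)
qed

section \<open>The theorem\<close>

text \<open>Lowering \<open>\<delta>\<close> affects only largeness. The final arithmetic works with
  a value at most 1.\<close>

lemma matching_cover_imp_stretched_cover: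
  assumes "matching_cover n d v \<sigma> \<delta> M" "\<sigma> > 0" "\<delta>' > 0" "\<delta>' \<le> \<delta>"
  shows "stretched_cover n d M v \<sigma> \<delta>'"
proof
  have "\<delta>' * real n \<le> \<delta> * real n" using assms by (intro mult_right_mono) auto
  then show "\<delta>' * real n \<le> (\<integral>u. real (card (M u)) \<partial>gaussian_vec d)"
    using assms by (simp add: matching_cover_def)
qed (use assms in \<open>auto simp: matching_cover_def edge_event_def\<close>)

definition sample_law :: "nat \<Rightarrow> nat \<Rightarrow> rvec list measure" where
  "sample_law d R = distr random_tape (list_space (vec_space d)) (sample_list d R)"

context matching_family
begin

text \<open>Every length in \<open>{1..R}\<close> has probability at least \<open>1/R\<close> and is
  independent of the chain, so the sum over lengths is at most \<open>R\<close> times the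
  expectation under the sampled law.\<close>

lemma sum_long_pairs_le_sample:
  assumes "R \<ge> 1"
  shows "(\<Sum>j\<in>{1..R}. \<integral>\<^sup>+g. ennreal (real (card (long_pairs n d v M L (map (ou d (1 - 1 / real R) g) [0..<j])))) \<partial>noise d (Suc R))
    \<le> ennreal (real R) * (\<integral>\<^sup>+us. ennreal (real (card (long_pairs n d v M L us))) \<partial>sample_law d R)"
proof -
  let ?\<rho> = "1 - 1 / real R"
  let ?c = "\<lambda>us. ennreal (real (card (long_pairs n d v M L us)))"
  define \<psi> where "\<psi> j g = ?c (map (ou d ?\<rho> g) [0..<j])" for j g
  define \<phi> where "\<phi> j = (indicator {u. sample_length R u = j} :: real \<Rightarrow> ennreal)" for j
  let ?B = "\<lambda>\<omega>. \<lambda>k\<in>{..<Suc R}. block d (\<lambda>i. \<omega> (Suc i)) k"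
  have m\<phi>[measurable]: "\<phi> j \<in> borel_measurable borel" for j
    unfolding \<phi>_def by measurable
  have m\<psi>: "\<psi> j \<in> borel_measurable (noise d (Suc R))" if "j \<in> {1..R}" for j
    unfolding \<psi>_def[abs_def] using that
    by (intro measurable_compose[OF measurable_map_list_space[where S = "vec_space d"]] measurable_compose[OF card_long_pairs_measurable]
        measurable_ennreal ou_measurable) auto
  have bm: "(\<lambda>\<omega>. ?B \<omega>) \<in> random_tape \<rightarrow>\<^sub>M noise d (Suc R)"
    unfolding noise_def by (intro measurable_restrict) (simp cong: measurable_cong_sets)
  have m: "(\<lambda>\<omega>. \<phi> j (snd (\<omega> 0)) * \<psi> j (?B \<omega>)) \<in> borel_measurable random_tape" if "j \<in> {1..R}" for j
  proof -
    note [measurable] = measurable_compose[OF bm m\<psi>[OF that]]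
    show ?thesis by measurable
  qed
  have R: "ennreal (real R) * ennreal (1 / real R) = 1"
    using assms by (simp flip: ennreal_mult)
  have "(\<Sum>j\<in>{1..R}. \<integral>\<^sup>+g. \<psi> j g \<partial>noise d (Suc R))
    = ennreal (real R) * (\<Sum>j\<in>{1..R}. ennreal (1 / real R) * (\<integral>\<^sup>+g. \<psi> j g \<partial>noise d (Suc R)))"
    by (simp add: R mult.assoc[symmetric] flip: sum_distrib_left)
  also have "\<dots> \<le> ennreal (real R) * (\<Sum>j\<in>{1..R}. (\<integral>\<^sup>+u. \<phi> j u \<partial>uniform_measure lborel {0..1}) * (\<integral>\<^sup>+g. \<psi> j g \<partial>noise d (Suc R)))"
    unfolding \<phi>_def by (intro mult_left_mono sum_mono mult_right_mono emeasure_sample_length) auto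
  also have "(\<Sum>j\<in>{1..R}. (\<integral>\<^sup>+u. \<phi> j u \<partial>uniform_measure lborel {0..1}) * (\<integral>\<^sup>+g. \<psi> j g \<partial>noise d (Suc R)))
     = (\<Sum>j\<in>{1..R}. \<integral>\<^sup>+\<omega>. \<phi> j (snd (\<omega> 0)) * \<psi> j (?B \<omega>) \<partial>random_tape)"
    by (intro sum.cong refl nn_integral_random_tape_split[symmetric] m\<phi> m\<psi>) auto
  also have "\<dots> = (\<integral>\<^sup>+\<omega>. (\<Sum>j\<in>{1..R}. \<phi> j (snd (\<omega> 0)) * \<psi> j (?B \<omega>)) \<partial>random_tape)"
    by (rule nn_integral_sum[symmetric]) (rule m)
  also have "\<dots> \<le> (\<integral>\<^sup>+\<omega>. ?c (sample_list d R \<omega>) \<partial>random_tape)"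
  proof (intro nn_integral_mono)
    fix \<omega> :: tape
    define l where "l = sample_length R (snd (\<omega> 0))"
    \<comment> \<open>At most one summand is nonzero, and none is if the sampled length is
      0.\<close>
    have "(\<Sum>j\<in>{1..R}. \<phi> j (snd (\<omega> 0)) * \<psi> j (?B \<omega>)) = (\<Sum>j\<in>{1..R}. if j = l then \<psi> l (?B \<omega>) else 0)"
      by (intro sum.cong) (auto simp: \<phi>_def l_def indicator_def)
    also have "\<dots> \<le> \<psi> l (?B \<omega>)" by simp
    also have "map (ou d ?\<rho> (?B \<omega>)) [0..<l] = sample_list d R \<omega>"
      unfolding sample_list_def l_def using sample_length_le[of R "snd (\<omega> 0)"]
      by (intro map_cong refl ou_cong) auto
    then have "\<psi> l (?B \<omega>) = ?c (sample_list d R \<omega>)" by (simp add: \<psi>_def)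
    finally show "(\<Sum>j\<in>{1..R}. \<phi> j (snd (\<omega> 0)) * \<psi> j (?B \<omega>)) \<le> ?c (sample_list d R \<omega>)" .
  qed
  also have "\<dots> = (\<integral>\<^sup>+us. ?c us \<partial>sample_law d R)"
    unfolding sample_law_def by (subst nn_integral_distr[OF sample_list_measurable]) auto
  finally show ?thesis unfolding \<psi>_def by (simp add: mult_left_mono)
qed

end

lemma prob_space_sample_law: "prob_space (sample_law d R)"
  unfolding sample_law_def by (intro prob_space.prob_space_distr prob_space_random_tape sample_list_measurable)

lemma sample_law_length: "AE us in sample_law d R. length us \<le> R"
proof -
  have "{us \<in> space (list_space (vec_space d)). length us \<le> R} \<in> sets (list_space (vec_space d))"
    unfolding sets_list_space
  proof (intro CollectI conjI allI)
    fix r :: nat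
    have "f j \<in> space (vec_space d)" if "f \<in> space (\<Pi>\<^sub>M i\<in>{..<r}. vec_space d)" "j < r" for f j
      using that by (auto simp: space_PiM)
    then have "{f \<in> space (\<Pi>\<^sub>M i\<in>{..<r}. vec_space d). map f [0..<r] \<in> {us \<in> space (list_space (vec_space d)). length us \<le> R}}
      = (if r \<le> R then space (\<Pi>\<^sub>M i\<in>{..<r}. vec_space d) else {})"
      by (auto simp: space_list_space)
    then show "{f \<in> space (\<Pi>\<^sub>M i\<in>{..<r}. vec_space d). map f [0..<r] \<in> {us \<in> space (list_space (vec_space d)). length us \<le> R}}
      \<in> sets (\<Pi>\<^sub>M i\<in>{..<r}. vec_space d)"
      by simp
  qed (auto simp: space_list_space)
  then show ?thesis
    unfolding sample_law_def using sample_length_le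
    by (subst AE_distr_iff[OF sample_list_measurable]) (auto simp: sample_list_def)
qed

lemma samples_within_sampler:
  assumes "R \<le> n"
  shows "samples_within sampler n d R ((n + d + 2) ^ 6) (sample_law d R)"
  unfolding samples_within_def
proof (rule exI[of _ "sample_list d R"], intro conjI ballI)
  fix \<omega>
  obtain t s where ts: "t \<le> 4 + 3 * R + 5 * (R * d)" "run \<omega> sampler (ram_init n d R) t s" "ram_output d s = sample_list d R \<omega>"
    by (rule run_sampler)
  \<comment> \<open>The summand 2 gives \<open>m >= 2\<close>, so that \<open>m^4\<close> absorbs
    the constant 16; \<open>R <= n\<close> makes the bound one in \<open>n\<close> and
    \<open>d\<close> alone.\<close>
  define m where "m = n + d + 2"
  have "2 \<le> m" by (simp add: m_def)
  then have m2: "2 ^ 2 \<le> m ^ 2" and m4: "2 ^ 4 \<le> m ^ 4" by (intro power_mono; simp)+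
  have "m * 1 \<le> m * m" by (intro mult_left_mono) (auto simp: m_def)
  moreover have "R * d \<le> m * m" using assms by (intro mult_mono) (auto simp: m_def)
  moreover have "R \<le> m" using assms by (simp add: m_def)
  ultimately have "4 + 3 * R + 5 * (R * d) \<le> 16 * m ^ 2" using m2 unfolding power2_eq_square by linarith
  also have "\<dots> \<le> m ^ 4 * m ^ 2" using m4 by (intro mult_right_mono) auto
  also have "\<dots> = m ^ 6" by (simp flip: power_add)
  finally show "\<exists>t s. t \<le> (n + d + 2) ^ 6 \<and> run \<omega> sampler (ram_init n d R) t s \<and> sample_list d R \<omega> = ram_output d s"
    using ts order.trans[OF ts(1), of "m ^ 6"] unfolding m_def by (intro exI[of _ t] exI[of _ s]) auto
qed (rule sample_list_measurable sample_law_def)+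

text \<open>The three summands under the root in \<open>c0\<close> have separate uses:
  \<open>8 / \<delta>\<close> makes \<open>n\<close> large compared with
  \<open>1 / \<delta>\<close>, \<open>2 * l\<close> keeps the survival factor above
  \<open>1 / n\<close>, and \<open>1\<close> gives \<open>R <= n\<close>.\<close>

lemma parameter_bounds:
  fixes \<delta> :: real and n R :: nat
  assumes \<delta>: "0 < \<delta>" "\<delta> \<le> 1" and R: "1 \<le> R"
  defines "l \<equiv> ln (4 / \<delta>)"
  defines "c0 \<equiv> 1 / sqrt (8 / \<delta> + 2 * l + 1)"
  assumes Rn: "real R \<le> c0 * sqrt (ln (real n))"
  shows "0 \<le> l" "0 < ln (real n)" "(8 / \<delta> + 2 * l + 1) * (real R)\<^sup>2 \<le> ln (real n)" "R \<le> n"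
proof -
  show l: "0 \<le> l" using \<delta> by (simp add: l_def field_simps)
  define C where "C = 8 / \<delta> + 2 * l + 1"
  have C: "C \<ge> 1" using l \<delta> by (simp add: C_def)
  have R1: "1 \<le> real R" using R by simp
  have ln: "0 < ln (real n)"
  proof (rule ccontr)
    assume "\<not> 0 < ln (real n)"
    then have "c0 * sqrt (ln (real n)) \<le> 0" using C
      by (intro mult_nonneg_nonpos) (auto simp: c0_def C_def[symmetric])
    then show False using Rn R1 by linarith
  qed
  then show "0 < ln (real n)" .
  have "(real R)\<^sup>2 \<le> (c0 * sqrt (ln (real n)))\<^sup>2" using Rn by (intro power_mono) auto
  also have "\<dots> = ln (real n) / C" using ln C by (simp add: c0_def C_def[symmetric] power_mult_distrib power_divide)
  finally have le: "C * (real R)\<^sup>2 \<le> ln (real n)" using C by (simp add: field_simps)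
  then show "(8 / \<delta> + 2 * l + 1) * (real R)\<^sup>2 \<le> ln (real n)" by (simp add: C_def)
  have "real R * 1 \<le> real R * real R" using R1 by (intro mult_left_mono) auto
  also have "\<dots> \<le> C * (real R)\<^sup>2" using mult_right_mono[OF C, of "(real R)\<^sup>2"] by (simp add: power2_eq_square)
  also note le
  also have "ln (real n) \<le> real n"
    using ln by (cases "n = 0") (auto intro: order.trans[OF ln_le_minus_one])
  finally show "R \<le> n" by simp
qed

text \<open>The survival term is \<open>q * \<delta> * n / 2\<close>. Half of it pays for the
  exceptional walks and the other half bounds \<open>R * E\<close> from below.\<close>

lemma expectation_bound_arithmetic:
  fixes \<delta> \<sigma> E :: real and n R :: nat
  assumes \<delta>: "0 < \<delta>" "\<delta> \<le> 1" and \<sigma>: "\<sigma> > 0" and R: "1 \<le> R"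
  defines "l \<equiv> ln (4 / \<delta>)"
  defines "c0 \<equiv> 1 / sqrt (8 / \<delta> + 2 * l + 1)" and "L \<equiv> \<sigma>\<^sup>2 / 128 * (real R)\<^sup>2 / ln (real n)"
  assumes Rn: "real R \<le> c0 * sqrt (ln (real n))"
    and E: "(\<delta> / 4) ^ (2 * R * R) * (\<delta> / 2 * real n) \<le> real R * E
      + real n * (real n * real R * exp (- ((real R * \<sigma>)\<^sup>2 / (32 * L))) + exp (- ((real R * \<sigma>)\<^sup>2 / (16 * L))))"
  shows "exp (- (1 + 3 * l) * (real R)\<^sup>2) * real n \<le> E"
proof -
  note b = parameter_bounds[OF \<delta> R Rn[unfolded c0_def l_def], folded l_def]
  have R1: "1 \<le> real R" using R by simp
  then have R2: "1 \<le> (real R)\<^sup>2" by (simp add: one_le_power)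
  have n: "real n > 0" using b(2) by (cases "n = 0") auto
  have ln: "ln (real n) > 0" by (rule b)
  \<comment> \<open>The factor 128 in \<open>L\<close> yields the exponents \<open>4 ln n\<close>
    and \<open>8 ln n\<close>, enough to beat the union over vertices and times and the sum over
    starting points.\<close>
  have e1: "(real R * \<sigma>)\<^sup>2 / (32 * L) = 4 * ln (real n)" and e2: "(real R * \<sigma>)\<^sup>2 / (16 * L) = 8 * ln (real n)"
    using R1 \<sigma> ln by (simp_all add: L_def power2_eq_square field_simps)
  have x: "exp (- (real k * ln (real n))) = 1 / real n ^ k" for k
    using n by (simp add: exp_minus exp_of_nat_mult inverse_eq_divide)
  have n1: "1 \<le> real n" using n by simp
  have bad: "real n * (real n * real R * exp (- ((real R * \<sigma>)\<^sup>2 / (32 * L))) + exp (- ((real R * \<sigma>)\<^sup>2 / (16 * L)))) \<le> 2 / real n"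
  proof -
    have "real n * (real n * real R * exp (- (4 * ln (real n))) + exp (- (8 * ln (real n))))
        = real n * (real n * real R * (1 / real n ^ 4) + 1 / real n ^ 8)"
      using x[of 4] x[of 8] by simp
    also have "\<dots> \<le> real n * (real n * real n * (1 / real n ^ 4) + 1 / real n ^ 2)"
      using b(4) n n1 by (intro mult_left_mono add_mono mult_mono frac_le power_increasing) auto
    also have "\<dots> = 2 / real n" using n by (simp add: field_simps power2_eq_square power4_eq_xxxx)
    finally show ?thesis unfolding e1 e2 .
  qed
  define q where "q = (\<delta> / 4) ^ (2 * R * R)"
  have q: "q = exp (- (2 * l * (real R)\<^sup>2))"
  proof -
    have "\<delta> / 4 = exp (- l)" using \<delta> by (simp add: l_def ln_div exp_diff)
    then have "q = exp (real (2 * R * R) * (- l))" unfolding q_def by (simp only: exp_of_nat_mult)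
    also have "real (2 * R * R) * (- l) = - (2 * l * (real R)\<^sup>2)" by (simp add: power2_eq_square)
    finally show ?thesis .
  qed
  have split: "(8 / \<delta> + 2 * l + 1) * (real R)\<^sup>2 = 8 / \<delta> * (real R)\<^sup>2 + 2 * l * (real R)\<^sup>2 + (real R)\<^sup>2"
    by (simp add: algebra_simps)
  have nnl: "0 \<le> 8 / \<delta> * (real R)\<^sup>2" "0 \<le> 2 * l * (real R)\<^sup>2" using \<delta> b(1) by auto
  have "2 * l * (real R)\<^sup>2 \<le> ln (real n)" using b(3) nnl R2 unfolding split by linarith
  then have "exp (- ln (real n)) \<le> q" unfolding q by simp
  then have qn: "1 / real n \<le> q" using n by (simp add: exp_minus inverse_eq_divide)
  have "8 / \<delta> * 1 \<le> 8 / \<delta> * (real R)\<^sup>2" using R2 \<delta> by (intro mult_left_mono) auto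
  also have "\<dots> \<le> ln (real n)" using b(3) nnl R2 unfolding split by linarith
  also have "\<dots> \<le> real n" using ln_le_minus_one[OF n] by linarith
  finally have dn: "2 \<le> \<delta> / 4 * real n" using \<delta> by (simp add: field_simps)
  \<comment> \<open>The error \<open>2 / n\<close> is absorbed by \<open>dn\<close>, which comes
    from \<open>n >= 8 / \<delta>\<close>, and \<open>qn\<close>.\<close>
  have "2 / real n = 2 * (1 / real n)" by simp
  also have "\<dots> \<le> (\<delta> / 4 * real n) * q" using dn qn n by (intro mult_mono) auto
  finally have "q * (\<delta> / 4 * real n) \<le> real R * E"
    using E bad unfolding q_def[symmetric] by (simp add: algebra_simps)
  then have low: "q * (\<delta> / 4 * real n) / real R \<le> E" using R1 by (simp add: field_simps)
  \<comment> \<open>The exponent splits into \<open>R^2\<close> against the factor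
    \<open>1 / R\<close>, \<open>l * R^2\<close> against \<open>\<delta> / 4\<close>, and
    \<open>2 * l * R^2\<close>, which is \<open>q\<close> exactly.\<close>
  have "exp (- (1 + 3 * l) * (real R)\<^sup>2) = exp (- ((real R)\<^sup>2)) * exp (- (l * (real R)\<^sup>2)) * q"
    unfolding q exp_add[symmetric] by (simp add: algebra_simps)
  also have "\<dots> \<le> (1 / real R) * (\<delta> / 4) * q"
  proof (intro mult_right_mono mult_mono)
    have "real R \<le> exp (real R)" using exp_ge_add_one_self[of "real R"] by linarith
    also have "\<dots> \<le> exp ((real R)\<^sup>2)" using R1 by (simp add: power2_eq_square)
    finally show "exp (- ((real R)\<^sup>2)) \<le> 1 / real R" using R1 by (simp add: exp_minus field_simps)
    have "exp (- (l * (real R)\<^sup>2)) \<le> exp (- l)" using mult_left_mono[OF R2 b(1)] by simp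
    also have "exp (- l) = \<delta> / 4" using \<delta> by (simp add: l_def ln_div exp_diff)
    finally show "exp (- (l * (real R)\<^sup>2)) \<le> \<delta> / 4" .
  qed (use q in auto)
  finally have "exp (- (1 + 3 * l) * (real R)\<^sup>2) * real n \<le> (1 / real R) * (\<delta> / 4) * q * real n"
    by (intro mult_right_mono) auto
  also have "\<dots> = q * (\<delta> / 4 * real n) / real R" by (simp add: field_simps)
  also note low
  finally show ?thesis .
qed

theorem theorem3:
  fixes \<sigma> \<delta> :: real
  assumes "\<sigma> > 0" and "\<delta> > 0"
  shows "\<exists>c0>0. \<exists>c1>0. \<exists>c2>0. \<exists>(P :: prog) (k :: nat).
    \<forall>(n :: nat) (d :: nat) (R :: nat).
      1 \<le> R \<longrightarrow> real R \<le> c0 * sqrt (ln (real n)) \<longrightarrow>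
      (\<exists>(L :: real) (D :: rvec list measure).
        L \<ge> c1 * (real R)\<^sup>2 / ln (real n) \<and>
        prob_space D \<and> sets D = sets (list_space (vec_space d)) \<and>
        (AE us in D. length us \<le> R) \<and>
        samples_within P n d R ((n + d + 2) ^ k) D \<and>
        (\<forall>(v :: nat \<Rightarrow> rvec) M.
          (\<forall>x\<in>{1..n}. v x \<in> space (vec_space d)) \<longrightarrow>
          inj_on v {1..n} \<longrightarrow>
          (\<forall>x\<in>{1..n}. vnorm d (v x) \<le> 1) \<longrightarrow>
          (\<Sum>x=1..n. \<Sum>y=Suc x..n. (vnorm d (vminus d (v x) (v y)))\<^sup>2) = (real n)\<^sup>2 \<longrightarrow>
          matching_cover n d v \<sigma> \<delta> M \<longrightarrow>
          (\<integral>us. real (card {(x, y). (x, y) \<in> chain_graph n M us \<and>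
                                     (vnorm d (vminus d (v x) (v y)))\<^sup>2 \<ge> L}) \<partial>D)
            \<ge> exp (- c2 * (real R)\<^sup>2) * real n))"
proof -
  \<comment> \<open>Capping the density at 1 makes \<open>ln (4 / \<epsilon>)\<close> nonnegative,
    and the cover still has density \<open>\<epsilon>\<close>.\<close>
  define \<epsilon> where "\<epsilon> = min \<delta> 1"
  define l where "l = ln (4 / \<epsilon>)"
  define c0 where "c0 = 1 / sqrt (8 / \<epsilon> + 2 * l + 1)"
  define c1 where "c1 = \<sigma>\<^sup>2 / 128"
  have e: "0 < \<epsilon>" "\<epsilon> \<le> 1" "\<epsilon> \<le> \<delta>" using assms by (auto simp: \<epsilon>_def)
  have l: "0 \<le> l" using e by (simp add: l_def field_simps)
  have D0: "0 < 8 / \<epsilon> + 2 * l + 1" using e l by (intro add_nonneg_pos) auto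
  have main: "exp (- (1 + 3 * l) * (real R)\<^sup>2) * real n
      \<le> (\<integral>us. real (card (long_pairs n d v M (c1 * (real R)\<^sup>2 / ln (real n)) us)) \<partial>sample_law d R)"
    if R: "1 \<le> R" and Rn: "real R \<le> c0 * sqrt (ln (real n))" and mc: "matching_cover n d v \<sigma> \<delta> M"
    for n d R v M
  proof -
    define L where "L = c1 * (real R)\<^sup>2 / ln (real n)"
    have L: "L > 0"
      using parameter_bounds(2)[OF e(1,2) R Rn[unfolded c0_def l_def]] R assms by (simp add: L_def c1_def)
    interpret D: prob_space "sample_law d R" by (rule prob_space_sample_law)
    interpret stretched_cover n d M v \<sigma> \<epsilon>
      by (rule matching_cover_imp_stretched_cover[OF mc assms(1) e(1,3)])
    let ?c = "\<lambda>us. real (card (long_pairs n d v M L us))"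
    have cm: "?c \<in> borel_measurable (sample_law d R)" unfolding sample_law_def by simp
    have "?c us \<le> real (n * n)" for us using card_long_pairs_le of_nat_le_iff by blast
    then have int: "integrable (sample_law d R) ?c"
      using cm by (intro D.integrable_const_bound[where B = "real (n * n)"]) auto
    define E where "E = (\<integral>us. ?c us \<partial>sample_law d R)"
    have E0: "0 \<le> E" unfolding E_def by simp
    have nnE: "(\<integral>\<^sup>+us. ennreal (?c us) \<partial>sample_law d R) = ennreal E"
      unfolding E_def using int by (intro nn_integral_eq_integral) auto
    let ?b = "real n * (real n * real R * exp (- ((real R * \<sigma>)\<^sup>2 / (32 * L))) + exp (- ((real R * \<sigma>)\<^sup>2 / (16 * L))))"
    have "ennreal ((\<epsilon> / 4) ^ (2 * R * R) * (\<epsilon> / 2 * real n)) \<le> ennreal (real R) * ennreal E + ennreal ?b"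
      using order.trans[OF expected_long_pairs_ge[OF R L] add_right_mono[OF sum_long_pairs_le_sample[OF R]]]
      unfolding nnE .
    also have "\<dots> = ennreal (real R * E + ?b)"
      using E0 by (simp add: ennreal_mult ennreal_plus)
    finally have "(\<epsilon> / 4) ^ (2 * R * R) * (\<epsilon> / 2 * real n) \<le> real R * E + ?b"
      using E0 by (subst (asm) ennreal_le_iff) auto
    then have "exp (- (1 + 3 * l) * (real R)\<^sup>2) * real n \<le> E"
      unfolding l_def L_def c1_def
      by (rule expectation_bound_arithmetic[OF e(1,2) assms(1) R Rn[unfolded c0_def l_def]])
    then show ?thesis unfolding E_def L_def .
  qed
  have "c0 > 0" "c1 > 0" "1 + 3 * l > 0" using D0 l assms by (auto simp: c0_def c1_def)
  moreover have "samples_within sampler n d R ((n + d + 2) ^ 6) (sample_law d R)"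
    if "1 \<le> R" "real R \<le> c0 * sqrt (ln (real n))" for n d R
    using parameter_bounds(4)[OF e(1,2) that[unfolded c0_def l_def]] by (rule samples_within_sampler)
  ultimately show ?thesis
    using main[unfolded long_pairs_def] prob_space_sample_law sample_law_length
    by - (rule exI[of _ c0], rule conjI, assumption, rule exI[of _ c1], rule conjI, assumption,
      rule exI[of _ "1 + 3 * l"], rule conjI, assumption, rule exI[of _ sampler], rule exI[of _ 6],
      intro allI impI, rule exI, rule exI[of _ "sample_law _ _"],
      intro conjI allI impI order.refl, auto simp: sample_law_def)
qed

end
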